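(* There exists a simply connected $C(4)$--$T(4)$ small cancellation complex $X$ admitting a proper and cocompact action of a non-cyclic free abelian group $G$ such that $X$ contains no $G$-invariant flat plane.
   Context: Complexes. A combinatorial map of CW-complexes is a continuous map whose restriction to every open cell is a homeomorphism onto an open cell. A 2-complex is a 2-dimensional CW-complex in which the attaching map of each 2-cell is combinatorial for a suitable subdivision of the circle; attaching maps are assumed to be immersions (locally injective). A polygon is a 2-disc with $n$ 0-cells, $n$ 1-cells and one 2-cell; a 2-cell of $X$ is regarded as a map $R\to X$ with $R$ a polygon. A path $P\to X$ is a combinatorial map from a subdivided interval or a single 0-cell. Actions are by combinatorial automorphisms. Pieces. A non-trivial path $P\to X$ is a piece if there are 2-cells $R_1,R_2$ such that $P\to X$ factors as $P\to \partial R_1\to X$ and as $P\to \partial R_2\to X$, but there is no homeomorphism $\partial R_1\to\partial R_2$ making the resulting square (together with the maps from $P$ and to $X$) commute. Small cancellation. $X$ is $C(p)$ if for each 2-cell $R\to X$ the attaching map $\partial R\to X$ is not a concatenation of fewer than $p$ pieces. A disc diagram is a contractible finite 2-complex $D$ with a specified embedding in the plane. A combinatorial map $D\to X$ is reduced if for every piece $P\to D$ the composition $P\to D\to X$ is a piece in the image of $D$ in $X$. The valence $\delta(v)$ of a 0-cell is the number of ends of 1-cells incident to it. $X$ is $T(q)$ if there is no reduced map $D\to X$ from a disc diagram $D$ containing an internal 0-cell $v$ with $2<\delta(v)<q$. $X$ is $C(4)$--$T(4)$ if it is both $C(4)$ and $T(4)$. Flat planes. A flat plane (in the $C(4)$--$T(4)$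 setting) is a $C(4)$--$T(4)$ complex homeomorphic to the Euclidean plane such that each closed 2-cell intersects exactly eight neighboring closed 2-cells, four of them in a single piece and four in a vertex, and each vertex of valence at least three has valence exactly four (so that after ignoring 0-cells of valence two it is the regular square tiling of the plane). "$X$ contains a $G$-invariant flat plane" means that some $G$-invariant subcomplex of $X$ is a flat plane. *)

theory Defs
  imports
    "HOL-Analysis.Analysis"
    "HOL-Library.Extended_Nat"
    "HOL-Algebra.Group_Action"
    "HOL-Algebra.Elementary_Groups"
    "HOL-Algebra.Free_Abelian_Groups"
begin

section \<open>CW-complexes of dimension at most two\<close>

text \<open>
  The 1- and 2-cells are given by their characteristic maps, defined on the closed unit interval
  and on the closed unit disc of the complex plane; values elsewhere are irrelevant.
\<close>

record 'a cell_complex =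
  cw_space :: "'a topology"
  cells0 :: "'a set"
  cells1 :: "(real \<Rightarrow> 'a) set"
  cells2 :: "(complex \<Rightarrow> 'a) set"

definition open_cells :: "'a cell_complex \<Rightarrow> 'a set set" where
  "open_cells X =
     (\<lambda>v. {v}) ` cells0 X \<union> (\<lambda>e. e ` {0<..<1}) ` cells1 X \<union> (\<lambda>f. f ` ball 0 1) ` cells2 X"

text \<open>
  Whitehead's definition. The two injectivity clauses exclude two characteristic maps for the same
  open cell.
\<close>

definition cw_complex :: "'a cell_complex \<Rightarrow> bool" where
  "cw_complex X \<longleftrightarrow>
     Hausdorff_space (cw_space X) \<and>
     disjoint (open_cells X) \<and> \<Union>(open_cells X) = topspace (cw_space X) \<and>
     inj_on (\<lambda>e. e ` {0<..<1}) (cells1 X) \<and> inj_on (\<lambda>f. f ` ball 0 1) (cells2 X) \<and>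
     (\<forall>e\<in>cells1 X.
        continuous_map (top_of_set {0..1}) (cw_space X) e \<and>
        homeomorphic_map (top_of_set {0<..<1}) (subtopology (cw_space X) (e ` {0<..<1})) e \<and>
        e 0 \<in> cells0 X \<and> e 1 \<in> cells0 X) \<and>
     (\<forall>f\<in>cells2 X.
        continuous_map (top_of_set (cball 0 1)) (cw_space X) f \<and>
        homeomorphic_map (top_of_set (ball 0 1)) (subtopology (cw_space X) (f ` ball 0 1)) f \<and>
        (\<exists>\<C>. finite \<C> \<and> \<C> \<subseteq> (\<lambda>v. {v}) ` cells0 X \<union> (\<lambda>e. e ` {0<..<1}) ` cells1 X \<and>
             f ` sphere 0 1 \<subseteq> \<Union>\<C>)) \<and>
     (\<forall>C\<subseteq>topspace (cw_space X).
        (\<forall>e\<in>cells1 X. closedin (cw_space X) (C \<inter> e ` {0..1})) \<and>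
        (\<forall>f\<in>cells2 X. closedin (cw_space X) (C \<inter> f ` cball 0 1)) \<longrightarrow>
        closedin (cw_space X) C)"

definition combinatorial_map ::
    "'a cell_complex \<Rightarrow> 'b cell_complex \<Rightarrow> ('a \<Rightarrow> 'b) \<Rightarrow> bool" where
  "combinatorial_map X Y h \<longleftrightarrow>
     continuous_map (cw_space X) (cw_space Y) h \<and>
     (\<forall>c\<in>open_cells X. \<exists>d\<in>open_cells Y.
        homeomorphic_map (subtopology (cw_space X) c) (subtopology (cw_space Y) d) h)"

definition combinatorial_automorphism :: "'a cell_complex \<Rightarrow> ('a \<Rightarrow> 'a) \<Rightarrow> bool" where
  "combinatorial_automorphism X h \<longleftrightarrow>
     homeomorphic_map (cw_space X) (cw_space X) h \<and> combinatorial_map X X h"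

text \<open>A CW-structure of dimension at most one on the given space (an interval or a circle).\<close>

definition subdivision :: "'a topology \<Rightarrow> 'a cell_complex \<Rightarrow> bool" where
  "subdivision T K \<longleftrightarrow> cw_complex K \<and> cw_space K = T \<and> cells2 K = {}"

definition two_complex :: "'a cell_complex \<Rightarrow> bool" where
  "two_complex X \<longleftrightarrow>
     cw_complex X \<and> cells2 X \<noteq> {} \<and>
     (\<forall>f\<in>cells2 X.
        (\<exists>K. subdivision (top_of_set (sphere 0 1)) K \<and> combinatorial_map K X f) \<and>
        (\<forall>z\<in>sphere 0 1. \<exists>U. open U \<and> z \<in> U \<and> inj_on f (U \<inter> sphere 0 1)))"

definition is_subcomplex :: "'a set \<Rightarrow> 'a cell_complex \<Rightarrow> bool" where
  "is_subcomplex S X \<longleftrightarrow>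
     S \<subseteq> topspace (cw_space X) \<and>
     (\<forall>c\<in>open_cells X. c \<inter> S \<noteq> {} \<longrightarrow> cw_space X closure_of c \<subseteq> S)"

definition restrict_complex :: "'a cell_complex \<Rightarrow> 'a set \<Rightarrow> 'a cell_complex" where
  "restrict_complex X S =
     \<lparr>cw_space = subtopology (cw_space X) S,
      cells0 = cells0 X \<inter> S,
      cells1 = {e \<in> cells1 X. e ` {0<..<1} \<subseteq> S},
      cells2 = {f \<in> cells2 X. f ` ball 0 1 \<subseteq> S}\<rparr>"

definition image_complex ::
    "'d cell_complex \<Rightarrow> 'a cell_complex \<Rightarrow> ('d \<Rightarrow> 'a) \<Rightarrow> 'a cell_complex" where
  "image_complex D X h = restrict_complex X (h ` topspace (cw_space D))"

text \<open>Number of ends of 1-cells at a 0-cell: a loop at \<open>v\<close> counts twice.\<close>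

definition valence :: "'a cell_complex \<Rightarrow> 'a \<Rightarrow> enat" where
  "valence X v =
     (let E = {(e, t). e \<in> cells1 X \<and> t \<in> {0, 1} \<and> e t = v}
      in if finite E then enat (card E) else \<infinity>)"


section \<open>Pieces and small cancellation\<close>

text \<open>A path whose domain is a subdivided interval, hence non-trivial.\<close>

definition nontrivial_path :: "'a cell_complex \<Rightarrow> (real \<Rightarrow> 'a) \<Rightarrow> bool" where
  "nontrivial_path X p \<longleftrightarrow>
     (\<exists>K. subdivision (top_of_set {0..1}) K \<and> combinatorial_map K X p)"

text \<open>
  A 2-cell \<open>R \<rightarrow> X\<close> is a characteristic map \<open>f\<close>, and \<open>\<partial>R \<rightarrow> X\<close> is its restriction to the unit circle,
  subdivided by the preimages of the 0-cells. A continuous lift \<open>a\<close> of the combinatorial map \<open>p\<close>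
  through \<open>\<partial>R \<rightarrow> X\<close> is automatically combinatorial.
\<close>

definition factors_through :: "(real \<Rightarrow> 'a) \<Rightarrow> (complex \<Rightarrow> 'a) \<Rightarrow> (real \<Rightarrow> complex) \<Rightarrow> bool" where
  "factors_through p f a \<longleftrightarrow>
     continuous_map (top_of_set {0..1}) (top_of_set (sphere 0 1)) a \<and>
     (\<forall>t\<in>{0..1}. f (a t) = p t)"

definition piece :: "'a cell_complex \<Rightarrow> (real \<Rightarrow> 'a) \<Rightarrow> bool" where
  "piece X p \<longleftrightarrow>
     nontrivial_path X p \<and>
     (\<exists>f1\<in>cells2 X. \<exists>f2\<in>cells2 X. \<exists>a1 a2.
        factors_through p f1 a1 \<and> factors_through p f2 a2 \<and>
        \<not> (\<exists>h. homeomorphic_map (top_of_set (sphere 0 1)) (top_of_set (sphere 0 1)) h \<and>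
               (\<forall>t\<in>{0..1}. h (a1 t) = a2 t) \<and>
               (\<forall>z\<in>sphere 0 1. f2 (h z) = f1 z)))"

text \<open>
  The boundary circle is cut at the angles \<open>\<theta> 0 < \<dots> < \<theta> n = \<theta> 0 + 2 * pi\<close> into \<open>n\<close> arcs.
\<close>

definition concat_of_pieces :: "'a cell_complex \<Rightarrow> (complex \<Rightarrow> 'a) \<Rightarrow> nat \<Rightarrow> bool" where
  "concat_of_pieces X f n \<longleftrightarrow>
     (\<exists>\<theta> :: nat \<Rightarrow> real.
        (\<forall>k<n. \<theta> k < \<theta> (Suc k)) \<and> \<theta> n = \<theta> 0 + 2 * pi \<and>
        (\<forall>k<n. piece X (\<lambda>t. f (cis (linepath (\<theta> k) (\<theta> (Suc k)) t)))))"

definition C_condition :: "nat \<Rightarrow> 'a cell_complex \<Rightarrow> bool" where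
  "C_condition p X \<longleftrightarrow> (\<forall>f\<in>cells2 X. \<forall>n<p. \<not> concat_of_pieces X f n)"

text \<open>The specified embedding in the plane is realised as an inclusion.\<close>

definition disc_diagram :: "complex cell_complex \<Rightarrow> bool" where
  "disc_diagram D \<longleftrightarrow>
     two_complex D \<and> finite (cells0 D) \<and> finite (cells1 D) \<and> finite (cells2 D) \<and>
     cw_space D = top_of_set (topspace (cw_space D)) \<and>
     contractible_space (cw_space D)"

definition reduced_map ::
    "'d cell_complex \<Rightarrow> 'a cell_complex \<Rightarrow> ('d \<Rightarrow> 'a) \<Rightarrow> bool" where
  "reduced_map D X h \<longleftrightarrow>
     combinatorial_map D X h \<and> (\<forall>p. piece D p \<longrightarrow> piece (image_complex D X h) (h \<circ> p))"

definition T_condition :: "nat \<Rightarrow> 'a cell_complex \<Rightarrow> bool" where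
  "T_condition q X \<longleftrightarrow>
     \<not> (\<exists>D h. disc_diagram D \<and> reduced_map D X h \<and>
          (\<exists>v\<in>cells0 D. v \<in> interior (topspace (cw_space D)) \<and>
             2 < valence D v \<and> valence D v < enat q))"

definition C4_T4_complex :: "'a cell_complex \<Rightarrow> bool" where
  "C4_T4_complex X \<longleftrightarrow> two_complex X \<and> C_condition 4 X \<and> T_condition 4 X"

definition neighbours :: "'a cell_complex \<Rightarrow> (complex \<Rightarrow> 'a) \<Rightarrow> (complex \<Rightarrow> 'a) set" where
  "neighbours X f = {g \<in> cells2 X. g \<noteq> f \<and> f ` cball 0 1 \<inter> g ` cball 0 1 \<noteq> {}}"

definition flat_plane :: "'a cell_complex \<Rightarrow> bool" where
  "flat_plane E \<longleftrightarrow>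
     C4_T4_complex E \<and>
     cw_space E homeomorphic_space (euclidean :: complex topology) \<and>
     (\<forall>f\<in>cells2 E.
        card (neighbours E f) = 8 \<and>
        card {g \<in> neighbours E f. \<exists>p. piece E p \<and> f ` cball 0 1 \<inter> g ` cball 0 1 = p ` {0..1}} = 4 \<and>
        card {g \<in> neighbours E f. \<exists>v\<in>cells0 E. f ` cball 0 1 \<inter> g ` cball 0 1 = {v}} = 4) \<and>
     (\<forall>v\<in>cells0 E. 3 \<le> valence E v \<longrightarrow> valence E v = 4)"


section \<open>Simple connectivity and group actions\<close>

definition simply_connected_space :: "'a topology \<Rightarrow> bool" where
  "simply_connected_space X \<longleftrightarrow>
     path_connected_space X \<and>
     (\<forall>p. pathin X p \<and> p 0 = p 1 \<longrightarrow>
        (\<exists>c\<in>topspace X.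
           homotopic_with (\<lambda>q. q 0 = q 1) (top_of_set {0..1}) X p (\<lambda>_. c)))"

definition free_abelian :: "('g, 'm) monoid_scheme \<Rightarrow> bool" where
  "free_abelian G \<longleftrightarrow> group G \<and> (\<exists>S :: 'g set. G \<cong> free_Abelian_group S)"

definition combinatorial_action ::
    "('g, 'm) monoid_scheme \<Rightarrow> 'a cell_complex \<Rightarrow> ('g \<Rightarrow> 'a \<Rightarrow> 'a) \<Rightarrow> bool" where
  "combinatorial_action G X \<phi> \<longleftrightarrow>
     group_action G (topspace (cw_space X)) \<phi> \<and>
     (\<forall>g\<in>carrier G. combinatorial_automorphism X (\<phi> g))"

definition proper_action ::
    "('g, 'm) monoid_scheme \<Rightarrow> 'a cell_complex \<Rightarrow> ('g \<Rightarrow> 'a \<Rightarrow> 'a) \<Rightarrow> bool" where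
  "proper_action G X \<phi> \<longleftrightarrow>
     (\<forall>K. compactin (cw_space X) K \<longrightarrow> finite {g \<in> carrier G. \<phi> g ` K \<inter> K \<noteq> {}})"

definition cocompact_action ::
    "('g, 'm) monoid_scheme \<Rightarrow> 'a cell_complex \<Rightarrow> ('g \<Rightarrow> 'a \<Rightarrow> 'a) \<Rightarrow> bool" where
  "cocompact_action G X \<phi> \<longleftrightarrow>
     (\<exists>K. compactin (cw_space X) K \<and> (\<Union>g\<in>carrier G. \<phi> g ` K) = topspace (cw_space X))"

end

theory Submission
  imports Defs
begin

text \<open>
  Tile the plane by the rectangles \<open>[4i, 4i + 4] \<times> [j, j + 1]\<close> and fold every horizontal line \<open>y = j\<close> at
  the points \<open>x = 4i\<close>, identifying \<open>(4i + u, j)\<close> with \<open>(4i - u, j)\<close> for \<open>\<bar>u\<bar> \<le> 1\<close>. At every lattice point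
  the two folded unit segments become one edge, a ``hair'', so each tile becomes an octagon.

  The folding lengthens the overlap of a tile with its left and right neighbours, but the middle part of each
  horizontal side still meets only one other tile, so the boundary of a tile is a concatenation of
  no fewer than four pieces. Along the boundary of an octagon hairs alternate with the other edges, and
  reflecting tiles folds the whole complex onto one octagon; hence interior vertices of planar diagrams
  have even valence, which gives T(4). The folding is a homotopy equivalence, so the complex is contractible.
  Finally, two tiles that meet share at least a hair. So no tile has a neighbour meeting it
  in a single vertex, as a flat plane would require, and there is no flat plane at all.
\<close>

section \<open>The pinched plane\<close>

text \<open>Without the folding, the tiling would itself be a flat plane invariant under all
  translations. The folding destroys the neighbours across a corner and keeps the rest under
  control: at each 0-cell the link has one vertex for the hair and two for other edges, and every
  corner joins the hair to another edge. Links are thus bipartite, which is the source of the even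
  valences. Width 4 leaves, between the two hairs of length 1 on a horizontal side, a segment of
  length 2 that is not folded. The complex is not an abstract quotient but the image of an explicit
  map into three-space, so that its identifications can be computed with real functions and its
  topology is Euclidean. The obstacle is T(4): a diagram is an arbitrary finite planar CW-complex,
  and its characteristic maps may behave badly on boundaries. They are replaced by inverse branches
  of the fold onto the octagon, extended to closed cells; invariance of domain then shows that an
  edge inside the diagram lies on exactly two faces.\<close>

text \<open>\<open>arcsin\<close> after \<open>sin\<close> is a triangle wave; the scaling gives it
  period 4, slope 1 on [-1, 1] and slope -1 on [1, 3]. In this form continuity is immediate.\<close>

definition tri_wave :: "real \<Rightarrow> real" where
  "tri_wave x = 2 / pi * arcsin (sin (pi * x / 2))"

lemma sin_quarter: "sin (pi * (4 * of_int i + u) / 2) = sin (pi * u / 2)"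
  using sin.plus_of_int [of "pi * u / 2" i] by (simp add: algebra_simps add_divide_distrib)

lemma cos_quarter: "cos (pi * (4 * of_int i + u) / 2) = cos (pi * u / 2)"
  using cos.plus_of_int [of "pi * u / 2" i] by (simp add: algebra_simps add_divide_distrib)

lemma tri_wave_hair:
  assumes "\<bar>u\<bar> \<le> 1"
  shows "tri_wave (4 * of_int i + u) = u"
proof -
  have "- (pi / 2) \<le> pi * u / 2" "pi * u / 2 \<le> pi / 2"
    using assms mult_left_mono [of "-1" u pi] mult_left_mono [of u 1 pi] by auto
  then show ?thesis
    unfolding tri_wave_def sin_quarter by (simp add: arcsin_sin)
qed

lemma tri_wave_mid:
  assumes "1 \<le> u" "u \<le> 3"
  shows "tri_wave (4 * of_int i + u) = 2 - u"
proof -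
  have "sin (pi * u / 2) = sin (pi * (2 - u) / 2)"
    using sin_pi_minus [of "pi * u / 2"] by (simp add: right_diff_distrib diff_divide_distrib)
  moreover have "tri_wave (4 * of_int 0 + (2 - u)) = 2 - u"
    using assms by (intro tri_wave_hair) auto
  ultimately show ?thesis
    unfolding tri_wave_def sin_quarter by simp
qed

lemma continuous_on_tri_wave [continuous_intros]:
  fixes S :: "'a :: t2_space set"
  shows "continuous_on S f \<Longrightarrow> continuous_on S (\<lambda>x. tri_wave (f x))"
  unfolding tri_wave_def by (intro continuous_intros) auto

lemma abs_tri_wave_le: "\<bar>tri_wave x\<bar> \<le> 1"
proof -
  have "\<bar>arcsin (sin (pi * x / 2))\<bar> \<le> pi / 2"
    using arcsin_bounded [of "sin (pi * x / 2)"] by (auto simp: abs_le_iff)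
  then show ?thesis
    by (simp add: tri_wave_def abs_mult field_simps)
qed

text \<open>The factor \<open>\<bar>sin (pi * y)\<bar>\<close> vanishes exactly on the horizontal lines with integer ordinate, where the
  first coordinate becomes constant on every hair and the third one is even along it.\<close>

definition pinch :: "real \<times> real \<Rightarrow> real \<times> real \<times> real" where
  "pinch = (\<lambda>(x, y). (x - (1 - \<bar>sin (pi * y)\<bar>) * tri_wave x, y, max 0 (cos (pi * x / 2))))"

lemma continuous_on_pinch [continuous_intros]:
  fixes S :: "'a :: t2_space set"
  shows "continuous_on S f \<Longrightarrow> continuous_on S (\<lambda>x. pinch (f x))"
  unfolding pinch_def case_prod_unfold by (intro continuous_intros) auto

section \<open>The identifications made by the pinching map\<close>

lemma sin_pi_int [simp]: "sin (pi * of_int j) = 0"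
  by (metis sin_zero_iff_int2 mult.commute)

lemma sin_pi_zero_iff: "sin (pi * y) = 0 \<longleftrightarrow> y \<in> \<int>"
  unfolding sin_zero_iff_int2 by (auto simp: Ints_def)

lemma pinch_fold:
  assumes "\<bar>u\<bar> \<le> 1"
  shows "pinch (4 * of_int i + u, of_int j) = pinch (4 * of_int i - u, of_int j)"
  using tri_wave_hair [of u i] tri_wave_hair [of "- u" i] assms
    cos_quarter [of i u] cos_quarter [of i "- u"]
  by (simp add: pinch_def)

text \<open>All ingredients are periodic, with period 4 in \<open>x\<close> and period 1 in
  \<open>y\<close>; hence translations of the plane by tiles become translations of three-space,
  which later act on the complex.\<close>

lemma pinch_translate:
  "pinch (x + 4 * of_int m, y + of_int n) = pinch (x, y) + (4 * of_int m, of_int n, 0)"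
proof -
  have "\<bar>cos (pi * of_int n)\<bar> = 1"
    using sin_cos_squared_add [of "pi * of_int n"] by (simp add: abs_square_eq_1)
  then have "\<bar>sin (pi * (y + of_int n))\<bar> = \<bar>sin (pi * y)\<bar>"
    by (simp add: distrib_left sin_add abs_mult)
  moreover have "tri_wave (x + 4 * of_int m) = tri_wave x"
    using sin_quarter [of m x] by (simp add: tri_wave_def add.commute)
  ultimately show ?thesis
    using cos_quarter [of m x] by (simp add: pinch_def add.commute)
qed

text \<open>Periods start at \<open>-1\<close> rather than at 0 so that the interval folded about
  \<open>4 * of_int i\<close> is not cut in two; the rest, from 1 to 3, is the unfolded
  middle.\<close>

lemma obtain_period:
  fixes x :: real
  obtains i :: int and u where "x = 4 * of_int i + u" "-1 \<le> u" "u < 3"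
proof -
  obtain k :: int where "of_int k \<le> (x + 1) / 4" "(x + 1) / 4 < of_int k + 1"
    by (metis of_int_floor_le real_of_int_floor_add_one_gt)
  then show thesis
    by (intro that [of k "x - 4 * of_int k"]) auto
qed

text \<open>On integer ordinates this difference is the first coordinate of \<open>pinch\<close>: it
  is constant on the interval folded about \<open>4 * of_int i\<close>, and it stretches the
  unfolded middle, with slope 2, to the full width 4.\<close>

lemma diff_tri_wave:
  assumes "-1 \<le> u" "u \<le> 3"
  shows "4 * of_int i + u - tri_wave (4 * of_int i + u) = 4 * of_int i + max 0 (2 * u - 2)"
  using tri_wave_hair [of u i] tri_wave_mid [of u i] assms by (cases "u \<le> 1") auto

text \<open>The slope of \<open>x - tri_wave x\<close> is 0 on the folded intervals and 2 between
  them, so the function is weakly increasing and two distinct arguments can share a value only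
  inside one folded interval.\<close>

lemma diff_tri_wave_cases:
  assumes "x \<le> x'"
  shows "x - tri_wave x < x' - tri_wave x' \<or> x = x' \<or>
    x - tri_wave x = x' - tri_wave x' \<and>
      (\<exists>i u u'. x = 4 * of_int i + u \<and> x' = 4 * of_int i + u' \<and> \<bar>u\<bar> \<le> 1 \<and> \<bar>u'\<bar> \<le> 1)"
proof -
  obtain i u where x: "x = 4 * of_int i + u" "-1 \<le> u" "u < 3" by (rule obtain_period)
  obtain i' u' where x': "x' = 4 * of_int i' + u'" "-1 \<le> u'" "u' < 3" by (rule obtain_period)
  have "i \<le> i'"
    using x x' assms by linarith
  show ?thesis
  proof (cases "i = i'")
    case True
    with x x' assms have "u \<le> u'" by simp
    have v: "x - tri_wave x = 4 * of_int i + max 0 (2 * u - 2)"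
      "x' - tri_wave x' = 4 * of_int i + max 0 (2 * u' - 2)"
      using True x x' diff_tri_wave [of u i] diff_tri_wave [of u' i] by auto
    show ?thesis
    proof (cases "u' \<le> 1")
      case u': True
      with \<open>u \<le> u'\<close> x have "\<bar>u\<bar> \<le> 1" "\<bar>u'\<bar> \<le> 1" by auto
      moreover from this v have "x - tri_wave x = x' - tri_wave x'" by simp
      ultimately show ?thesis using x(1) x'(1) True by blast
    next
      case False
      with v \<open>u \<le> u'\<close> x(1) x'(1) True show ?thesis by (auto simp: max_def)
    qed
  next
    case False
    with \<open>i \<le> i'\<close> have "real_of_int i + 1 \<le> of_int i'" by linarith
    moreover have "x - tri_wave x = 4 * of_int i + max 0 (2 * u - 2)"
      "x' - tri_wave x' = 4 * of_int i' + max 0 (2 * u' - 2)"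
      using x x' diff_tri_wave [of u i] diff_tri_wave [of u' i'] by auto
    ultimately show ?thesis using x x' by linarith
  qed
qed

text \<open>With \<open>s\<close> for the sine factor, the first coordinate is
  \<open>(1 - s) * (x - tri_wave x) + s * x\<close>, a convex combination of a weakly and a strictly
  increasing function. Equality at distinct abscissae therefore forces \<open>s = 0\<close>, that is
  an integer ordinate, and puts both points into one folded interval. There the third coordinate is
  injective in \<open>\<bar>u\<bar>\<close>, so only the mirror image is left.\<close>

lemma pinch_eq_imp_wlog:
  assumes pq: "fst p \<le> fst q" "pinch p = pinch q"
  shows "p = q \<or> (\<exists>i j u. 0 < \<bar>u\<bar> \<and> \<bar>u\<bar> \<le> 1 \<and>
    p = (4 * of_int i + u, of_int j) \<and> q = (4 * of_int i - u, of_int j))"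
proof -
  obtain x y x' y' where p: "p = (x, y)" and q': "q = (x', y')" by fastforce
  have "y' = y" using pq(2) by (simp add: pinch_def p q')
  then have q: "q = (x', y)" using q' by simp
  define s where "s = \<bar>sin (pi * y)\<bar>"
  have s: "0 \<le> s" "s \<le> 1" by (auto simp: s_def)
  have eq: "x - (1 - s) * tri_wave x = x' - (1 - s) * tri_wave x'"
    and eqc: "max 0 (cos (pi * x / 2)) = max 0 (cos (pi * x' / 2))"
    using pq(2) by (simp_all add: pinch_def p q s_def)
  have eq': "(1 - s) * (x - tri_wave x) + s * x = (1 - s) * (x' - tri_wave x') + s * x'"
    using eq by (simp add: algebra_simps)
  have xx: "x \<le> x'" using pq(1) p q by simp
  have mono: "x - tri_wave x \<le> x' - tri_wave x'"
    using diff_tri_wave_cases [OF xx] by auto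
  show ?thesis
  proof (cases "x = x'")
    case True then show ?thesis by (simp add: p q)
  next
    case False
    with xx have "x < x'" by simp
    have "s = 0"
    proof (rule ccontr)
      assume "s \<noteq> 0"
      then have "s * x < s * x'" using s \<open>x < x'\<close> by simp
      moreover have "(1 - s) * (x - tri_wave x) \<le> (1 - s) * (x' - tri_wave x')"
        using mono s by (intro mult_left_mono) auto
      ultimately show False using eq' by linarith
    qed
    then have "y \<in> \<int>" using sin_pi_zero_iff by (simp add: s_def)
    then obtain j where j: "y = of_int j" by (auto elim: Ints_cases)
    have "\<not> x - tri_wave x < x' - tri_wave x'" using eq \<open>s = 0\<close> by simp
    with diff_tri_wave_cases [OF xx] False obtain i u u'
      where u: "x = 4 * of_int i + u" "x' = 4 * of_int i + u'" "\<bar>u\<bar> \<le> 1" "\<bar>u'\<bar> \<le> 1" by blast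
    have b: "0 \<le> pi * \<bar>v\<bar> / 2" "pi * \<bar>v\<bar> / 2 \<le> pi / 2" "cos (pi * v / 2) = cos (pi * \<bar>v\<bar> / 2)"
      if "\<bar>v\<bar> \<le> 1" for v :: real
    proof -
      show "0 \<le> pi * \<bar>v\<bar> / 2" by simp
      show "pi * \<bar>v\<bar> / 2 \<le> pi / 2" using mult_left_mono [OF that, of pi] by simp
      show "cos (pi * v / 2) = cos (pi * \<bar>v\<bar> / 2)"
        using cos_minus [of "pi * v / 2"] by (cases "0 \<le> v") simp_all
    qed
    have "max 0 (cos (pi * \<bar>u\<bar> / 2)) = max 0 (cos (pi * \<bar>u'\<bar> / 2))"
      using eqc unfolding u(1,2) cos_quarter b(3) [OF u(3)] b(3) [OF u(4)] .
    moreover have "0 \<le> cos (pi * \<bar>v\<bar> / 2)" if "\<bar>v\<bar> \<le> 1" for v :: real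
      using b(1,2) [OF that] pi_gt_zero by (intro cos_ge_zero) linarith+
    ultimately have "cos (pi * \<bar>u\<bar> / 2) = cos (pi * \<bar>u'\<bar> / 2)"
      using u(3,4) by (metis max.absorb2)
    then have "pi * \<bar>u\<bar> / 2 = pi * \<bar>u'\<bar> / 2"
      using b(1,2) [OF u(3)] b(1,2) [OF u(4)] pi_gt_zero cos_inj_pi [of "pi * \<bar>u\<bar> / 2" "pi * \<bar>u'\<bar> / 2"]
      by linarith
    then have "\<bar>u\<bar> = \<bar>u'\<bar>" by simp
    moreover have "u \<noteq> u'" using False u(1,2) by metis
    ultimately have "u' = - u" "u \<noteq> 0" by linarith+
    then have "0 < \<bar>u\<bar> \<and> \<bar>u\<bar> \<le> 1 \<and>
      p = (4 * of_int i + u, of_int j) \<and> q = (4 * of_int i - u, of_int j)"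
      unfolding p q j u(1,2) using u(3) by simp
    then show ?thesis by blast
  qed
qed

lemma pinch_eq_imp:
  assumes "pinch p = pinch q"
  shows "p = q \<or> (\<exists>i j u. 0 < \<bar>u\<bar> \<and> \<bar>u\<bar> \<le> 1 \<and>
    p = (4 * of_int i + u, of_int j) \<and> q = (4 * of_int i - u, of_int j))"
proof (cases "fst p \<le> fst q")
  case True
  then show ?thesis using assms by (rule pinch_eq_imp_wlog)
next
  case False
  then have "fst q \<le> fst p" by simp
  from pinch_eq_imp_wlog [OF this assms [symmetric]] show ?thesis
  proof (elim disjE exE conjE)
    fix i j u
    assume "0 < \<bar>u\<bar>" "\<bar>u\<bar> \<le> 1" "q = (4 * of_int i + u, of_int j)" "p = (4 * of_int i - u, of_int j)"
    then show ?thesis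
      by (intro disjI2 exI [of _ i] exI [of _ j] exI [of _ "- u"]) auto
  qed simp
qed

section \<open>Properness of the pinching map and quotient topologies\<close>

text \<open>The first coordinate moves by at most 1, and the additional coordinate can only increase
  the norm. This bound is what makes \<open>pinch\<close> a closed map.\<close>

lemma norm_diff_pinch: "norm p \<le> norm (pinch p) + 1"
proof -
  obtain x y where p: "p = (x, y)" by fastforce
  have s: "0 \<le> 1 - \<bar>sin (pi * y)\<bar>" "1 - \<bar>sin (pi * y)\<bar> \<le> 1" by auto
  define e where "e = (1 - \<bar>sin (pi * y)\<bar>) * tri_wave x"
  have "\<bar>e\<bar> \<le> 1 * 1"
    unfolding e_def abs_mult using s abs_tri_wave_le [of x] by (intro mult_mono) auto
  have "norm p \<le> norm (x - e, y) + norm (e, 0 :: real)"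
    using norm_triangle_ineq [of "(x - e, y)" "(e, 0)"] by (simp add: p)
  also have "norm (e, 0 :: real) \<le> 1" using \<open>\<bar>e\<bar> \<le> 1 * 1\<close> by (simp add: norm_Pair)
  also have "norm (x - e, y) \<le> norm (pinch p)"
    by (simp add: p pinch_def norm_Pair flip: e_def)
  finally show ?thesis by simp
qed

lemma closed_if_closed_Int_cball:
  fixes S :: "'a :: heine_borel set"
  assumes "\<And>r. closed (S \<inter> cball a r)"
  shows "closed S"
  unfolding closed_sequential_limits
proof (intro allI impI, elim conjE)
  fix f l assume f: "\<forall>n. f n \<in> S" "f \<longlonglongrightarrow> l"
  then have "bounded (range f)" by (intro convergent_imp_bounded)
  then obtain r where "range f \<subseteq> cball a r"
    unfolding bounded_any_center [of _ a] by (auto simp: subset_iff)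
  then have "\<forall>n. f n \<in> S \<inter> cball a r" using f by blast
  then show "l \<in> S" using assms [of r] f closed_sequential_limits by blast
qed

text \<open>Where \<open>f x\<close> is bounded, so is \<open>x\<close>; hence every bounded part of
  the image comes from a compact part of \<open>C\<close>.\<close>

lemma closed_image_if_norm_le:
  fixes f :: "'a :: euclidean_space \<Rightarrow> 'b :: euclidean_space"
  assumes f: "continuous_on S f" and bound: "\<And>x. x \<in> S \<Longrightarrow> norm x \<le> norm (f x) + c"
    and C: "closed C" "C \<subseteq> S"
  shows "closed (f ` C)"
proof (rule closed_if_closed_Int_cball [where a = 0])
  fix r
  have "f ` C \<inter> cball 0 r = f ` (C \<inter> cball 0 (r + c)) \<inter> cball 0 r"
    using bound C by force
  moreover have "compact (f ` (C \<inter> cball 0 (r + c)))"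
    using C by (intro compact_continuous_image continuous_on_subset [OF f]) (auto simp: closed_Int_compact)
  ultimately show "closed (f ` C \<inter> cball 0 r)"
    by (simp add: compact_imp_closed closed_Int)
qed

text \<open>Allows maps out of the image to be tested for continuity upstairs; the fold onto the
  octagon and the contraction are both obtained in this way.\<close>

lemma quotient_map_if_norm_le:
  fixes f :: "'a :: euclidean_space \<Rightarrow> 'b :: euclidean_space"
  assumes f: "continuous_on S f" and bound: "\<And>x. x \<in> S \<Longrightarrow> norm x \<le> norm (f x) + c"
    and S: "closed S"
  shows "quotient_map (top_of_set S) (top_of_set (f ` S)) f"
proof (rule continuous_closed_imp_quotient_map)
  show "closed_map (top_of_set S) (top_of_set (f ` S)) f"
    unfolding closed_map_def
    using closed_image_if_norm_le [OF f bound] S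
    by (metis closedin_closed_eq closedin_subset closed_subset image_mono topspace_euclidean_subtopology)
qed (use f in auto)

lemma quotient_map_pinch: "quotient_map euclidean (top_of_set (range pinch)) pinch"
  using quotient_map_if_norm_le [of UNIV pinch 1] norm_diff_pinch
  by (simp add: continuous_on_pinch continuous_on_id)

section \<open>The complex\<close>

text \<open>A \<open>Tip\<close> is a lattice point, about which the line is folded; a
  \<open>Root\<close> is the common image of the two points at distance 1 from it on that line; the
  \<open>Hair\<close> joins them.\<close>

datatype cell = Tip int int | Root int int | Hair int int | Mid int int | Vert int int | Face int int

text \<open>A transversal to the fibres of \<open>pinch\<close>. Of two segments folded together
  only the right one belongs to regions: \<open>Root\<close> has the single representative
  \<open>4 * of_int i + 1\<close>, and between the end of \<open>Mid\<close> and the next tip the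
  line is left out.\<close>

fun region :: "cell \<Rightarrow> (real \<times> real) set" where
  "region (Tip i j) = {(4 * of_int i, of_int j)}"
| "region (Root i j) = {(4 * of_int i + 1, of_int j)}"
| "region (Hair i j) = {4 * of_int i<..<4 * of_int i + 1} \<times> {of_int j}"
| "region (Mid i j) = {4 * of_int i + 1<..<4 * of_int i + 3} \<times> {of_int j}"
| "region (Vert i j) = {4 * of_int i} \<times> {of_int j<..<of_int j + 1}"
| "region (Face i j) = {4 * of_int i<..<4 * of_int i + 4} \<times> {of_int j<..<of_int j + 1}"

fun translate_cell :: "int \<Rightarrow> int \<Rightarrow> cell \<Rightarrow> cell" where
  "translate_cell m n (Tip i j) = Tip (i + m) (j + n)"
| "translate_cell m n (Root i j) = Root (i + m) (j + n)"
| "translate_cell m n (Hair i j) = Hair (i + m) (j + n)"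
| "translate_cell m n (Mid i j) = Mid (i + m) (j + n)"
| "translate_cell m n (Vert i j) = Vert (i + m) (j + n)"
| "translate_cell m n (Face i j) = Face (i + m) (j + n)"

text \<open>A decoder that replaces the comparison of all pairs of constructors when regions are
  shown to be disjoint. On the left halves of hairs, which belong to no region, its value
  \<open>Mid\<close> has no meaning.\<close>

definition cell_at :: "real \<times> real \<Rightarrow> cell" where
  "cell_at = (\<lambda>(x, y). let i = \<lfloor>x / 4\<rfloor>; j = \<lfloor>y\<rfloor>; u = x - 4 * of_int i in
     if y = of_int j then
       (if u = 0 then Tip i j else if u < 1 then Hair i j else if u = 1 then Root i j else Mid i j)
     else if u = 0 then Vert i j else Face i j)"

lemma cell_at_eq:
  assumes "4 * of_int i \<le> x" "x < 4 * of_int i + 4" "of_int j \<le> y" "y < of_int j + 1"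
  shows "cell_at (x, y) =
    (if y = of_int j then
       (if x = 4 * of_int i then Tip i j else if x < 4 * of_int i + 1 then Hair i j
        else if x = 4 * of_int i + 1 then Root i j else Mid i j)
     else if x = 4 * of_int i then Vert i j else Face i j)"
proof -
  have "\<lfloor>x / 4\<rfloor> = i" "\<lfloor>y\<rfloor> = j"
    using assms by (simp_all add: floor_eq_iff field_simps)
  then show ?thesis by (auto simp: cell_at_def Let_def)
qed

lemma cell_at_region:
  assumes "p \<in> region k"
  shows "cell_at p = k"
proof (cases k)
  case (Tip i j)
  with assms show ?thesis using cell_at_eq [of i "fst p" j "snd p"] by auto
next
  case (Root i j)
  with assms show ?thesis using cell_at_eq [of i "fst p" j "snd p"] by auto
next
  case (Hair i j)
  with assms show ?thesis using cell_at_eq [of i "fst p" j "snd p"] by auto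
next
  case (Mid i j)
  with assms show ?thesis using cell_at_eq [of i "fst p" j "snd p"] by auto
next
  case (Vert i j)
  with assms show ?thesis using cell_at_eq [of i "fst p" j "snd p"] by auto
next
  case (Face i j)
  with assms show ?thesis using cell_at_eq [of i "fst p" j "snd p"] by auto
qed

lemma no_int_between: "real_of_int i < of_int j \<Longrightarrow> real_of_int j < of_int i + 1 \<Longrightarrow> False"
proof -
  assume "real_of_int i < of_int j" "real_of_int j < of_int i + 1"
  then have "i < j" "real_of_int j < of_int (i + 1)" by simp_all
  then have "i < j" "j < i + 1" unfolding of_int_less_iff by simp_all
  then show False by simp
qed

text \<open>A fibre with two points consists of \<open>4 * of_int i + u\<close> and
  \<open>4 * of_int i - u\<close> on an integer line, and by the fact \<open>no\<close> the left one
  of them is missed by all regions.\<close>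

lemma region_unique:
  assumes "p \<in> region k" "q \<in> region l" "pinch p = pinch q"
  shows "p = q \<and> k = l"
proof -
  have no: "x \<notin> {4 * of_int i - 1..<4 * of_int i}"
    if "(x, real_of_int j) \<in> region m" for x :: real and i j m
  proof
    assume x: "x \<in> {4 * of_int i - 1..<4 * of_int i}"
    have False if "4 * of_int i' \<le> x" "x < 4 * of_int i' + 3" for i' :: int
    proof -
      have "real_of_int i' < of_int i" "real_of_int i < of_int i' + 1" using x that by auto
      then show False by (rule no_int_between)
    qed
    note tooth = this
    show False
    proof (cases m)
      case (Tip i' j') with that tooth [of i'] show False by simp
    next
      case (Root i' j') with that tooth [of i'] show False by simp
    next
      case (Hair i' j') with that tooth [of i'] show False by simp
    next
      case (Mid i' j') with that tooth [of i'] show False by simp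
    next
      case (Vert i' j') with that no_int_between [of j' j] show False by simp
    next
      case (Face i' j') with that no_int_between [of j' j] show False by simp
    qed
  qed
  have "p = q"
  proof (rule ccontr)
    assume "p \<noteq> q"
    with pinch_eq_imp [OF assms(3)] obtain i j u where u: "0 < \<bar>u\<bar>" "\<bar>u\<bar> \<le> 1"
      "p = (4 * of_int i + u, of_int j)" "q = (4 * of_int i - u, of_int j)" by blast
    then have "4 * of_int i + u \<notin> {4 * of_int i - 1..<4 * of_int i}"
      "4 * of_int i - u \<notin> {4 * of_int i - 1..<4 * of_int i}"
      using no [of "4 * of_int i + u" j k] no [of "4 * of_int i - u" j l] assms(1,2) u(3,4) by blast+
    with u(1,2) show False by (auto simp: abs_if split: if_splits)
  qed
  with assms cell_at_region show ?thesis by metis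
qed

lemma region_cover:
  obtains k q where "q \<in> region k" "pinch p = pinch q"
proof -
  obtain x y where p: "p = (x, y)" by fastforce
  obtain i u where x: "x = 4 * of_int i + u" "-1 \<le> u" "u < 3" by (rule obtain_period)
  obtain j v where y: "y = of_int j + v" "0 \<le> v" "v < 1"
    by (rule that [of "\<lfloor>y\<rfloor>" "y - of_int \<lfloor>y\<rfloor>"]) linarith+
  show thesis
  proof (cases "v = 0")
    case True
    \<comment> \<open>The representative in the right half of the hair.\<close>
    define w where "w = \<bar>u\<bar>"
    show thesis
    proof (cases "u \<le> 1")
      case u: True
      then have "pinch p = pinch (4 * of_int i + w, of_int j)"
        using pinch_fold [of u i j] x y True by (auto simp: p w_def abs_if)
      moreover have "(4 * of_int i + w, of_int j) \<in> region (if w = 0 then Tip i j else if w < 1 then Hair i j else Root i j)"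
        using x u by (auto simp: w_def)
      ultimately show thesis using that by blast
    next
      case False
      then have "p \<in> region (Mid i j)" using x y True by (auto simp: p)
      then show thesis using that by blast
    qed
  next
    case False
    \<comment> \<open>Off the integer lines nothing is folded. Since the period starts at
      \<open>-1\<close>, the part with \<open>u < 0\<close> belongs to the tile on the left.\<close>
    define i' u' where "i' = (if u < 0 then i - 1 else i)" and "u' = (if u < 0 then u + 4 else u)"
    have "x = 4 * of_int i' + u'" "0 \<le> u'" "u' < 4" using x by (auto simp: i'_def u'_def)
    then have "p \<in> region (if u' = 0 then Vert i' j else Face i' j)"
      using y False by (auto simp: p)
    then show thesis using that by blast
  qed
qed

definition rect :: "int \<Rightarrow> int \<Rightarrow> (real \<times> real) set" where
  "rect i j = {4 * of_int i..4 * of_int i + 4} \<times> {of_int j..of_int j + 1}"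

lemma compact_rect [simp]: "compact (rect i j)"
  by (simp add: rect_def compact_Times)

text \<open>Two distinct points with the same image lie strictly on opposite sides of some abscissa
  \<open>4 * of_int i'\<close>, and no such abscissa lies strictly between the two vertical sides of
  a tile.\<close>

lemma inj_on_pinch_rect: "inj_on pinch (rect i j)"
proof (rule inj_onI, rule ccontr)
  fix p q assume pq: "p \<in> rect i j" "q \<in> rect i j" "pinch p = pinch q" "p \<noteq> q"
  then obtain i' j' u where u: "0 < \<bar>u\<bar>" "\<bar>u\<bar> \<le> 1"
      "p = (4 * of_int i' + u, of_int j')" "q = (4 * of_int i' - u, of_int j')"
    using pinch_eq_imp by blast
  with pq have "real_of_int i < of_int i'" "real_of_int i' < of_int i + 1"
    by (auto simp: rect_def)
  then show False by (rule no_int_between)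
qed

lemma region_subset_rect:
  "region (Tip i j) \<subseteq> rect i j" "region (Root i j) \<subseteq> rect i j" "region (Hair i j) \<subseteq> rect i j"
  "region (Mid i j) \<subseteq> rect i j" "region (Vert i j) \<subseteq> rect i j" "region (Face i j) \<subseteq> rect i j"
  by (auto simp: rect_def)

section \<open>Characteristic maps of the cells\<close>

text \<open>Every open cell sits in a closed cell on which the characteristic map is injective, so
  compactness provides all the homeomorphisms that the cells require.\<close>

lemma homeomorphic_map_if_compact:
  fixes f :: "'a :: t2_space \<Rightarrow> 'b :: t2_space"
  assumes "compact S" "continuous_on S f" "inj_on f S" "T \<subseteq> S"
  shows "homeomorphic_map (top_of_set T) (top_of_set (f ` T)) f"
proof -
  obtain g where "homeomorphism S (f ` S) f g"
    using homeomorphism_compact [OF assms(1,2) refl assms(3)] by blast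
  then have "homeomorphism T (f ` T) f g"
    using assms(4) by (rule homeomorphism_of_subsets) auto
  then show ?thesis
    unfolding homeomorphic_map_maps homeomorphic_maps_def homeomorphism_def
    by (intro exI [of _ g]) auto
qed

text \<open>Compact convex sets of equal dimension are homeomorphic, but this gives no information
  about the homeomorphism. Invariance of domain, applied to it and to its inverse, shows that the
  interiors correspond.\<close>

lemma ex_disc_to_rect:
  "\<exists>\<kappa> :: complex \<Rightarrow> real \<times> real. continuous_on (cball 0 1) \<kappa> \<and> inj_on \<kappa> (cball 0 1) \<and>
     \<kappa> ` cball 0 1 = {0..4} \<times> {0..1} \<and> \<kappa> ` ball 0 1 = {0<..<4} \<times> {0<..<1}"
proof -
  let ?R = "{0..4} \<times> {0..1} :: (real \<times> real) set"
  have int: "interior ?R = {0<..<4} \<times> {0<..<1}" by (simp add: interior_Times)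
  have "aff_dim (cball 0 1 :: complex set) = aff_dim ?R"
    using aff_dim_nonempty_interior [of ?R] int by (simp add: aff_dim_cball)
  then have "(cball 0 1 :: complex set) homeomorphic ?R"
    by (intro homeomorphic_convex_compact_sets) (auto simp: convex_Times compact_Times)
  then obtain f g where fg: "homeomorphism (cball 0 1 :: complex set) ?R f g"
    unfolding homeomorphic_def by blast
  have cf: "continuous_on (cball 0 1) f" and cg: "continuous_on ?R g"
    and inj: "inj_on f (cball 0 1)" "inj_on g ?R"
    and im: "f ` cball 0 1 = ?R" "g ` ?R = cball 0 1"
    and inv: "\<And>z. z \<in> cball 0 1 \<Longrightarrow> g (f z) = z" "\<And>p. p \<in> ?R \<Longrightarrow> f (g p) = p"
  proof -
    show "continuous_on (cball 0 1) f" "continuous_on ?R g" "f ` cball 0 1 = ?R" "g ` ?R = cball 0 1"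
      and inv: "\<And>z. z \<in> cball 0 1 \<Longrightarrow> g (f z) = z" "\<And>p. p \<in> ?R \<Longrightarrow> f (g p) = p"
      using fg unfolding homeomorphism_def by metis+
    show "inj_on f (cball 0 1)" "inj_on g ?R"
      using inv by (metis inj_on_inverseI)+
  qed
  have "open (f ` ball 0 1)"
    using continuous_on_subset [OF cf ball_subset_cball] inj_on_subset [OF inj(1) ball_subset_cball]
    by (intro invariance_of_domain_gen) auto
  then have 1: "f ` ball 0 1 \<subseteq> interior ?R"
    using image_mono [OF ball_subset_cball, of f 0 1] im(1) by (intro interior_maximal) simp_all
  have "open (g ` interior ?R)"
    using continuous_on_subset [OF cg interior_subset] inj_on_subset [OF inj(2) interior_subset]
    by (intro invariance_of_domain_gen) auto
  then have "g ` interior ?R \<subseteq> interior (cball 0 1)"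
    using image_mono [OF interior_subset, of g ?R] im(2) by (intro interior_maximal) simp_all
  then have 2: "g ` interior ?R \<subseteq> ball 0 1" by simp
  have "interior ?R \<subseteq> f ` ball 0 1"
  proof
    fix p assume p: "p \<in> interior ?R"
    then have "f (g p) = p" using inv(2) interior_subset by blast
    moreover have "g p \<in> ball 0 1" using 2 p by blast
    ultimately show "p \<in> f ` ball 0 1" by (metis imageI)
  qed
  with 1 have "f ` ball 0 1 = {0<..<4} \<times> {0<..<1}" unfolding int by (rule equalityI)
  with cf inj(1) im(1) show ?thesis by blast
qed

definition disc_to_rect :: "complex \<Rightarrow> real \<times> real" where
  "disc_to_rect = (SOME \<kappa>. continuous_on (cball 0 1) \<kappa> \<and> inj_on \<kappa> (cball 0 1) \<and>
     \<kappa> ` cball 0 1 = {0..4} \<times> {0..1} \<and> \<kappa> ` ball 0 1 = {0<..<4} \<times> {0<..<1})"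

lemma disc_to_rect:
  "continuous_on (cball 0 1) disc_to_rect" "inj_on disc_to_rect (cball 0 1)"
  "disc_to_rect ` cball 0 1 = {0..4} \<times> {0..1}" "disc_to_rect ` ball 0 1 = {0<..<4} \<times> {0<..<1}"
  using someI_ex [OF ex_disc_to_rect] unfolding disc_to_rect_def by blast+

definition hair :: "int \<Rightarrow> int \<Rightarrow> real \<Rightarrow> real \<times> real \<times> real" where
  "hair i j t = pinch (4 * of_int i + t, of_int j)"

definition mid :: "int \<Rightarrow> int \<Rightarrow> real \<Rightarrow> real \<times> real \<times> real" where
  "mid i j t = pinch (4 * of_int i + 1 + 2 * t, of_int j)"

definition vert :: "int \<Rightarrow> int \<Rightarrow> real \<Rightarrow> real \<times> real \<times> real" where
  "vert i j t = pinch (4 * of_int i, of_int j + t)"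

definition face :: "int \<Rightarrow> int \<Rightarrow> complex \<Rightarrow> real \<times> real \<times> real" where
  "face i j z = pinch ((4 * of_int i, of_int j) + disc_to_rect z)"

definition pinched_plane :: "(real \<times> real \<times> real) cell_complex" where
  "pinched_plane =
     \<lparr>cw_space = top_of_set (range pinch),
      cells0 = {pinch (4 * of_int i, of_int j) | i j. True} \<union> {pinch (4 * of_int i + 1, of_int j) | i j. True},
      cells1 = {hair i j | i j. True} \<union> {mid i j | i j. True} \<union> {vert i j | i j. True},
      cells2 = {face i j | i j. True}\<rparr>"

lemma pinched_plane_simps:
  "cw_space pinched_plane = top_of_set (range pinch)"
  "cells2 pinched_plane = {face i j | i j. True}"
  by (simp_all add: pinched_plane_def)

lemma rect_eq_image: "rect i j = (+) (4 * of_int i, of_int j) ` ({0..4} \<times> {0..1})"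
proof -
  have "(x, y) \<in> (+) (4 * of_int i, of_int j) ` ({0..4} \<times> {0..1})" if "(x, y) \<in> rect i j" for x y
    using that by (intro image_eqI [where x = "(x - 4 * of_int i, y - of_int j)"]) (auto simp: rect_def)
  then show ?thesis by (auto simp: rect_def)
qed

lemma region_Face_eq_image:
  "region (Face i j) = (+) (4 * of_int i, of_int j) ` ({0<..<4} \<times> {0<..<1})"
proof -
  have "(x, y) \<in> (+) (4 * of_int i, of_int j) ` ({0<..<4} \<times> {0<..<1})"
    if "(x, y) \<in> region (Face i j)" for x y
    using that by (intro image_eqI [where x = "(x - 4 * of_int i, y - of_int j)"]) auto
  then show ?thesis by auto
qed

lemma face_cball: "face i j ` cball 0 1 = pinch ` rect i j"
  unfolding face_def rect_eq_image by (simp add: image_image flip: disc_to_rect(3))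

lemma face_ball: "face i j ` ball 0 1 = pinch ` region (Face i j)"
  unfolding face_def region_Face_eq_image by (simp add: image_image flip: disc_to_rect(4))

lemma face_inj: "inj_on (face i j) (cball 0 1)"
proof -
  have "inj_on pinch ((\<lambda>z. (4 * of_int i, of_int j) + disc_to_rect z) ` cball 0 1)"
    using inj_on_pinch_rect [of i j] unfolding rect_eq_image disc_to_rect(3) [symmetric] image_image .
  moreover have "inj_on (\<lambda>z. (4 * of_int i, of_int j) + disc_to_rect z) (cball 0 1)"
    using disc_to_rect(2) by (simp add: inj_on_def)
  ultimately show ?thesis unfolding face_def by (simp add: inj_on_def)
qed

lemma face_continuous: "continuous_on (cball 0 1) (face i j)"
  unfolding face_def by (intro continuous_intros disc_to_rect(1))

lemma pinch_line:
  fixes l :: "real \<Rightarrow> real \<times> real"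
  assumes "\<And>t. t \<in> {0..1} \<Longrightarrow> l t \<in> rect i j" "inj_on l {0..1}" "continuous_on {0..1} l"
  shows "continuous_on {0..1} (\<lambda>t. pinch (l t))" "inj_on (\<lambda>t. pinch (l t)) {0..1}"
proof -
  show "continuous_on {0..1} (\<lambda>t. pinch (l t))"
    using continuous_on_pinch [OF assms(3)] .
  show "inj_on (\<lambda>t. pinch (l t)) {0..1}"
    using assms(1,2) inj_on_pinch_rect [of i j] by (auto simp: inj_on_def)
qed

lemma edge_continuous_inj:
  assumes "e \<in> cells1 pinched_plane"
  shows "continuous_on {0..1} e" "inj_on e {0..1}"
proof -
  have "\<exists>i j l. e = (\<lambda>t. pinch (l t)) \<and> (\<forall>t\<in>{0..1}. l t \<in> rect i j) \<and> inj_on l {0..1} \<and> continuous_on {0..1} l"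
    using assms unfolding pinched_plane_def
  proof (simp, elim disjE exE)
    fix i j assume "e = hair i j"
    then show ?thesis
      by (intro exI [of _ i] exI [of _ j] exI [of _ "\<lambda>t. (4 * of_int i + t, of_int j)"])
        (auto simp: hair_def fun_eq_iff rect_def inj_on_def intro!: continuous_intros)
  next
    fix i j assume "e = mid i j"
    then show ?thesis
      by (intro exI [of _ i] exI [of _ j] exI [of _ "\<lambda>t. (4 * of_int i + 1 + 2 * t, of_int j)"])
        (auto simp: mid_def fun_eq_iff rect_def inj_on_def intro!: continuous_intros)
  next
    fix i j assume "e = vert i j"
    then show ?thesis
      by (intro exI [of _ i] exI [of _ j] exI [of _ "\<lambda>t. (4 * of_int i, of_int j + t)"])
        (auto simp: vert_def fun_eq_iff rect_def inj_on_def intro!: continuous_intros)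
  qed
  then show "continuous_on {0..1} e" "inj_on e {0..1}"
    using pinch_line by blast+
qed

lemma image_affine_open:
  fixes a b :: real assumes "0 < b"
  shows "(\<lambda>t. a + b * t) ` {0<..<1} = {a<..<a + b}"
  using assms by (auto simp: image_iff field_simps intro!: bexI [of _ "(_ - a) / b"])

lemma edge_open_image:
  "hair i j ` {0<..<1} = pinch ` region (Hair i j)"
  "mid i j ` {0<..<1} = pinch ` region (Mid i j)"
  "vert i j ` {0<..<1} = pinch ` region (Vert i j)"
proof -
  have "region (Hair i j) = (\<lambda>t. (4 * of_int i + t, of_int j)) ` {0<..<1}"
    using image_affine_open [of 1 "4 * of_int i"] by (auto simp: image_iff set_eq_iff)
  then show "hair i j ` {0<..<1} = pinch ` region (Hair i j)"
    by (simp add: hair_def image_image)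
  have "region (Mid i j) = (\<lambda>t. (4 * of_int i + 1 + 2 * t, of_int j)) ` {0<..<1}"
    using image_affine_open [of 2 "4 * of_int i + 1"] by (auto simp: image_iff set_eq_iff)
  then show "mid i j ` {0<..<1} = pinch ` region (Mid i j)"
    by (simp add: mid_def image_image)
  have "region (Vert i j) = (\<lambda>t. (4 * of_int i, of_int j + t)) ` {0<..<1}"
    using image_affine_open [of 1 "of_int j"] by (auto simp: image_iff set_eq_iff)
  then show "vert i j ` {0<..<1} = pinch ` region (Vert i j)"
    by (simp add: vert_def image_image)
qed

lemma image_double_collect: "h ` {f i j | i j. True} = {h (f i j) | i j. True}"
  by blast

lemma open_cells_pinched_plane: "open_cells pinched_plane = range (\<lambda>k. pinch ` region k)"
proof -
  have "open_cells pinched_plane =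
    ({pinch ` region (Tip i j) | i j. True} \<union> {pinch ` region (Root i j) | i j. True}) \<union>
    ({pinch ` region (Hair i j) | i j. True} \<union> {pinch ` region (Mid i j) | i j. True} \<union>
    {pinch ` region (Vert i j) | i j. True}) \<union> {pinch ` region (Face i j) | i j. True}"
    unfolding open_cells_def pinched_plane_def cell_complex.select_convs image_Un
      image_double_collect edge_open_image face_ball by simp
  also have "\<dots> = range (\<lambda>k. pinch ` region k)" (is "?L = ?R")
  proof
    show "?L \<subseteq> ?R"
      by (intro Un_least) (auto simp del: region.simps)
    have "pinch ` region k \<in> ?L" for k
      by (cases k) (simp_all del: region.simps, blast+)
    then show "?R \<subseteq> ?L" by blast
  qed
  finally show ?thesis .
qed

lemma region_nonempty: "region k \<noteq> {}"
proof (cases k)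
  case (Face i j)
  have "(4 * of_int i + 1, of_int j + 1 / 2) \<in> region (Face i j)" by auto
  with Face show ?thesis by blast
qed auto

lemma pinch_region_inject:
  assumes "pinch ` region k \<inter> pinch ` region l \<noteq> {}"
  shows "k = l"
  using assms region_unique by blast

section \<open>Attaching maps and the boundary of a tile\<close>

text \<open>As the boundary circle is embedded, the cells of \<open>X\<close> in its image can be
  pulled back along the inverse \<open>g\<close>; \<open>f\<close> maps each pulled-back cell
  homeomorphically onto the original one.\<close>

lemma subdivision_pullback:
  fixes X :: "'a :: t2_space cell_complex" and f :: "complex \<Rightarrow> 'a"
  assumes top: "cw_space X = top_of_set Y"
    and disj: "disjoint (open_cells X)" and inj1: "inj_on (\<lambda>e. e ` {0<..<1}) (cells1 X)"
    and f: "continuous_on (sphere 0 1) f" "inj_on f (sphere 0 1)" "f ` sphere 0 1 \<subseteq> Y"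
    and E: "finite E" "E \<subseteq> cells1 X" "f ` sphere 0 1 = (\<Union>e\<in>E. e ` {0..1})"
    and edge: "\<And>e. e \<in> E \<Longrightarrow> continuous_on {0..1} e \<and> inj_on e {0..1} \<and> e 0 \<in> cells0 X \<and> e 1 \<in> cells0 X"
  shows "\<exists>K. subdivision (top_of_set (sphere 0 1)) K \<and> combinatorial_map K X f"
proof -
  let ?S = "sphere 0 1 :: complex set"
  define g where "g = inv_into ?S f"
  have gf: "g (f z) = z" if "z \<in> ?S" for z using f(2) that by (simp add: g_def)
  have fg: "f (g y) = y" and gS: "g y \<in> ?S" if "y \<in> f ` ?S" for y
    unfolding g_def using that by (rule f_inv_into_f, rule inv_into_into)
  have cg: "continuous_on (f ` ?S) g"
    by (rule continuous_on_inv [OF f(1)]) (simp_all add: gf)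
  have ig: "inj_on g (f ` ?S)" using fg by (metis inj_on_inverseI)
  define V where "V = cells0 X \<inter> f ` ?S"
  define K where "K = \<lparr>cw_space = top_of_set ?S, cells0 = g ` V, cells1 = (\<lambda>e. g \<circ> e) ` E,
    cells2 = {} :: (complex \<Rightarrow> complex) set\<rparr>"
  define C0 where "C0 = (\<lambda>v. {v}) ` V \<union> (\<lambda>e. e ` {0<..<1}) ` E"
  have C0_sub: "C0 \<subseteq> open_cells X"
    using E(2) by (auto simp: C0_def open_cells_def V_def)
  have E_sub: "e ` {0..1} \<subseteq> f ` ?S" if "e \<in> E" for e using E(3) that by blast
  have E_sub': "e ` {0<..<1} \<subseteq> f ` ?S" if "e \<in> E" for e
    using E_sub [OF that] by (auto simp: image_subset_iff)
  have C0_S: "c \<subseteq> f ` ?S" if "c \<in> C0" for c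
    using that E_sub' by (auto simp: C0_def V_def)
  have oK: "open_cells K = (\<lambda>c. g ` c) ` C0"
    by (simp add: open_cells_def K_def C0_def image_Un image_image image_comp o_def)
  have cover: "\<Union>C0 = f ` ?S"
  proof
    show "\<Union>C0 \<subseteq> f ` ?S" using C0_S by blast
    show "f ` ?S \<subseteq> \<Union>C0"
    proof
      fix y assume y: "y \<in> f ` ?S"
      then obtain e t where e: "e \<in> E" "t \<in> {0..1}" "y = e t" using E(3) by auto
      show "y \<in> \<Union>C0"
      proof (cases "t \<in> {0<..<1}")
        case True
        then have "y \<in> e ` {0<..<1}" using e(3) by blast
        then show ?thesis using e(1) by (auto simp: C0_def)
      next
        case False
        then have "t = 0 \<or> t = 1" using e(2) by auto
        then have "y \<in> V" using e edge y by (auto simp: V_def)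
        then show ?thesis by (auto simp: C0_def)
      qed
    qed
  qed
  have ends: "g (e t) \<in> cells0 K" if "e \<in> E" "t = 0 \<or> t = 1" for e t
  proof -
    have "e t \<in> e ` {0..1}" using that by auto
    then have "e t \<in> f ` ?S" using E_sub [OF that(1)] by blast
    then have "e t \<in> V" using that edge by (auto simp: V_def)
    then show ?thesis by (simp add: K_def)
  qed
  have ge: "continuous_on {0..1} (g \<circ> e)" "inj_on (g \<circ> e) {0..1}" "(g \<circ> e) ` {0..1} \<subseteq> ?S" if "e \<in> E" for e
  proof -
    show "continuous_on {0..1} (g \<circ> e)"
      using edge [OF that] continuous_on_subset [OF cg E_sub [OF that]] by (intro continuous_on_compose) auto
    show "inj_on (g \<circ> e) {0..1}"
      using edge [OF that] inj_on_subset [OF ig E_sub [OF that]] by (intro comp_inj_on) auto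
    show "(g \<circ> e) ` {0..1} \<subseteq> ?S" using E_sub [OF that] gS by auto
  qed
  have "cw_complex K"
    unfolding cw_complex_def
  proof (intro conjI)
    show "Hausdorff_space (cw_space K)"
      by (simp add: K_def Hausdorff_space_subtopology)
    show "disjoint (open_cells K)"
      unfolding oK
    proof (rule disjointI)
      fix a b assume "a \<in> (`) g ` C0" "b \<in> (`) g ` C0" "a \<noteq> b"
      then obtain c d where cd: "c \<in> C0" "d \<in> C0" "a = g ` c" "b = g ` d" "c \<noteq> d" by blast
      then have "c \<inter> d = {}" using disj C0_sub by (meson disjointD subsetD)
      then show "a \<inter> b = {}"
        using inj_on_image_Int [OF ig C0_S [OF cd(1)] C0_S [OF cd(2)]] cd by simp
    qed
    show "\<Union> (open_cells K) = topspace (cw_space K)"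
    proof -
      have "\<Union> (open_cells K) = g ` \<Union>C0" unfolding oK by blast
      also have "\<dots> = ?S" unfolding cover by (auto simp: gf image_image)
      finally show ?thesis by (simp add: K_def)
    qed
    show "inj_on (\<lambda>e. e ` {0<..<1}) (cells1 K)"
    proof (rule inj_onI)
      fix a b assume "a \<in> cells1 K" "b \<in> cells1 K" and eq: "a ` {0<..<1} = b ` {0<..<1}"
      then obtain e e' where e: "e \<in> E" "e' \<in> E" "a = g \<circ> e" "b = g \<circ> e'" by (auto simp: K_def)
      have "g ` (e ` {0<..<1}) = g ` (e' ` {0<..<1})" using eq e by (simp add: image_comp)
      then have "e ` {0<..<1} = e' ` {0<..<1}"
        using inj_on_image_eq_iff [OF ig E_sub' [OF e(1)] E_sub' [OF e(2)]] by simp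
      then have "e = e'" using inj1 e E(2) by (meson inj_onD subsetD)
      then show "a = b" using e by simp
    qed
    show "inj_on (\<lambda>f. f ` ball 0 1) (cells2 K)" by (simp add: K_def)
    show "\<forall>e\<in>cells1 K. continuous_map (top_of_set {0..1}) (cw_space K) e \<and>
        homeomorphic_map (top_of_set {0<..<1}) (subtopology (cw_space K) (e ` {0<..<1})) e \<and>
        e 0 \<in> cells0 K \<and> e 1 \<in> cells0 K"
    proof
      fix a assume "a \<in> cells1 K"
      then obtain e where e: "e \<in> E" "a = g \<circ> e" by (auto simp: K_def)
      have "homeomorphic_map (top_of_set {0<..<1}) (top_of_set (a ` {0<..<1})) a"
        using ge [OF e(1)] unfolding e(2) by (intro homeomorphic_map_if_compact [of "{0..1}"]) auto
      moreover have "a ` {0<..<1} \<subseteq> ?S" using ge(3) [OF e(1)] by (auto simp: e(2) image_subset_iff)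
      ultimately show "continuous_map (top_of_set {0..1}) (cw_space K) a \<and>
        homeomorphic_map (top_of_set {0<..<1}) (subtopology (cw_space K) (a ` {0<..<1})) a \<and>
        a 0 \<in> cells0 K \<and> a 1 \<in> cells0 K"
        using ge [OF e(1)] ends [OF e(1)] e(2)
        by (auto simp: K_def subtopology_subtopology Int_absorb1)
    qed
    show "\<forall>f\<in>cells2 K. continuous_map (top_of_set (cball 0 1)) (cw_space K) f \<and>
       homeomorphic_map (top_of_set (ball 0 1)) (subtopology (cw_space K) (f ` ball 0 1)) f \<and>
       (\<exists>\<C>. finite \<C> \<and> \<C> \<subseteq> (\<lambda>v. {v}) ` cells0 K \<union> (\<lambda>e. e ` {0<..<1}) ` cells1 K \<and>
            f ` sphere 0 1 \<subseteq> \<Union> \<C>)"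
      by (simp add: K_def)
    show "\<forall>C\<subseteq>topspace (cw_space K).
       (\<forall>e\<in>cells1 K. closedin (cw_space K) (C \<inter> e ` {0..1})) \<and>
       (\<forall>f\<in>cells2 K. closedin (cw_space K) (C \<inter> f ` cball 0 1)) \<longrightarrow> closedin (cw_space K) C"
    proof (intro allI impI, elim conjE)
      fix C assume C: "C \<subseteq> topspace (cw_space K)"
        and cl: "\<forall>e\<in>cells1 K. closedin (cw_space K) (C \<inter> e ` {0..1})"
      have "?S = g ` f ` ?S" by (auto simp: gf image_image)
      then have "?S = (\<Union>e\<in>E. (g \<circ> e) ` {0..1})" unfolding E(3) by (simp add: image_UN image_comp)
      then have "C = (\<Union>e\<in>E. C \<inter> (g \<circ> e) ` {0..1})" using C by (simp add: K_def) blast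
      moreover have "closedin (cw_space K) (\<Union>e\<in>E. C \<inter> (g \<circ> e) ` {0..1})"
        using E(1) cl by (intro closedin_Union) (auto simp: K_def)
      ultimately show "closedin (cw_space K) C" by simp
    qed
  qed
  moreover have "combinatorial_map K X f"
    unfolding combinatorial_map_def
  proof (intro conjI ballI)
    show "continuous_map (cw_space K) (cw_space X) f"
      using f by (simp add: K_def top continuous_map_in_subtopology image_subset_iff_funcset)
    fix c assume "c \<in> open_cells K"
    then obtain d where d: "d \<in> C0" "c = g ` d" unfolding oK by blast
    have "c \<subseteq> ?S" using C0_S [OF d(1)] gS d(2) by blast
    moreover have "f ` c = d" using C0_S [OF d(1)] fg d(2) by (force simp: image_image)
    moreover have "d \<subseteq> Y" using C0_S [OF d(1)] f(3) by blast
    ultimately have "homeomorphic_map (subtopology (cw_space K) c) (subtopology (cw_space X) d) f"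
      using homeomorphic_map_if_compact [OF compact_sphere f(1,2) \<open>c \<subseteq> ?S\<close>]
      by (simp add: K_def top subtopology_subtopology Int_absorb1)
    then show "\<exists>d\<in>open_cells X. homeomorphic_map (subtopology (cw_space K) c) (subtopology (cw_space X) d) f"
      using C0_sub d(1) by blast
  qed
  ultimately show ?thesis
    by (intro exI [of _ K]) (simp add: subdivision_def K_def)
qed

lemma pinch_fold_image: "pinch ` ({4 * of_int i - 1..4 * of_int i} \<times> {of_int j}) =
  pinch ` ({4 * of_int i..4 * of_int i + 1} \<times> {of_int j})"
proof -
  \<comment> \<open>\<open>8 * of_int i - x\<close> is the mirror image of \<open>x\<close> about
    \<open>4 * of_int i\<close>.\<close>
  have *: "pinch (x, of_int j) = pinch (8 * of_int i - x, of_int j)" if "\<bar>x - 4 * of_int i\<bar> \<le> 1" for x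
    using pinch_fold [OF that, of i j] by simp
  have "pinch (x, of_int j) \<in> pinch ` ({4 * of_int i..4 * of_int i + 1} \<times> {of_int j})"
    if "x \<in> {4 * of_int i - 1..4 * of_int i}" for x
    using that by (subst *) auto
  moreover have "pinch (x, of_int j) \<in> pinch ` ({4 * of_int i - 1..4 * of_int i} \<times> {of_int j})"
    if "x \<in> {4 * of_int i..4 * of_int i + 1}" for x
    using that by (subst *) auto
  ultimately show ?thesis by blast
qed

lemma image_affine_closed:
  fixes a b :: real assumes "0 < b"
  shows "(\<lambda>t. a + b * t) ` {0..1} = {a..a + b}"
proof -
  have "(\<lambda>t. a + b * t) = (\<lambda>t. b * t + a)" by (simp add: add.commute)
  then show ?thesis using assms image_affinity_atLeastAtMost [of b a 0 1] by (simp add: add.commute)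
qed

lemma edge_closed_image:
  "hair i j ` {0..1} = pinch ` ({4 * of_int i..4 * of_int i + 1} \<times> {of_int j})"
  "mid i j ` {0..1} = pinch ` ({4 * of_int i + 1..4 * of_int i + 3} \<times> {of_int j})"
  "vert i j ` {0..1} = pinch ` ({4 * of_int i} \<times> {of_int j..of_int j + 1})"
proof -
  have *: "A \<times> {c} = (\<lambda>x. (x, c)) ` A" "{c} \<times> A = (\<lambda>x. (c, x)) ` A" for A and c :: real by auto
  show "hair i j ` {0..1} = pinch ` ({4 * of_int i..4 * of_int i + 1} \<times> {of_int j})"
    unfolding * image_affine_closed [OF zero_less_one, symmetric] hair_def image_image by simp
  have "{4 * of_int i + 1..4 * of_int i + 3} = (\<lambda>t. 4 * of_int i + 1 + 2 * t) ` {0..1 :: real}"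
    unfolding image_affine_closed [OF zero_less_numeral] by simp
  then show "mid i j ` {0..1} = pinch ` ({4 * of_int i + 1..4 * of_int i + 3} \<times> {of_int j})"
    unfolding * mid_def image_image by (simp only: image_image)
  show "vert i j ` {0..1} = pinch ` ({4 * of_int i} \<times> {of_int j..of_int j + 1})"
    unfolding * image_affine_closed [OF zero_less_one, symmetric] vert_def image_image by simp
qed

text \<open>Hairs of column \<open>i + 1\<close> occur because the right ends of the horizontal
  sides are folded onto them.\<close>

definition face_edges :: "int \<Rightarrow> int \<Rightarrow> (real \<Rightarrow> real \<times> real \<times> real) set" where
  "face_edges i j = {hair i j, mid i j, hair (i + 1) j, vert i j, vert (i + 1) j,
     hair i (j + 1), mid i (j + 1), hair (i + 1) (j + 1)}"

lemma horizontal_side: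
  "pinch ` ({4 * of_int i..4 * of_int i + 4} \<times> {of_int j}) =
     hair i j ` {0..1} \<union> mid i j ` {0..1} \<union> hair (i + 1) j ` {0..1}"
proof -
  have "hair (i + 1) j ` {0..1} = pinch ` ({4 * of_int i + 3..4 * of_int i + 4} \<times> {of_int j})"
    using pinch_fold_image [of "i + 1" j] unfolding edge_closed_image by (simp add: algebra_simps)
  moreover have "{4 * of_int i..4 * of_int i + 4} \<times> {of_int j} =
    {4 * of_int i..4 * of_int i + 1} \<times> {of_int j} \<union> {4 * of_int i + 1..4 * of_int i + 3} \<times> {of_int j} \<union>
    {4 * of_int i + 3..4 * real_of_int i + 4} \<times> {real_of_int j}"
    by auto
  ultimately show ?thesis by (simp add: edge_closed_image image_Un)
qed

lemma rect_minus_Face: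
  "rect i j - region (Face i j) =
     {4 * of_int i..4 * of_int i + 4} \<times> {of_int j} \<union> {4 * of_int i..4 * of_int i + 4} \<times> {of_int (j + 1)} \<union>
     {4 * of_int i} \<times> {of_int j..of_int j + 1} \<union> {4 * of_int (i + 1)} \<times> {of_int j..of_int j + 1}"
  by (auto simp: rect_def)

lemma face_sphere_eq: "face i j ` sphere 0 1 = pinch ` (rect i j - region (Face i j))"
proof -
  have "face i j ` sphere 0 1 = face i j ` (cball 0 1 - ball 0 1)"
    by (simp only: cball_diff_eq_sphere)
  also have "\<dots> = face i j ` cball 0 1 - face i j ` ball 0 1"
    by (rule inj_on_image_set_diff [OF face_inj]) (simp_all add: ball_subset_cball subset_iff)
  also have "\<dots> = pinch ` (rect i j - region (Face i j))"
    unfolding face_cball face_ball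
    using inj_on_image_set_diff [OF inj_on_pinch_rect [of i j], of "rect i j" "region (Face i j)"]
      region_subset_rect(6) [of i j] by blast
  finally show ?thesis .
qed

lemma face_sphere: "face i j ` sphere 0 1 = (\<Union>e\<in>face_edges i j. e ` {0..1})"
  unfolding face_sphere_eq rect_minus_Face image_Un horizontal_side edge_closed_image(3) [symmetric]
    face_edges_def UN_insert UN_empty by blast

lemma face_edges_cells1: "face_edges i j \<subseteq> cells1 pinched_plane"
  by (auto simp: face_edges_def pinched_plane_def)

lemma finite_face_edges: "finite (face_edges i j)"
  by (simp add: face_edges_def)

lemma edge_endpoints:
  assumes "e \<in> cells1 pinched_plane"
  shows "e 0 \<in> cells0 pinched_plane" "e 1 \<in> cells0 pinched_plane"
proof -
  have v: "pinch (4 * of_int i, of_int j) \<in> cells0 pinched_plane"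
    "pinch (4 * of_int i + 1, of_int j) \<in> cells0 pinched_plane" for i j
    by (auto simp: pinched_plane_def)
  \<comment> \<open>The right end has abscissa \<open>4 * of_int i + 3\<close>, one unit before the
    next fold, and is therefore identified with the root of column \<open>i + 1\<close>.\<close>
  have "mid i j 1 = pinch (4 * of_int (i + 1) + 1, of_int j)" for i j
    using pinch_fold [of 1 "i + 1" j] by (simp add: mid_def algebra_simps)
  then have "mid i j 1 \<in> cells0 pinched_plane" for i j using v(2) by metis
  moreover have "vert i j 1 = pinch (4 * of_int i, of_int (j + 1))" for i j
    by (simp add: vert_def)
  then have "vert i j 1 \<in> cells0 pinched_plane" for i j using v(1) by metis
  moreover have "hair i j 0 \<in> cells0 pinched_plane" "hair i j 1 \<in> cells0 pinched_plane"
    "mid i j 0 \<in> cells0 pinched_plane" "vert i j 0 \<in> cells0 pinched_plane" for i j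
    using v by (simp_all add: hair_def mid_def vert_def)
  moreover have "\<exists>i j. e = hair i j \<or> e = mid i j \<or> e = vert i j"
    using assms unfolding pinched_plane_def by simp blast
  ultimately show "e 0 \<in> cells0 pinched_plane" "e 1 \<in> cells0 pinched_plane" by blast+
qed

section \<open>The axioms of a CW-complex\<close>

lemma disjoint_open_cells: "disjoint (open_cells pinched_plane)"
  unfolding open_cells_pinched_plane
proof (rule disjointI)
  fix a b assume "a \<in> range (\<lambda>k. pinch ` region k)" "b \<in> range (\<lambda>k. pinch ` region k)" "a \<noteq> b"
  then obtain k l where "a = pinch ` region k" "b = pinch ` region l" "k \<noteq> l" by blast
  then show "a \<inter> b = {}" using pinch_region_inject [of k l] by metis
qed

lemma pinch_region_eq_iff: "pinch ` region k = pinch ` region l \<longleftrightarrow> k = l"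
proof
  assume "pinch ` region k = pinch ` region l"
  then show "k = l" using region_nonempty [of l] by (intro pinch_region_inject) simp
qed simp

lemma inj_on_open_edge: "inj_on (\<lambda>e. e ` {0<..<1}) (cells1 pinched_plane)"
proof (rule inj_onI)
  fix e e' assume e: "e \<in> cells1 pinched_plane" "e' \<in> cells1 pinched_plane"
    and eq: "e ` {0<..<1} = e' ` {0<..<1}"
  have *: "\<exists>i j. e = hair i j \<or> e = mid i j \<or> e = vert i j" if "e \<in> cells1 pinched_plane" for e
    using that unfolding pinched_plane_def by simp blast
  obtain i j where 1: "e = hair i j \<or> e = mid i j \<or> e = vert i j" using * [OF e(1)] by blast
  obtain k l where 2: "e' = hair k l \<or> e' = mid k l \<or> e' = vert k l" using * [OF e(2)] by blast
  show "e = e'"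
    using 1 2 eq by (elim disjE) (simp_all add: edge_open_image pinch_region_eq_iff del: region.simps)
qed

lemma closed_range_pinch: "closed (range pinch)"
  using closed_image_if_norm_le [of UNIV pinch 1 UNIV] norm_diff_pinch
  by (simp add: continuous_on_pinch continuous_on_id)

text \<open>Local finiteness: a ball in the plane is covered by finitely many tiles, so the preimage
  of \<open>C\<close> is closed, and the closed map \<open>pinch\<close> takes it back to
  \<open>C\<close>.\<close>

lemma closed_if_closed_Int_faces:
  assumes C: "C \<subseteq> range pinch" and cl: "\<And>i j. closed (C \<inter> pinch ` rect i j)"
  shows "closed C"
proof -
  have *: "closed (pinch -` C \<inter> rect i j)" for i j
  proof -
    have "pinch -` C \<inter> rect i j = pinch -` (C \<inter> pinch ` rect i j) \<inter> rect i j" by blast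
    moreover have "closed (pinch -` (C \<inter> pinch ` rect i j) \<inter> rect i j)"
      using cl compact_imp_closed [OF compact_rect]
      by (intro closed_Int [OF closed_vimage]) (simp_all add: continuous_on_pinch continuous_on_id)
    ultimately show ?thesis by simp
  qed
  have "closed (pinch -` C)"
  proof (rule closed_if_closed_Int_cball [where a = 0])
    fix r :: real
    define N where "N = \<lceil>r\<rceil> + 1"
    have "cball 0 r \<subseteq> (\<Union>i\<in>{-N..N}. \<Union>j\<in>{-N..N}. rect i j)"
    proof
      fix p :: "real \<times> real" assume "p \<in> cball 0 r"
      then have r: "\<bar>fst p\<bar> \<le> r" "\<bar>snd p\<bar> \<le> r"
        using norm_fst_le [of "fst p" "snd p"] norm_snd_le [of "snd p" "fst p"] by simp_all
      have N: "r \<le> of_int N" by (simp add: N_def) linarith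
      have "- of_int N \<le> fst p / 4" "fst p / 4 \<le> of_int N" "- of_int N \<le> snd p" "snd p \<le> of_int N"
        using r N by linarith+
      then have "\<lfloor>fst p / 4\<rfloor> \<in> {-N..N}" "\<lfloor>snd p\<rfloor> \<in> {-N..N}"
        by (simp_all add: le_floor_iff floor_le_iff)
      moreover have "p \<in> rect \<lfloor>fst p / 4\<rfloor> \<lfloor>snd p\<rfloor>"
      proof -
        obtain a b where ab: "a = \<lfloor>fst p / 4\<rfloor>" "b = \<lfloor>snd p\<rfloor>" by blast
        have "of_int a \<le> fst p / 4" "fst p / 4 < of_int a + 1" "of_int b \<le> snd p" "snd p < of_int b + 1"
          unfolding ab by linarith+
        then show ?thesis unfolding ab [symmetric] by (simp add: rect_def mem_Times_iff)
      qed
      ultimately show "p \<in> (\<Union>i\<in>{-N..N}. \<Union>j\<in>{-N..N}. rect i j)" by blast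
    qed
    then have "pinch -` C \<inter> cball 0 r = (\<Union>i\<in>{-N..N}. \<Union>j\<in>{-N..N}. pinch -` C \<inter> rect i j) \<inter> cball 0 r"
      by blast
    moreover have "closed (\<Union>i\<in>{-N..N}. \<Union>j\<in>{-N..N}. pinch -` C \<inter> rect i j)"
      by (intro closed_UN ballI finite_atLeastAtMost_int *)
    ultimately show "closed (pinch -` C \<inter> cball 0 r)" by (simp add: closed_Int)
  qed
  then have "closed (pinch ` (pinch -` C))"
    using norm_diff_pinch by (intro closed_image_if_norm_le [of UNIV _ 1]) (auto simp: continuous_on_pinch continuous_on_id)
  then show ?thesis using C by (simp add: image_vimage_eq Int_absorb2)
qed

lemma subtopology_pinched_plane:
  "T \<subseteq> range pinch \<Longrightarrow> subtopology (cw_space pinched_plane) T = top_of_set T"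
  by (simp add: pinched_plane_simps subtopology_subtopology Int_absorb1)

lemma edge_range: "e \<in> cells1 pinched_plane \<Longrightarrow> range e \<subseteq> range pinch"
  by (auto simp: pinched_plane_def hair_def mid_def vert_def)

lemma face_range: "range (face i j) \<subseteq> range pinch"
  by (auto simp: face_def)

lemma face_map_clauses:
  "continuous_map (top_of_set (cball 0 1)) (cw_space pinched_plane) (face i j)"
  "homeomorphic_map (top_of_set (ball 0 1)) (subtopology (cw_space pinched_plane) (face i j ` ball 0 1)) (face i j)"
  "\<exists>\<C>. finite \<C> \<and> \<C> \<subseteq> (\<lambda>v. {v}) ` cells0 pinched_plane \<union> (\<lambda>e. e ` {0<..<1}) ` cells1 pinched_plane \<and>
     face i j ` sphere 0 1 \<subseteq> \<Union> \<C>"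
proof -
  have sub: "face i j ` S \<subseteq> range pinch" for S
    using image_mono [OF subset_UNIV] face_range by (rule order_trans)
  show "continuous_map (top_of_set (cball 0 1)) (cw_space pinched_plane) (face i j)"
    using face_continuous [of i j] sub [of "cball 0 1"]
    by (simp add: pinched_plane_simps image_subset_iff_funcset)
  have "homeomorphic_map (top_of_set (ball 0 1)) (top_of_set (face i j ` ball 0 1)) (face i j)"
    by (rule homeomorphic_map_if_compact [OF compact_cball face_continuous face_inj ball_subset_cball])
  then show "homeomorphic_map (top_of_set (ball 0 1))
      (subtopology (cw_space pinched_plane) (face i j ` ball 0 1)) (face i j)"
    by (simp only: subtopology_pinched_plane [OF sub])
  define A where "A = (\<lambda>e. e 0) ` face_edges i j \<union> (\<lambda>e. e 1) ` face_edges i j"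
  define \<C> where "\<C> = (\<lambda>v. {v}) ` A \<union> (\<lambda>e. e ` {0<..<1}) ` face_edges i j"
  have A: "A \<subseteq> cells0 pinched_plane"
    unfolding A_def
  proof (intro Un_least image_subsetI)
    fix e assume "e \<in> face_edges i j"
    then have "e \<in> cells1 pinched_plane" using face_edges_cells1 by (rule rev_subsetD)
    then show "e 0 \<in> cells0 pinched_plane" "e 1 \<in> cells0 pinched_plane"
      using edge_endpoints [of e] by simp_all
  qed
  show "\<exists>\<C>. finite \<C> \<and> \<C> \<subseteq> (\<lambda>v. {v}) ` cells0 pinched_plane \<union> (\<lambda>e. e ` {0<..<1}) ` cells1 pinched_plane \<and>
     face i j ` sphere 0 1 \<subseteq> \<Union> \<C>"
  proof (intro exI [of _ \<C>] conjI)
    show "finite \<C>" by (simp add: \<C>_def A_def finite_face_edges)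
    show "\<C> \<subseteq> (\<lambda>v. {v}) ` cells0 pinched_plane \<union> (\<lambda>e. e ` {0<..<1}) ` cells1 pinched_plane"
      unfolding \<C>_def by (rule Un_mono [OF image_mono [OF A] image_mono [OF face_edges_cells1]])
    have edge: "e ` {0..1} \<subseteq> A \<union> e ` {0<..<1}" if "e \<in> face_edges i j" for e
    proof -
      have "{0..1} = {0, 1} \<union> {0<..<1 :: real}" by auto
      then have "e ` {0..1} = {e 0, e 1} \<union> e ` {0<..<1}" by (metis image_Un image_insert image_empty)
      moreover have "e 0 \<in> A" "e 1 \<in> A" unfolding A_def using that by blast+
      then have "{e 0, e 1} \<subseteq> A" by simp
      ultimately show ?thesis by (metis Un_mono order_refl)
    qed
    have "\<Union> \<C> = A \<union> (\<Union>e\<in>face_edges i j. e ` {0<..<1})" by (simp add: \<C>_def)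
    then have C: "A \<subseteq> \<Union> \<C>" "\<And>e. e \<in> face_edges i j \<Longrightarrow> e ` {0<..<1} \<subseteq> \<Union> \<C>" by auto
    show "face i j ` sphere 0 1 \<subseteq> \<Union> \<C>"
      unfolding face_sphere
    proof (rule UN_least)
      fix e assume "e \<in> face_edges i j"
      then show "e ` {0..1} \<subseteq> \<Union> \<C>"
        using order_trans [OF edge Un_least [OF C]] by simp
    qed
  qed
qed

lemma cw_complex_pinched_plane: "cw_complex pinched_plane"
  unfolding cw_complex_def
proof (intro conjI)
  show "Hausdorff_space (cw_space pinched_plane)"
    by (simp add: pinched_plane_simps Hausdorff_space_subtopology)
  show "disjoint (open_cells pinched_plane)" by (rule disjoint_open_cells)
  show "\<Union> (open_cells pinched_plane) = topspace (cw_space pinched_plane)"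
  proof -
    have "pinch p \<in> \<Union> (range (\<lambda>k. pinch ` region k))" for p
    proof -
      obtain k q where "q \<in> region k" "pinch p = pinch q" by (rule region_cover)
      then have "pinch p \<in> pinch ` region k" by simp
      then show ?thesis by blast
    qed
    then have "range pinch \<subseteq> \<Union> (range (\<lambda>k. pinch ` region k))" by blast
    moreover have "\<Union> (range (\<lambda>k. pinch ` region k)) \<subseteq> range pinch" by blast
    ultimately show ?thesis unfolding open_cells_pinched_plane pinched_plane_simps by simp
  qed
  show "inj_on (\<lambda>e. e ` {0<..<1}) (cells1 pinched_plane)" by (rule inj_on_open_edge)
  show "inj_on (\<lambda>f. f ` ball 0 1) (cells2 pinched_plane)"
  proof (rule inj_onI)
    fix f g assume "f \<in> cells2 pinched_plane" "g \<in> cells2 pinched_plane" and eq: "f ` ball 0 1 = g ` ball 0 1"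
    then obtain i j k l where fg: "f = face i j" "g = face k l" by (auto simp: pinched_plane_simps)
    with eq have "pinch ` region (Face i j) = pinch ` region (Face k l)"
      by (simp only: face_ball)
    then show "f = g" unfolding fg pinch_region_eq_iff by simp
  qed
  show "\<forall>e\<in>cells1 pinched_plane. continuous_map (top_of_set {0..1}) (cw_space pinched_plane) e \<and>
        homeomorphic_map (top_of_set {0<..<1}) (subtopology (cw_space pinched_plane) (e ` {0<..<1})) e \<and>
        e 0 \<in> cells0 pinched_plane \<and> e 1 \<in> cells0 pinched_plane"
  proof
    fix e assume e: "e \<in> cells1 pinched_plane"
    have "homeomorphic_map (top_of_set {0<..<1}) (top_of_set (e ` {0<..<1})) e"
      using edge_continuous_inj [OF e] by (intro homeomorphic_map_if_compact [of "{0..1}"]) auto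
    moreover have "e ` {0<..<1} \<subseteq> range pinch" "e ` {0..1} \<subseteq> range pinch"
      using edge_range [OF e] by blast+
    ultimately show "continuous_map (top_of_set {0..1}) (cw_space pinched_plane) e \<and>
        homeomorphic_map (top_of_set {0<..<1}) (subtopology (cw_space pinched_plane) (e ` {0<..<1})) e \<and>
        e 0 \<in> cells0 pinched_plane \<and> e 1 \<in> cells0 pinched_plane"
      using edge_continuous_inj [OF e] edge_endpoints [OF e]
      unfolding subtopology_pinched_plane [OF \<open>e ` {0<..<1} \<subseteq> range pinch\<close>]
      by (simp add: pinched_plane_simps(1) image_subset_iff_funcset)
  qed
  show "\<forall>f\<in>cells2 pinched_plane.
       continuous_map (top_of_set (cball 0 1)) (cw_space pinched_plane) f \<and>
       homeomorphic_map (top_of_set (ball 0 1)) (subtopology (cw_space pinched_plane) (f ` ball 0 1)) f \<and>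
       (\<exists>\<C>. finite \<C> \<and>
            \<C> \<subseteq> (\<lambda>v. {v}) ` cells0 pinched_plane \<union> (\<lambda>e. e ` {0<..<1}) ` cells1 pinched_plane \<and>
            f ` sphere 0 1 \<subseteq> \<Union> \<C>)"
  proof
    fix f assume "f \<in> cells2 pinched_plane"
    then obtain i j where f: "f = face i j" by (auto simp: pinched_plane_simps)
    show "continuous_map (top_of_set (cball 0 1)) (cw_space pinched_plane) f \<and>
       homeomorphic_map (top_of_set (ball 0 1)) (subtopology (cw_space pinched_plane) (f ` ball 0 1)) f \<and>
       (\<exists>\<C>. finite \<C> \<and>
            \<C> \<subseteq> (\<lambda>v. {v}) ` cells0 pinched_plane \<union> (\<lambda>e. e ` {0<..<1}) ` cells1 pinched_plane \<and>
            f ` sphere 0 1 \<subseteq> \<Union> \<C>)"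
      unfolding f using face_map_clauses [of i j] by blast
  qed
  show "\<forall>C\<subseteq>topspace (cw_space pinched_plane).
       (\<forall>e\<in>cells1 pinched_plane. closedin (cw_space pinched_plane) (C \<inter> e ` {0..1})) \<and>
       (\<forall>f\<in>cells2 pinched_plane. closedin (cw_space pinched_plane) (C \<inter> f ` cball 0 1)) \<longrightarrow>
       closedin (cw_space pinched_plane) C"
  proof (intro allI impI, elim conjE)
    fix C assume C: "C \<subseteq> topspace (cw_space pinched_plane)"
      and cl: "\<forall>f\<in>cells2 pinched_plane. closedin (cw_space pinched_plane) (C \<inter> f ` cball 0 1)"
    have "closed (C \<inter> pinch ` rect i j)" for i j
    proof -
      have "face i j \<in> cells2 pinched_plane" by (auto simp: pinched_plane_simps)
      then have "closedin (cw_space pinched_plane) (C \<inter> face i j ` cball 0 1)" using cl by blast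
      then have "closedin (top_of_set (range pinch)) (C \<inter> pinch ` rect i j)"
        by (simp only: pinched_plane_simps(1) face_cball)
      then show ?thesis using closedin_closed_trans closed_range_pinch by blast
    qed
    then have "closed (C \<inter> pinch ` rect i j)" for i j by blast
    moreover have C': "C \<subseteq> range pinch" using C by (simp add: pinched_plane_simps(1))
    ultimately have "closed C" using closed_if_closed_Int_faces by blast
    with C' show "closedin (cw_space pinched_plane) C"
      by (simp only: pinched_plane_simps(1) closed_subset)
  qed
qed

lemma two_complex_pinched_plane: "two_complex pinched_plane"
  unfolding two_complex_def
proof (intro conjI ballI cw_complex_pinched_plane)
  show "cells2 pinched_plane \<noteq> {}" by (auto simp: pinched_plane_simps)
  fix f assume "f \<in> cells2 pinched_plane"
  then obtain i j where f: "f = face i j" by (auto simp: pinched_plane_simps)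
  have inj: "inj_on f (sphere 0 1)"
    using face_inj sphere_cball unfolding f by (rule inj_on_subset)
  show "\<exists>K. subdivision (top_of_set (sphere 0 1)) K \<and> combinatorial_map K pinched_plane f"
  proof (rule subdivision_pullback)
    show "continuous_on (sphere 0 1) f"
      using face_continuous sphere_cball unfolding f by (rule continuous_on_subset)
    show "f ` sphere 0 1 = (\<Union>e\<in>face_edges i j. e ` {0..1})"
      unfolding f by (rule face_sphere)
    show "f ` sphere 0 1 \<subseteq> range pinch" using face_range f by blast
    show "continuous_on {0..1} e \<and> inj_on e {0..1} \<and> e 0 \<in> cells0 pinched_plane \<and> e 1 \<in> cells0 pinched_plane"
      if "e \<in> face_edges i j" for e
    proof -
      have "e \<in> cells1 pinched_plane" using that face_edges_cells1 by blast
      then show ?thesis by (intro conjI edge_continuous_inj edge_endpoints)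
    qed
  qed (rule pinched_plane_simps inj disjoint_open_cells inj_on_open_edge finite_face_edges face_edges_cells1)+
  show "\<exists>U. open U \<and> z \<in> U \<and> inj_on f (U \<inter> sphere 0 1)" for z
    using inj by (intro exI [of _ UNIV]) auto
qed

section \<open>The condition C(4)\<close>

text \<open>The second hypothesis ensures that \<open>p\<close> is alone in its fibre: it is beyond
  the reach of every fold, or off the integer lines, or the centre of the fold.\<close>

lemma pinch_in_rect_imp:
  assumes "pinch p \<in> pinch ` rect i j" and "\<And>a :: int. \<bar>fst p - 4 * of_int a\<bar> > 1 \<or> snd p \<notin> \<int> \<or> fst p = 4 * of_int a"
  shows "p \<in> rect i j"
proof -
  obtain q where q: "q \<in> rect i j" "pinch p = pinch q" using assms(1) by blast
  have "p = q"
  proof (rule ccontr)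
    assume "p \<noteq> q"
    then obtain a b u where "0 < \<bar>u\<bar>" "\<bar>u\<bar> \<le> 1" "p = (4 * of_int a + u, of_int b)"
      using pinch_eq_imp [OF q(2)] by blast
    then show False using assms(2) [of a] by auto
  qed
  then show ?thesis using q by simp
qed

text \<open>The order is bottom, top, left, right. The horizontal midpoints have distance 2 from the
  nearest folds, beyond the ends of the hairs, and the vertical ones lie off the integer lines;
  hence none of the four is folded onto another point.\<close>

definition side_midpoint :: "int \<Rightarrow> int \<Rightarrow> nat \<Rightarrow> real \<times> real" where
  "side_midpoint i j m = [(4 * of_int i + 2, of_int j), (4 * of_int i + 2, of_int j + 1),
     (4 * of_int i, of_int j + 1 / 2), (4 * of_int i + 4, of_int j + 1 / 2)] ! m"

lemma side_midpoint_simps: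
  "side_midpoint i j 0 = (4 * of_int i + 2, of_int j)"
  "side_midpoint i j (Suc 0) = (4 * of_int i + 2, of_int j + 1)"
  "side_midpoint i j 2 = (4 * of_int i, of_int j + 1 / 2)"
  "side_midpoint i j 3 = (4 * of_int i + 4, of_int j + 1 / 2)"
  by (simp_all add: side_midpoint_def)

lemma less_4_cases: "m < 4 \<Longrightarrow> m = 0 \<or> m = Suc 0 \<or> m = 2 \<or> m = (3 :: nat)"
  by linarith

lemma side_midpoint_face: "m < 4 \<Longrightarrow> pinch (side_midpoint i j m) \<in> face i j ` sphere 0 1"
proof -
  assume "m < 4"
  then have "side_midpoint i j m \<in> rect i j - region (Face i j)"
    using less_4_cases [of m] by (auto simp: side_midpoint_simps rect_def)
  then have "pinch (side_midpoint i j m) \<in> pinch ` (rect i j - region (Face i j))" by blast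
  then show ?thesis by (simp add: face_sphere_eq)
qed

lemma half_not_Ints: "real_of_int j + 1 / 2 \<notin> \<int>"
proof
  assume "real_of_int j + 1 / 2 \<in> \<int>"
  then obtain k where "real_of_int j + 1 / 2 = of_int k" by (elim Ints_cases)
  then have "real_of_int j < of_int k" "real_of_int k < of_int j + 1" by linarith+
  then show False by (rule no_int_between)
qed

lemma side_midpoint_in_face:
  assumes "m < 4" "pinch (side_midpoint i j m) \<in> pinch ` rect a b"
  shows "side_midpoint i j m \<in> rect a b"
  using assms(2)
proof (rule pinch_in_rect_imp)
  fix c :: int
  have no: "\<bar>4 * real_of_int i + 2 - 4 * of_int c\<bar> > 1"
  proof (cases "c \<le> i")
    case True
    then have "real_of_int c \<le> of_int i" by simp
    then show ?thesis by linarith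
  next
    case False
    then have "real_of_int c \<ge> of_int (i + 1)" unfolding of_int_le_iff by simp
    then show ?thesis by simp
  qed
  show "\<bar>fst (side_midpoint i j m) - 4 * of_int c\<bar> > 1 \<or> snd (side_midpoint i j m) \<notin> \<int> \<or>
      fst (side_midpoint i j m) = 4 * of_int c"
    using no half_not_Ints less_4_cases [OF assms(1)] by (auto simp: side_midpoint_simps)
qed

lemma int_le_if_real: "real_of_int a < of_int b + 1 \<Longrightarrow> a \<le> b"
proof -
  assume "real_of_int a < of_int b + 1"
  then have "real_of_int a < of_int (b + 1)" by simp
  then have "a < b + 1" unfolding of_int_less_iff .
  then show ?thesis by simp
qed

text \<open>A midpoint of a horizontal side fixes the column and bounds the row from one side, a
  midpoint of a vertical side does the converse. Any two of these constraints leave only the tile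
  itself.\<close>

lemma two_side_midpoints:
  assumes "m < 4" "n < 4" "m \<noteq> n" "side_midpoint i j m \<in> rect a b" "side_midpoint i j n \<in> rect a b"
  shows "a = i \<and> b = j"
proof -
  have ri: "real_of_int (i + 1) = of_int i + 1" "real_of_int (i - 1) = of_int i - 1"
    "real_of_int (j + 1) = of_int j + 1" "real_of_int (j - 1) = of_int j - 1" by simp_all
  have 0: "a = i \<and> b \<le> j" if "side_midpoint i j 0 \<in> rect a b"
  proof -
    have "4 * real_of_int a \<le> 4 * of_int i + 2" "4 * real_of_int i + 2 \<le> 4 * of_int a + 4"
      "real_of_int b \<le> of_int j" using that unfolding side_midpoint_simps rect_def by simp_all
    then have "a \<le> i" "i \<le> a" "b \<le> j" by (intro int_le_if_real; linarith)+
    then show ?thesis by simp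
  qed
  have 1: "a = i \<and> b \<ge> j" if "side_midpoint i j (Suc 0) \<in> rect a b"
  proof -
    have "4 * real_of_int a \<le> 4 * of_int i + 2" "4 * real_of_int i + 2 \<le> 4 * of_int a + 4"
      "real_of_int j \<le> of_int b" using that unfolding side_midpoint_simps rect_def by simp_all
    then have "a \<le> i" "i \<le> a" "j \<le> b" by (intro int_le_if_real; linarith)+
    then show ?thesis by simp
  qed
  have 2: "b = j \<and> a \<le> i" if "side_midpoint i j 2 \<in> rect a b"
  proof -
    have "real_of_int b \<le> of_int j + 1 / 2" "real_of_int j + 1 / 2 \<le> of_int b + 1"
      "real_of_int a \<le> of_int i" using that unfolding side_midpoint_simps rect_def by simp_all
    then have "b \<le> j" "j \<le> b" "a \<le> i" by (intro int_le_if_real; linarith)+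
    then show ?thesis by simp
  qed
  have 3: "b = j \<and> a \<ge> i" if "side_midpoint i j 3 \<in> rect a b"
  proof -
    have "real_of_int b \<le> of_int j + 1 / 2" "real_of_int j + 1 / 2 \<le> of_int b + 1"
      "real_of_int i \<le> of_int a" using that unfolding side_midpoint_simps rect_def by simp_all
    then have "b \<le> j" "j \<le> b" "i \<le> a" by (intro int_le_if_real; linarith)+
    then show ?thesis by simp
  qed
  show ?thesis
    using less_4_cases [OF assms(1)] less_4_cases [OF assms(2)] assms(3-5) 0 1 2 3
    by (elim disjE) (hypsubst, force)+
qed

text \<open>If both 2-cells were the same face, its injectivity would make the two lifts equal, and
  the identity of the circle would be a forbidden homeomorphism.\<close>

lemma piece_in_two_faces:
  assumes "piece pinched_plane p"
  obtains i1 j1 i2 j2 where "(i1, j1) \<noteq> (i2, j2)" "p ` {0..1} \<subseteq> pinch ` rect i1 j1"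
    "p ` {0..1} \<subseteq> pinch ` rect i2 j2"
proof -
  obtain f1 f2 a1 a2 where f: "f1 \<in> cells2 pinched_plane" "f2 \<in> cells2 pinched_plane"
    and a: "factors_through p f1 a1" "factors_through p f2 a2"
    and no: "\<not> (\<exists>h. homeomorphic_map (top_of_set (sphere 0 1)) (top_of_set (sphere 0 1)) h \<and>
               (\<forall>t\<in>{0..1}. h (a1 t) = a2 t) \<and> (\<forall>z\<in>sphere 0 1. f2 (h z) = f1 z))"
    using assms unfolding piece_def by blast
  have "\<exists>i j. f1 = face i j" "\<exists>i j. f2 = face i j"
    using f by (simp_all add: pinched_plane_simps)
  then obtain i1 j1 i2 j2 where ij: "f1 = face i1 j1" "f2 = face i2 j2" by blast
  have a_S: "a t \<in> sphere 0 1" "f (a t) = p t" if "factors_through p f a" "t \<in> {0..1}" for f a t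
  proof -
    have "continuous_map (top_of_set {0..1}) (top_of_set (sphere 0 1)) a" "f (a t) = p t"
      using that unfolding factors_through_def by blast+
    then have "a ` {0..1} \<subseteq> sphere 0 1" "f (a t) = p t"
      using continuous_map_image_subset_topspace [of "top_of_set {0..1}" "top_of_set (sphere 0 1)" a]
      by simp_all
    then show "a t \<in> sphere 0 1" "f (a t) = p t"
      using that(2) by blast+
  qed
  have "(i1, j1) \<noteq> (i2, j2)"
  proof
    assume "(i1, j1) = (i2, j2)"
    then have eq: "f2 = f1" using ij by simp
    have "a1 t = a2 t" if "t \<in> {0..1}" for t
    proof (rule inj_onD [OF face_inj [of i1 j1]])
      show "face i1 j1 (a1 t) = face i1 j1 (a2 t)"
        using a_S(2) [OF a(1) that] a_S(2) [OF a(2) that] unfolding eq ij(1) [symmetric] by simp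
      show "a1 t \<in> cball 0 1" "a2 t \<in> cball 0 1" using a_S(1) [OF a(1) that] a_S(1) [OF a(2) that] by simp_all
    qed
    then have "homeomorphic_map (top_of_set (sphere 0 1)) (top_of_set (sphere 0 1)) id \<and>
               (\<forall>t\<in>{0..1}. id (a1 t) = a2 t) \<and> (\<forall>z\<in>sphere 0 1. f2 (id z) = f1 z)"
      unfolding eq by (simp add: homeomorphic_map_id)
    with no show False by (metis (lifting))
  qed
  moreover have "p ` {0..1} \<subseteq> pinch ` rect i j" if "factors_through p (face i j) a" for a i j
  proof (rule image_subsetI)
    fix t :: real assume "t \<in> {0..1}"
    note t = a_S [OF that this]
    have "face i j (a t) \<in> face i j ` cball 0 1" using t(1) by (intro imageI) simp
    then have "p t \<in> face i j ` cball 0 1" unfolding t(2) .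
    then show "p t \<in> pinch ` rect i j" by (simp add: face_cball)
  qed
  ultimately show thesis using that [of i1 j1 i2 j2] a(1) [unfolded ij] a(2) [unfolded ij] by metis
qed

lemma arcs_cover_circle:
  fixes \<theta> :: "nat \<Rightarrow> real"
  assumes "\<And>k. k < n \<Longrightarrow> \<theta> k < \<theta> (Suc k)" "\<theta> n = \<theta> 0 + 2 * pi" "z \<in> sphere 0 1"
  obtains k t where "k < n" "t \<in> {0..1}" "z = cis (linepath (\<theta> k) (\<theta> (Suc k)) t)"
proof -
  define a where "a = Arg z"
  have "norm z = 1" "z \<noteq> 0" using assms(3) by auto
  then have z: "z = cis a" using cis_Arg [of z] by (simp add: a_def sgn_eq)
  \<comment> \<open>The number of full turns that moves the argument into the half-open range from
    \<open>\<theta> 0\<close> to \<open>\<theta> 0 + 2 * pi\<close>.\<close>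
  define m where "m = \<lceil>(\<theta> 0 - a) / (2 * pi)\<rceil>"
  define \<phi> where "\<phi> = a + 2 * pi * of_int m"
  have "(\<theta> 0 - a) / (2 * pi) \<le> of_int m" "of_int m < (\<theta> 0 - a) / (2 * pi) + 1"
    unfolding m_def by linarith+
  then have \<phi>: "\<theta> 0 \<le> \<phi>" "\<phi> < \<theta> 0 + 2 * pi"
    by (simp_all add: \<phi>_def field_simps)
  have cis: "z = cis \<phi>"
    using z cis_multiple_2pi [of "of_int m"] by (simp add: \<phi>_def flip: cis_mult)
  have "\<exists>k<l. \<theta> k \<le> \<phi> \<and> \<phi> < \<theta> (Suc k)" if "\<phi> < \<theta> l" for l
    using that
  proof (induction l)
    case 0 then show ?case using \<phi> by simp
  next
    case (Suc l)
    then show ?case by (cases "\<phi> < \<theta> l") (auto simp: less_Suc_eq not_less)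
  qed
  then obtain k where k: "k < n" "\<theta> k \<le> \<phi>" "\<phi> < \<theta> (Suc k)" using \<phi> assms(2) by metis
  define t where "t = (\<phi> - \<theta> k) / (\<theta> (Suc k) - \<theta> k)"
  have "t \<in> {0..1}" using k by (simp add: t_def)
  moreover have "t * (\<theta> (Suc k) - \<theta> k) = \<phi> - \<theta> k" using k by (simp add: t_def)
  then have "\<phi> = linepath (\<theta> k) (\<theta> (Suc k)) t" by (simp add: linepath_def algebra_simps)
  ultimately show thesis using that k(1) cis by metis
qed

text \<open>No second face contains two of the four midpoints of the sides of a face, so a piece covers
  at most one of them.\<close>

lemma C_condition_pinched_plane: "C_condition 4 pinched_plane"
  unfolding C_condition_def
proof (intro ballI allI impI notI)
  fix f n assume "f \<in> cells2 pinched_plane" and n: "n < (4 :: nat)" and conc: "concat_of_pieces pinched_plane f n"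
  then obtain i j where f: "f = face i j" by (auto simp: pinched_plane_simps)
  obtain \<theta> :: "nat \<Rightarrow> real" where \<theta>: "\<And>k. k < n \<Longrightarrow> \<theta> k < \<theta> (Suc k)" "\<theta> n = \<theta> 0 + 2 * pi"
    and p: "\<And>k. k < n \<Longrightarrow> piece pinched_plane (\<lambda>t. f (cis (linepath (\<theta> k) (\<theta> (Suc k)) t)))"
    using conc unfolding concat_of_pieces_def by blast
  have "\<exists>k<n. pinch (side_midpoint i j m) \<in> (\<lambda>t. f (cis (linepath (\<theta> k) (\<theta> (Suc k)) t))) ` {0..1}"
    if m: "m < 4" for m
  proof -
    obtain z where z: "z \<in> sphere 0 1" "pinch (side_midpoint i j m) = f z"
      using side_midpoint_face [OF m, of i j] f by blast
    obtain k t where "k < n" "t \<in> {0..1}" "z = cis (linepath (\<theta> k) (\<theta> (Suc k)) t)"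
      using arcs_cover_circle [OF \<theta> z(1)] by metis
    then show ?thesis using z(2) by blast
  qed
  then obtain \<kappa> where \<kappa>: "\<And>m. m < 4 \<Longrightarrow> \<kappa> m < n \<and> pinch (side_midpoint i j m) \<in>
      (\<lambda>t. f (cis (linepath (\<theta> (\<kappa> m)) (\<theta> (Suc (\<kappa> m))) t))) ` {0..1}"
    by metis
  have "card (\<kappa> ` {..<4}) \<le> card {..<n}" using \<kappa> by (intro card_mono) auto
  then have "\<not> inj_on \<kappa> {..<4}" using n by (intro pigeonhole) simp
  then obtain m l where ml: "m < 4" "l < 4" "m \<noteq> l" "\<kappa> m = \<kappa> l" by (auto simp: inj_on_def)
  obtain i1 j1 i2 j2 where ij: "(i1, j1) \<noteq> (i2, j2)"
    and sub: "(\<lambda>t. f (cis (linepath (\<theta> (\<kappa> m)) (\<theta> (Suc (\<kappa> m))) t))) ` {0..1} \<subseteq> pinch ` rect i1 j1"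
      "(\<lambda>t. f (cis (linepath (\<theta> (\<kappa> m)) (\<theta> (Suc (\<kappa> m))) t))) ` {0..1} \<subseteq> pinch ` rect i2 j2"
    using piece_in_two_faces [OF p [of "\<kappa> m"]] \<kappa> [OF ml(1)] by blast
  \<comment> \<open>A face that contains the arc contains two side midpoints, so it must be
    \<open>face i j\<close>; the piece however lies in two different faces.\<close>
  have both: "a = i \<and> b = j"
    if "(\<lambda>t. f (cis (linepath (\<theta> (\<kappa> m)) (\<theta> (Suc (\<kappa> m))) t))) ` {0..1} \<subseteq> pinch ` rect a b" for a b
  proof (rule two_side_midpoints [OF ml(1-3)])
    show "side_midpoint i j m \<in> rect a b"
      using \<kappa> [OF ml(1)] that by (intro side_midpoint_in_face [OF ml(1)]) blast
    show "side_midpoint i j l \<in> rect a b"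
      using \<kappa> [OF ml(2)] that unfolding ml(4) [symmetric] by (intro side_midpoint_in_face [OF ml(2)]) blast
  qed
  from both [OF sub(1)] both [OF sub(2)] ij show False by simp
qed

section \<open>Planar diagrams folded onto a polygon\<close>

text \<open>The limit points of \<open>\<sigma>\<close> at a point \<open>y\<close> of the closure
  form a nested intersection of compact sets, connected because \<open>J\<close> is convex, and they
  lie in the fibre over \<open>y\<close>. A non-empty connected finite set is a point, so the limit
  exists.\<close>

lemma extend_section:
  fixes T :: "'a :: euclidean_space set" and \<theta> :: "'a \<Rightarrow> 'b :: euclidean_space"
  assumes T: "compact T" "continuous_on T \<theta>"
    and J: "convex J" "continuous_on J \<sigma>" "\<sigma> ` J \<subseteq> T" "\<And>q. q \<in> J \<Longrightarrow> \<theta> (\<sigma> q) = q"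
    and fin: "\<And>y. finite {x \<in> T. \<theta> x = y}"
  obtains \<tau> where "continuous_on (closure J) \<tau>" "\<And>q. q \<in> J \<Longrightarrow> \<tau> q = \<sigma> q"
    "\<And>q. q \<in> closure J \<Longrightarrow> \<tau> q \<in> T \<and> \<theta> (\<tau> q) = q"
proof -
  \<comment> \<open>The closure of the values of \<open>\<sigma>\<close> near \<open>y\<close>, at
    scale \<open>1 / real (Suc n)\<close>.\<close>
  define S where "S y n = closure (\<sigma> ` (J \<inter> ball y (1 / real (Suc n))))" for y and n :: nat
  have S_mono: "S y n \<subseteq> S y m" if "m \<le> n" for y m n
  proof -
    have "1 / real (Suc n) \<le> 1 / real (Suc m)" using that by (simp add: frac_le)
    then show ?thesis unfolding S_def by (intro closure_mono image_mono Int_mono subset_ball order_refl)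
  qed
  have S_T: "S y n \<subseteq> T" for y n
    unfolding S_def using J(3) compact_imp_closed [OF T(1)] by (intro closure_minimal) auto
  have S_compact: "compact (S y n)" for y n
    using compact_Int_closed [OF T(1), of "S y n"] S_T [of y n] by (simp add: S_def Int_absorb1)
  have S_connected: "connected (S y n)" for y n
    unfolding S_def
    by (rule connected_imp_connected_closure, rule connected_continuous_image,
        rule continuous_on_subset [OF J(2)]) (simp_all add: convex_connected convex_Int J(1))
  have S_ne: "S y n \<noteq> {}" if yJ: "y \<in> closure J" for y n
  proof -
    have "0 < 1 / real (Suc n)" by simp
    then obtain q where "q \<in> J" "dist q y < 1 / real (Suc n)"
      using yJ unfolding closure_approachable by blast
    then have "q \<in> J \<inter> ball y (1 / real (Suc n))" by (simp add: dist_commute)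
    then have "\<sigma> q \<in> \<sigma> ` (J \<inter> ball y (1 / real (Suc n)))" by (rule imageI)
    then have "\<sigma> q \<in> S y n" unfolding S_def by (rule closure_subset [THEN subsetD])
    then show ?thesis by blast
  qed
  have S_fibre: "\<theta> x = y" if x_in: "\<And>n. x \<in> S y n" for x y
  proof (rule ccontr)
    assume ne: "\<theta> x \<noteq> y"
    define d where "d = dist (\<theta> x) y / 2"
    have d: "0 < d" using ne by (simp add: d_def)
    have "x \<in> T" using x_in S_T by blast
    then obtain \<delta> where \<delta>: "0 < \<delta>" "\<And>x'. x' \<in> T \<Longrightarrow> dist x' x < \<delta> \<Longrightarrow> dist (\<theta> x') (\<theta> x) < d"
      using T(2) d unfolding continuous_on_iff by metis
    obtain n where n: "1 / real (Suc n) < d" using d by (metis nat_approx_posE)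
    obtain q where q: "q \<in> J" "q \<in> ball y (1 / real (Suc n))" "dist (\<sigma> q) x < \<delta>"
    proof -
      have "\<exists>z\<in>\<sigma> ` (J \<inter> ball y (1 / real (Suc n))). dist z x < \<delta>"
        using x_in [of n] \<delta>(1) unfolding S_def closure_approachable by blast
      then show thesis using that by blast
    qed
    have "\<sigma> q \<in> T" using J(3) q(1) by (rule subsetD [OF _ imageI])
    then have "dist (\<theta> (\<sigma> q)) (\<theta> x) < d" using q(3) by (rule \<delta>(2))
    then have "dist q (\<theta> x) < d" unfolding J(4) [OF q(1)] .
    moreover have "dist y q < d" using q(2) n by (simp add: dist_norm)
    moreover have "dist (\<theta> x) y \<le> dist q (\<theta> x) + dist y q"
      using dist_triangle [of "\<theta> x" y q] by (simp only: dist_commute)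
    ultimately have "dist (\<theta> x) y < 2 * d" by linarith
    then show False by (simp add: d_def)
  qed
  have sing: "\<exists>p. \<Inter> (range (S y)) = {p}" if "y \<in> closure J" for y
  proof -
    have "connected (\<Inter> (range (S y)))"
      by (rule connected_nest [OF S_compact S_connected S_mono])
    moreover have "\<Inter> (range (S y)) \<subseteq> {x \<in> T. \<theta> x = y}"
    proof
      fix x assume "x \<in> \<Inter> (range (S y))"
      then have x: "x \<in> S y n" for n by (rule InterD) (rule rangeI)
      then show "x \<in> {x \<in> T. \<theta> x = y}" using S_fibre [OF x] subsetD [OF S_T x] by simp
    qed
    then have "finite (\<Inter> (range (S y)))" by (rule finite_subset [OF _ fin])
    moreover have "\<Inter> (range (S y)) \<noteq> {}"
      by (rule compact_nest [OF S_compact S_ne [OF that] S_mono])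
    ultimately show ?thesis using connected_finite_iff_sing [of "\<Inter> (range (S y))"] by simp
  qed
  define \<tau> where "\<tau> y = (SOME p. \<Inter> (range (S y)) = {p})" for y
  have \<tau>: "\<Inter> (range (S y)) = {\<tau> y}" if "y \<in> closure J" for y
    using someI_ex [OF sing [OF that]] by (simp add: \<tau>_def)
  have \<tau>_in: "\<tau> y \<in> S y n" if "y \<in> closure J" for y n
  proof -
    have "\<tau> y \<in> \<Inter> (range (S y))" unfolding \<tau> [OF that] by (rule singletonI)
    then show ?thesis by (rule InterD) (rule rangeI)
  qed
  have \<tau>_eq: "x = \<tau> y" if y: "y \<in> closure J" and x: "\<And>n. x \<in> S y n" for x y
  proof -
    have "x \<in> \<Inter> (range (S y))" using x by (rule INT_I)
    then show ?thesis unfolding \<tau> [OF y] by (rule singletonD)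
  qed
  \<comment> \<open>Compactness turns a one-point intersection into smallness of some
    \<open>S y n\<close>; continuity of \<open>\<tau>\<close> follows from this.\<close>
  have small: "\<exists>n. S y n \<subseteq> ball (\<tau> y) e" if "y \<in> closure J" "0 < e" for y e
  proof (rule ccontr)
    assume "\<nexists>n. S y n \<subseteq> ball (\<tau> y) e"
    then have "S y n - ball (\<tau> y) e \<noteq> {}" for n by blast
    moreover have "S y n - ball (\<tau> y) e \<subseteq> S y m - ball (\<tau> y) e" if "m \<le> n" for m n
      using S_mono [OF that] by blast
    ultimately have "\<Inter> (range (\<lambda>n. S y n - ball (\<tau> y) e)) \<noteq> {}"
      by (intro compact_nest [OF compact_diff [OF S_compact open_ball]])
    then obtain p where "p \<in> \<Inter> (range (\<lambda>n. S y n - ball (\<tau> y) e))" by (metis ex_in_conv)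
    then have p: "p \<in> S y n" "p \<notin> ball (\<tau> y) e" for n by auto
    then have "p = \<tau> y" using \<tau>_eq [OF that(1)] by simp
    then show False using p(2) that(2) by simp
  qed
  show thesis
  proof (rule that)
    show "\<tau> q = \<sigma> q" if "q \<in> J" for q
    proof -
      have "\<sigma> q \<in> S q n" for n
      proof -
        have "q \<in> J \<inter> ball q (1 / real (Suc n))" using that by simp
        then have "\<sigma> q \<in> \<sigma> ` (J \<inter> ball q (1 / real (Suc n)))" by (rule imageI)
        then show ?thesis unfolding S_def by (rule closure_subset [THEN subsetD])
      qed
      moreover have "q \<in> closure J" using closure_subset that by (rule subsetD)
      ultimately show ?thesis using \<tau>_eq [of q "\<sigma> q"] by simp
    qed
    show "\<tau> q \<in> T \<and> \<theta> (\<tau> q) = q" if "q \<in> closure J" for q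
    proof -
      have "\<And>n. \<tau> q \<in> S q n" using \<tau>_in [OF that] .
      then show ?thesis using S_fibre subsetD [OF S_T] by blast
    qed
    show "continuous_on (closure J) \<tau>"
      unfolding continuous_on_iff
    proof (intro ballI allI impI)
      fix y and e :: real assume y: "y \<in> closure J" and e: "0 < e"
      obtain n where n: "S y n \<subseteq> ball (\<tau> y) e" using small [OF y e] by blast
      show "\<exists>d>0. \<forall>y'\<in>closure J. dist y' y < d \<longrightarrow> dist (\<tau> y') (\<tau> y) < e"
      proof (intro exI [of _ "1 / real (Suc n)"] conjI ballI impI)
        fix y' assume y': "y' \<in> closure J" "dist y' y < 1 / real (Suc n)"
        obtain m where m: "1 / real (Suc m) < 1 / real (Suc n) - dist y' y"
          using y'(2) by (metis diff_gt_0_iff_gt nat_approx_posE)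
        have "ball y' (1 / real (Suc m)) \<subseteq> ball y (1 / real (Suc n))"
          unfolding ball_subset_ball_iff using m by (simp add: dist_commute)
        then have "S y' m \<subseteq> S y n" unfolding S_def by (intro closure_mono image_mono) blast
        moreover have "\<tau> y' \<in> S y' m" by (rule \<tau>_in [OF y'(1)])
        ultimately have "\<tau> y' \<in> ball (\<tau> y) e" using n by blast
        then show "dist (\<tau> y') (\<tau> y) < e" by (simp add: dist_commute)
      qed simp
    qed
  qed
qed

section \<open>Planar diagrams over a polygon with two classes of sides\<close>

text \<open>Collects what even valence needs from a map \<open>\<theta>\<close> of a finite planar
  complex to a polygon with interior \<open>I\<close>, corners \<open>V\<close> and open sides in
  two classes \<open>HS\<close> and \<open>NS\<close>. On open cells \<open>\<theta>\<close> is
  given through its inverse branches \<open>\<sigma>\<close>. The maps of \<open>reflection\<close>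
  provide the model of a neighbourhood of an interior edge point, two copies of the polygon glued
  along a side; \<open>corner\<close> expresses that the two classes alternate around the
  polygon.\<close>

locale folded_diagram =
  fixes D :: "complex cell_complex" and T :: "complex set" and \<theta> :: "complex \<Rightarrow> real \<times> real"
    and I :: "(real \<times> real) set" and HS NS :: "(real \<times> real) set set" and V :: "(real \<times> real) set"
  assumes cw: "cw_complex D" and top: "cw_space D = top_of_set T"
    and fin: "finite (cells0 D)" "finite (cells1 D)" "finite (cells2 D)"
    and cont: "continuous_on T \<theta>"
    and vertex: "\<And>v. v \<in> cells0 D \<Longrightarrow> \<theta> v \<in> V"
    and edge: "\<And>e. e \<in> cells1 D \<Longrightarrow> \<exists>A\<in>HS \<union> NS. \<exists>\<sigma>. continuous_on A \<sigma> \<and> \<sigma> ` A = e ` {0<..<1} \<and> (\<forall>q\<in>A. \<theta> (\<sigma> q) = q)"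
    and face: "\<And>f. f \<in> cells2 D \<Longrightarrow> \<exists>\<sigma>. continuous_on I \<sigma> \<and> \<sigma> ` I = f ` ball 0 1 \<and> (\<forall>q\<in>I. \<theta> (\<sigma> q) = q)"
    and I: "open I" "convex I" "bounded I"
    and HS_NS: "HS \<inter> NS = {}"
    and side: "\<And>A. A \<in> HS \<union> NS \<Longrightarrow> convex A \<and> A \<noteq> {} \<and> bounded A \<and> A \<subseteq> closure I \<and> A \<inter> I = {} \<and> A \<inter> V = {}"
    and sides_disjoint: "\<And>A B. A \<in> HS \<union> NS \<Longrightarrow> B \<in> HS \<union> NS \<Longrightarrow> A \<inter> B \<noteq> {} \<Longrightarrow> A = B"
    and I_V: "I \<inter> V = {}"
    and side_ends: "\<And>A. A \<in> HS \<union> NS \<Longrightarrow> \<exists>a b. a \<noteq> b \<and> closure A = A \<union> {a, b} \<and> a \<notin> A \<and> b \<notin> A"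
    and reflection: "\<And>A. A \<in> HS \<union> NS \<Longrightarrow> \<exists>r. continuous_on UNIV r \<and> inj r \<and> (\<forall>q\<in>A. r q = q) \<and>
      (\<forall>q\<in>I. r q \<notin> closure I) \<and> (\<forall>q. q \<in> closure I \<longrightarrow> r q \<in> closure I \<longrightarrow> r q = q) \<and>
      (\<forall>y\<in>A. \<exists>B. open B \<and> y \<in> B \<and> B \<subseteq> I \<union> A \<union> r -` I)"
    and corner: "\<And>w. w \<in> V \<Longrightarrow> \<exists>!A. A \<in> HS \<and> w \<in> closure A" "\<And>w. w \<in> V \<Longrightarrow> \<exists>!A. A \<in> NS \<and> w \<in> closure A"
begin

lemma edge_map:
  assumes "e \<in> cells1 D"
  shows "continuous_on {0..1} e" "e ` {0..1} \<subseteq> T" "e 0 \<in> cells0 D" "e 1 \<in> cells0 D"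
  using cw assms unfolding cw_complex_def top by (auto simp: image_subset_iff_funcset)

lemma face_map:
  assumes "f \<in> cells2 D"
  shows "continuous_on (cball 0 1) f" "f ` cball 0 1 \<subseteq> T"
  using cw assms unfolding cw_complex_def top by (auto simp: image_subset_iff_funcset)

lemma cw_clauses:
  "disjoint (open_cells D)" "\<Union> (open_cells D) = T"
  "inj_on (\<lambda>e. e ` {0<..<1}) (cells1 D)" "inj_on (\<lambda>f. f ` ball 0 1) (cells2 D)"
proof -
  have "disjoint (open_cells D) \<and> \<Union> (open_cells D) = topspace (cw_space D) \<and>
     inj_on (\<lambda>e. e ` {0<..<1}) (cells1 D) \<and> inj_on (\<lambda>f. f ` ball 0 1) (cells2 D)"
    using cw unfolding cw_complex_def by (elim conjE) (intro conjI)
  then show "disjoint (open_cells D)" "\<Union> (open_cells D) = T"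
    "inj_on (\<lambda>e. e ` {0<..<1}) (cells1 D)" "inj_on (\<lambda>f. f ` ball 0 1) (cells2 D)"
    unfolding top by simp_all
qed

lemma cell_disjoint:
  assumes "c \<in> open_cells D" "d \<in> open_cells D" "c \<inter> d \<noteq> {}"
  shows "c = d"
  using disjointD [OF cw_clauses(1) assms(1,2)] assms(3) by metis

lemma open_cells_in:
  "v \<in> cells0 D \<Longrightarrow> {v} \<in> open_cells D" "e \<in> cells1 D \<Longrightarrow> e ` {0<..<1} \<in> open_cells D"
  "f \<in> cells2 D \<Longrightarrow> f ` ball 0 1 \<in> open_cells D"
  unfolding open_cells_def by (simp_all add: image_iff) blast+

lemma open_cell_subset: "c \<in> open_cells D \<Longrightarrow> c \<subseteq> T"
  unfolding cw_clauses(2) [symmetric] by (rule Union_upper)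

lemma edge_eq:
  assumes "e \<in> cells1 D" "e' \<in> cells1 D" "e ` {0<..<1} \<inter> e' ` {0<..<1} \<noteq> {}"
  shows "e = e'"
  using cell_disjoint [OF open_cells_in(2) [OF assms(1)] open_cells_in(2) [OF assms(2)] assms(3)]
    cw_clauses(3) assms(1,2) by (simp only: inj_on_def)

lemma face_eq:
  assumes "f \<in> cells2 D" "f' \<in> cells2 D" "f ` ball 0 1 \<inter> f' ` ball 0 1 \<noteq> {}"
  shows "f = f'"
  using cell_disjoint [OF open_cells_in(3) [OF assms(1)] open_cells_in(3) [OF assms(2)] assms(3)]
    cw_clauses(4) assms(1,2) by (simp only: inj_on_def)

lemma cell_cases:
  assumes "x \<in> T"
  shows "x \<in> cells0 D \<or> (\<exists>e\<in>cells1 D. x \<in> e ` {0<..<1}) \<or> (\<exists>f\<in>cells2 D. x \<in> f ` ball 0 1)"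
proof -
  obtain c where "c \<in> open_cells D" "x \<in> c" using assms unfolding cw_clauses(2) [symmetric] by (rule UnionE)
  then show ?thesis unfolding open_cells_def by (elim UnE imageE) (hypsubst, blast)+
qed

lemma vertex_in: "cells0 D \<subseteq> T"
proof
  fix v assume "v \<in> cells0 D"
  from open_cells_in(1) [OF this] show "v \<in> T"
    unfolding cw_clauses(2) [symmetric] by (rule UnionI) simp
qed

lemma compact_T: "compact T"
proof -
  have "T = cells0 D \<union> (\<Union>e\<in>cells1 D. e ` {0..1}) \<union> (\<Union>f\<in>cells2 D. f ` cball 0 1)"
  proof
    show "T \<subseteq> cells0 D \<union> (\<Union>e\<in>cells1 D. e ` {0..1}) \<union> (\<Union>f\<in>cells2 D. f ` cball 0 1)"
    proof
      fix x assume "x \<in> T"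
      from cell_cases [OF this]
      show "x \<in> cells0 D \<union> (\<Union>e\<in>cells1 D. e ` {0..1}) \<union> (\<Union>f\<in>cells2 D. f ` cball 0 1)"
      proof (elim disjE bexE)
        fix e assume e: "e \<in> cells1 D" "x \<in> e ` {0<..<1}"
        have "e ` {0<..<1} \<subseteq> e ` {0..1}" by (intro image_mono greaterThanLessThan_subseteq_atLeastAtMost_iff [THEN iffD2]) simp
        then have "x \<in> e ` {0..1}" using e(2) by (rule subsetD)
        then show ?thesis by (intro UnI1 UnI2 UN_I [OF e(1)])
      next
        fix f assume f: "f \<in> cells2 D" "x \<in> f ` ball 0 1"
        have "f ` ball 0 1 \<subseteq> f ` cball 0 1" by (intro image_mono ball_subset_cball)
        then have "x \<in> f ` cball 0 1" using f(2) by (rule subsetD)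
        then show ?thesis by (intro UnI2 UN_I [OF f(1)])
      qed simp
    qed
    show "cells0 D \<union> (\<Union>e\<in>cells1 D. e ` {0..1}) \<union> (\<Union>f\<in>cells2 D. f ` cball 0 1) \<subseteq> T"
      by (rule Un_least [OF Un_least [OF vertex_in UN_least [OF edge_map(2)]] UN_least [OF face_map(2)]])
  qed
  moreover have "compact \<dots>"
  proof (rule compact_Un [OF compact_Un])
    show "compact (cells0 D)" using fin(1) by (rule finite_imp_compact)
    show "compact (\<Union>e\<in>cells1 D. e ` {0..1})"
      by (rule compact_UN [OF fin(2)]) (intro compact_continuous_image edge_map(1) compact_Icc)
    show "compact (\<Union>f\<in>cells2 D. f ` cball 0 1)"
      by (rule compact_UN [OF fin(3)]) (intro compact_continuous_image face_map(1) compact_cball)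
  qed
  ultimately show ?thesis by (rule ssubst)
qed

definition side_of :: "(real \<Rightarrow> complex) \<Rightarrow> (real \<times> real) set" where
  "side_of e = (SOME A. A \<in> HS \<union> NS \<and> (\<exists>\<sigma>. continuous_on A \<sigma> \<and> \<sigma> ` A = e ` {0<..<1} \<and> (\<forall>q\<in>A. \<theta> (\<sigma> q) = q)))"

lemma side_of:
  assumes "e \<in> cells1 D"
  shows "side_of e \<in> HS \<union> NS"
    "\<exists>\<sigma>. continuous_on (side_of e) \<sigma> \<and> \<sigma> ` side_of e = e ` {0<..<1} \<and> (\<forall>q\<in>side_of e. \<theta> (\<sigma> q) = q)"
proof -
  have "\<exists>A. A \<in> HS \<union> NS \<and> (\<exists>\<sigma>. continuous_on A \<sigma> \<and> \<sigma> ` A = e ` {0<..<1} \<and> (\<forall>q\<in>A. \<theta> (\<sigma> q) = q))"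
    using edge [OF assms] by blast
  from someI_ex [OF this] show "side_of e \<in> HS \<union> NS"
    "\<exists>\<sigma>. continuous_on (side_of e) \<sigma> \<and> \<sigma> ` side_of e = e ` {0<..<1} \<and> (\<forall>q\<in>side_of e. \<theta> (\<sigma> q) = q)"
    unfolding side_of_def by blast+
qed

text \<open>Each open cell has at most one point over \<open>y\<close>, having an inverse branch of
  \<open>\<theta>\<close>, and there are finitely many cells. This is the hypothesis under which
  sections extend.\<close>

lemma finite_fibre: "finite {x \<in> T. \<theta> x = y}"
proof -
  have "finite {x \<in> e ` {0<..<1}. \<theta> x = y}" if e: "e \<in> cells1 D" for e
  proof -
    obtain \<sigma> where \<sigma>: "\<sigma> ` side_of e = e ` {0<..<1}" "\<forall>q\<in>side_of e. \<theta> (\<sigma> q) = q"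
      using side_of(2) [OF e] by blast
    have "{x \<in> e ` {0<..<1}. \<theta> x = y} \<subseteq> {\<sigma> y}" unfolding \<sigma>(1) [symmetric] using \<sigma>(2) by auto
    then show ?thesis by (rule finite_subset) simp
  qed
  moreover have "finite {x \<in> f ` ball 0 1. \<theta> x = y}" if f: "f \<in> cells2 D" for f
  proof -
    obtain \<sigma> where \<sigma>: "\<sigma> ` I = f ` ball 0 1" "\<forall>q\<in>I. \<theta> (\<sigma> q) = q" using face [OF f] by blast
    have "{x \<in> f ` ball 0 1. \<theta> x = y} \<subseteq> {\<sigma> y}" unfolding \<sigma>(1) [symmetric] using \<sigma>(2) by auto
    then show ?thesis by (rule finite_subset) simp
  qed
  ultimately have "finite (cells0 D \<union> (\<Union>e\<in>cells1 D. {x \<in> e ` {0<..<1}. \<theta> x = y}) \<union>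
      (\<Union>f\<in>cells2 D. {x \<in> f ` ball 0 1. \<theta> x = y}))"
    by (intro finite_UnI finite_UN_I fin)
  moreover have "{x \<in> T. \<theta> x = y} \<subseteq> cells0 D \<union> (\<Union>e\<in>cells1 D. {x \<in> e ` {0<..<1}. \<theta> x = y}) \<union>
      (\<Union>f\<in>cells2 D. {x \<in> f ` ball 0 1. \<theta> x = y})"
  proof
    fix x assume "x \<in> {x \<in> T. \<theta> x = y}"
    then have x: "x \<in> T" "\<theta> x = y" by simp_all
    then show "x \<in> cells0 D \<union> (\<Union>e\<in>cells1 D. {x \<in> e ` {0<..<1}. \<theta> x = y}) \<union>
      (\<Union>f\<in>cells2 D. {x \<in> f ` ball 0 1. \<theta> x = y})"
      using cell_cases [OF x(1)] by blast
  qed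
  ultimately show ?thesis by (rule rev_finite_subset)
qed

section \<open>Sections over closed cells\<close>

text \<open>A substitute for the characteristic map. The latter may be badly behaved on the
  boundary, whereas a section of \<open>\<theta>\<close> is injective on the closed polygon or side
  and equips the closed cell with coordinates.\<close>

definition is_section :: "(real \<times> real) set \<Rightarrow> complex set \<Rightarrow> (real \<times> real \<Rightarrow> complex) \<Rightarrow> bool" where
  "is_section J c \<tau> \<longleftrightarrow> continuous_on (closure J) \<tau> \<and> \<tau> ` J = c \<and> \<tau> ` closure J = closure c \<and>
     (\<forall>q\<in>closure J. \<tau> q \<in> T \<and> \<theta> (\<tau> q) = q)"

lemma section_exists:
  assumes "convex J" "bounded J" "continuous_on J \<sigma>" "\<sigma> ` J = c" "c \<subseteq> T" "\<forall>q\<in>J. \<theta> (\<sigma> q) = q"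
  shows "\<exists>\<tau>. is_section J c \<tau>"
proof -
  obtain \<tau> where \<tau>: "continuous_on (closure J) \<tau>" "\<And>q. q \<in> J \<Longrightarrow> \<tau> q = \<sigma> q"
    "\<And>q. q \<in> closure J \<Longrightarrow> \<tau> q \<in> T \<and> \<theta> (\<tau> q) = q"
    by (rule extend_section [OF compact_T cont assms(1,3)]) (use assms finite_fibre in auto)
  have im: "\<tau> ` J = c" using \<tau>(2) assms(4) by (metis image_cong)
  have "compact (\<tau> ` closure J)"
    using assms(2) \<tau>(1) by (intro compact_continuous_image) (simp_all add: compact_closure)
  then have "closure c \<subseteq> \<tau> ` closure J"
    using im closure_subset [of J] by (intro closure_minimal compact_imp_closed) auto
  moreover have "\<tau> ` closure J \<subseteq> closure c"
    using \<tau>(1) im closure_subset [of c] by (intro image_closure_subset) auto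
  ultimately show ?thesis using \<tau> im unfolding is_section_def by blast
qed

lemma is_sectionD:
  assumes "is_section J c \<tau>"
  shows "continuous_on (closure J) \<tau>" "\<tau> ` J = c" "\<tau> ` closure J = closure c"
    "\<And>q. q \<in> closure J \<Longrightarrow> \<tau> q \<in> T" "\<And>q. q \<in> closure J \<Longrightarrow> \<theta> (\<tau> q) = q"
  using assms by (simp_all add: is_section_def)

definition edge_section :: "(real \<Rightarrow> complex) \<Rightarrow> real \<times> real \<Rightarrow> complex" where
  "edge_section e = (SOME \<tau>. is_section (side_of e) (e ` {0<..<1}) \<tau>)"

definition face_section :: "(complex \<Rightarrow> complex) \<Rightarrow> real \<times> real \<Rightarrow> complex" where
  "face_section f = (SOME \<tau>. is_section I (f ` ball 0 1) \<tau>)"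

lemma edge_section:
  assumes "e \<in> cells1 D"
  shows "continuous_on (closure (side_of e)) (edge_section e)" "edge_section e ` side_of e = e ` {0<..<1}"
    "edge_section e ` closure (side_of e) = closure (e ` {0<..<1})"
    "\<And>q. q \<in> closure (side_of e) \<Longrightarrow> edge_section e q \<in> T"
    "\<And>q. q \<in> closure (side_of e) \<Longrightarrow> \<theta> (edge_section e q) = q"
proof -
  have "e ` {0<..<1} \<subseteq> T" by (rule open_cell_subset [OF open_cells_in(2) [OF assms]])
  moreover obtain \<sigma> where "continuous_on (side_of e) \<sigma>" "\<sigma> ` side_of e = e ` {0<..<1}"
    "\<forall>q\<in>side_of e. \<theta> (\<sigma> q) = q" using side_of(2) [OF assms] by (elim exE conjE)
  moreover have "convex (side_of e)" "bounded (side_of e)" using side [OF side_of(1) [OF assms]] by simp_all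
  ultimately have "\<exists>\<tau>. is_section (side_of e) (e ` {0<..<1}) \<tau>"
    using section_exists [of "side_of e" \<sigma> "e ` {0<..<1}"] by simp
  from someI_ex [OF this] have *: "is_section (side_of e) (e ` {0<..<1}) (edge_section e)"
    unfolding edge_section_def .
  show "continuous_on (closure (side_of e)) (edge_section e)" "edge_section e ` side_of e = e ` {0<..<1}"
    "edge_section e ` closure (side_of e) = closure (e ` {0<..<1})"
    "\<And>q. q \<in> closure (side_of e) \<Longrightarrow> edge_section e q \<in> T"
    "\<And>q. q \<in> closure (side_of e) \<Longrightarrow> \<theta> (edge_section e q) = q"
    using is_sectionD [OF *] by simp_all
qed

lemma face_section:
  assumes "f \<in> cells2 D"
  shows "continuous_on (closure I) (face_section f)" "face_section f ` I = f ` ball 0 1"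
    "face_section f ` closure I = closure (f ` ball 0 1)"
    "\<And>q. q \<in> closure I \<Longrightarrow> face_section f q \<in> T"
    "\<And>q. q \<in> closure I \<Longrightarrow> \<theta> (face_section f q) = q"
proof -
  have "f ` ball 0 1 \<subseteq> T" by (rule open_cell_subset [OF open_cells_in(3) [OF assms]])
  moreover obtain \<sigma> where "continuous_on I \<sigma>" "\<sigma> ` I = f ` ball 0 1" "\<forall>q\<in>I. \<theta> (\<sigma> q) = q"
    using face [OF assms] by (elim exE conjE)
  ultimately have "\<exists>\<tau>. is_section I (f ` ball 0 1) \<tau>"
    using section_exists [of I \<sigma> "f ` ball 0 1"] I(2,3) by simp
  from someI_ex [OF this] have *: "is_section I (f ` ball 0 1) (face_section f)"
    unfolding face_section_def .
  show "continuous_on (closure I) (face_section f)" "face_section f ` I = f ` ball 0 1"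
    "face_section f ` closure I = closure (f ` ball 0 1)"
    "\<And>q. q \<in> closure I \<Longrightarrow> face_section f q \<in> T"
    "\<And>q. q \<in> closure I \<Longrightarrow> \<theta> (face_section f q) = q"
    using is_sectionD [OF *] by simp_all
qed

lemma theta_edge:
  assumes "e \<in> cells1 D" "x \<in> e ` {0<..<1}"
  shows "\<theta> x \<in> side_of e \<and> x = edge_section e (\<theta> x)"
proof -
  obtain q where q: "q \<in> side_of e" "x = edge_section e q"
    using assms(2) unfolding edge_section(2) [OF assms(1), symmetric] by (rule imageE)
  then have "\<theta> x = q" using edge_section(5) [OF assms(1) subsetD [OF closure_subset q(1)]] by simp
  then show ?thesis using q by simp
qed

lemma theta_face:
  assumes "f \<in> cells2 D" "x \<in> f ` ball 0 1"
  shows "\<theta> x \<in> I \<and> x = face_section f (\<theta> x)"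
proof -
  obtain q where q: "q \<in> I" "x = face_section f q"
    using assms(2) unfolding face_section(2) [OF assms(1), symmetric] by (rule imageE)
  then have "\<theta> x = q" using face_section(5) [OF assms(1) subsetD [OF closure_subset q(1)]] by simp
  then show ?thesis using q by simp
qed

text \<open>\<open>\<theta>\<close> distinguishes the two ends of the section, so no edge is a loop
  and counting ends of edges at a vertex amounts to counting edges. Since the closed edge adds only
  \<open>e 0\<close> and \<open>e 1\<close> to the open one, the ends of the section are these two
  points.\<close>

lemma edge_endpoints:
  assumes e: "e \<in> cells1 D"
  shows "e 0 \<noteq> e 1" "v \<in> {e 0, e 1} \<longleftrightarrow> v \<in> cells0 D \<and> \<theta> v \<in> closure (side_of e) \<and> edge_section e (\<theta> v) = v"
proof -
  obtain a b where ab: "a \<noteq> b" "closure (side_of e) = side_of e \<union> {a, b}" "a \<notin> side_of e" "b \<notin> side_of e"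
    using side_ends [OF side_of(1) [OF e]] by blast
  have "closed (e ` {0..1})"
    using edge_map(1) [OF e] by (intro compact_imp_closed compact_continuous_image) auto
  then have "closure (e ` {0<..<1}) \<subseteq> e ` {0..1}" by (intro closure_minimal image_mono) auto
  moreover have "e ` {0..1} = e ` {0<..<1} \<union> {e 0, e 1}"
  proof -
    have "{0..1} = {0<..<1} \<union> {0, 1 :: real}" by auto
    then show ?thesis by (metis image_Un image_insert image_empty)
  qed
  ultimately have sub: "edge_section e ` closure (side_of e) \<subseteq> e ` {0<..<1} \<union> {e 0, e 1}"
    using edge_section(3) [OF e] by simp
  have end_in: "edge_section e w \<in> {e 0, e 1}" if "w \<in> closure (side_of e)" "w \<notin> side_of e" for w
  proof -
    have "edge_section e w \<notin> e ` {0<..<1}"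
      using theta_edge [OF e, of "edge_section e w"] edge_section(5) [OF e that(1)] that(2) by auto
    then show ?thesis using sub that(1) by blast
  qed
  have in_ab: "edge_section e a \<in> {e 0, e 1}" "edge_section e b \<in> {e 0, e 1}"
    using end_in ab by auto
  have th: "\<theta> (edge_section e a) = a" "\<theta> (edge_section e b) = b" using edge_section(5) [OF e] ab by auto
  with ab(1) have ne: "edge_section e a \<noteq> edge_section e b" by metis
  with in_ab have eq: "{e 0, e 1} = {edge_section e a, edge_section e b}" by auto
  show "e 0 \<noteq> e 1" using ne in_ab by auto
  show "v \<in> {e 0, e 1} \<longleftrightarrow> v \<in> cells0 D \<and> \<theta> v \<in> closure (side_of e) \<and> edge_section e (\<theta> v) = v"
  proof
    assume v: "v \<in> {e 0, e 1}"
    then have "v = edge_section e a \<or> v = edge_section e b" unfolding eq by simp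
    then have "\<theta> v \<in> closure (side_of e) \<and> edge_section e (\<theta> v) = v"
      using th ab(2) by (elim disjE) simp_all
    moreover have "v \<in> cells0 D" using v edge_map(3,4) [OF e] by auto
    ultimately show "v \<in> cells0 D \<and> \<theta> v \<in> closure (side_of e) \<and> edge_section e (\<theta> v) = v" by blast
  next
    assume v: "v \<in> cells0 D \<and> \<theta> v \<in> closure (side_of e) \<and> edge_section e (\<theta> v) = v"
    then have "\<theta> v \<notin> side_of e" using vertex side [OF side_of(1) [OF e]] by blast
    then show "v \<in> {e 0, e 1}" using end_in [of "\<theta> v"] v by metis
  qed
qed

text \<open>Over \<open>A\<close> the section of a face runs through edges over \<open>A\<close>
  only. The sets on which it follows a given edge are closed, disjoint and finite in number, hence
  open as well, and \<open>A\<close> is connected.\<close>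

lemma face_side:
  assumes f: "f \<in> cells2 D" and A: "A \<in> HS \<union> NS"
  shows "\<exists>e\<in>cells1 D. side_of e = A \<and> (\<forall>q\<in>A. face_section f q = edge_section e q)"
proof -
  note A' = side [OF A]
  have cov: "\<exists>e\<in>cells1 D. side_of e = A \<and> face_section f q = edge_section e q" if q: "q \<in> A" for q
  proof -
    have qI: "q \<in> closure I" using q A' by blast
    let ?x = "face_section f q"
    have x: "?x \<in> T" "\<theta> ?x = q" using face_section(4,5) [OF f qI] by auto
    have "?x \<notin> cells0 D" using vertex [of ?x] x(2) q A' by auto
    moreover have "?x \<notin> f' ` ball 0 1" if "f' \<in> cells2 D" for f'
      using theta_face [OF that, of ?x] x(2) q A' by auto
    ultimately obtain e where e: "e \<in> cells1 D" "?x \<in> e ` {0<..<1}"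
      using cell_cases [OF x(1)] by blast
    then have "q \<in> side_of e" "?x = edge_section e q" using theta_edge [OF e] x(2) by simp_all
    moreover from this have "side_of e = A"
      using sides_disjoint [OF side_of(1) [OF e(1)] A] q by blast
    ultimately show ?thesis using e(1) by blast
  qed
  define K where "K e = {q \<in> A. face_section f q = edge_section e q}" for e
  have K_closed: "closedin (top_of_set A) (K e)" if "e \<in> cells1 D" "side_of e = A" for e
  proof -
    have "continuous_on A (face_section f)" "continuous_on A (edge_section e)"
      using continuous_on_subset [OF face_section(1) [OF f], of A] A'
        continuous_on_subset [OF edge_section(1) [OF that(1)], of A] that(2) closure_subset by auto
    then have "closedin (top_of_set A) (A \<inter> (\<lambda>q. face_section f q - edge_section e q) -` {0})"
      by (intro continuous_closedin_preimage continuous_on_diff) auto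
    moreover have "A \<inter> (\<lambda>q. face_section f q - edge_section e q) -` {0} = K e" by (auto simp: K_def)
    ultimately show ?thesis by simp
  qed
  obtain q0 where q0: "q0 \<in> A" using A' by blast
  then obtain e0 where e0: "e0 \<in> cells1 D" "side_of e0 = A" "face_section f q0 = edge_section e0 q0"
    using cov by blast
  define N where "N = {e \<in> cells1 D. side_of e = A \<and> e \<noteq> e0}"
  have "A - K e0 = (\<Union>e\<in>N. K e)"
  proof
    show "A - K e0 \<subseteq> (\<Union>e\<in>N. K e)"
    proof
      fix q assume q: "q \<in> A - K e0"
      then obtain e where "e \<in> cells1 D" "side_of e = A" "face_section f q = edge_section e q" using cov by blast
      with q show "q \<in> (\<Union>e\<in>N. K e)" by (auto simp: N_def K_def)
    qed
    have False if "e \<in> N" "q \<in> K e" "q \<in> K e0" for e q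
    proof -
      have e: "e \<in> cells1 D" "side_of e = A" "e \<noteq> e0" using that(1) by (auto simp: N_def)
      have "edge_section e q \<in> e ` {0<..<1}" "edge_section e0 q \<in> e0 ` {0<..<1}" "edge_section e q = edge_section e0 q"
      proof -
        have q: "q \<in> A" "edge_section e q = edge_section e0 q" using that(2,3) by (auto simp: K_def)
        show "edge_section e q = edge_section e0 q" by (rule q(2))
        show "edge_section e q \<in> e ` {0<..<1}" "edge_section e0 q \<in> e0 ` {0<..<1}"
          using edge_section(2) [OF e(1)] edge_section(2) [OF e0(1)] q(1) e(2) e0(2) by blast+
      qed
      then show False using edge_eq [OF e(1) e0(1)] e(3) by auto
    qed
    then have "K e \<subseteq> A - K e0" if "e \<in> N" for e using that unfolding K_def by blast
    then show "(\<Union>e\<in>N. K e) \<subseteq> A - K e0" by (rule UN_least)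
  qed
  moreover have "closedin (top_of_set A) (\<Union>e\<in>N. K e)"
  proof (rule closedin_Union)
    show "finite (K ` N)" using fin(2) by (simp add: N_def)
    fix S assume "S \<in> K ` N"
    then obtain e where "e \<in> N" "S = K e" by (rule imageE)
    then show "closedin (top_of_set A) S" using K_closed [of e] by (simp add: N_def)
  qed
  ultimately have "openin (top_of_set A) (K e0)"
    by (auto simp: openin_closedin_eq K_def)
  moreover have "connected A" using A' convex_connected by blast
  ultimately have "K e0 = A"
    using K_closed [OF e0(1,2)] q0 e0(3) connected_clopen [of A] by (auto simp: K_def)
  then show ?thesis using e0 by (intro bexI [of _ e0]) (auto simp: K_def)
qed

section \<open>Faces along an interior edge\<close>

definition faces_at :: "(real \<Rightarrow> complex) \<Rightarrow> (complex \<Rightarrow> complex) set" where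
  "faces_at e = {f \<in> cells2 D. \<forall>q\<in>side_of e. face_section f q = edge_section e q}"

text \<open>A face follows a single edge along the whole side; touching \<open>e\<close> in one
  point of the open edge identifies this edge as \<open>e\<close>.\<close>

lemma faces_at_if_closure:
  assumes e: "e \<in> cells1 D" and f: "f \<in> cells2 D" and x: "x \<in> e ` {0<..<1}" "x \<in> closure (f ` ball 0 1)"
  shows "f \<in> faces_at e"
proof -
  let ?A = "side_of e"
  note A = side_of(1) [OF e]
  have th: "\<theta> x \<in> ?A" "x = edge_section e (\<theta> x)" using theta_edge [OF e x(1)] by auto
  obtain q where q: "x = face_section f q" "q \<in> closure I"
    using x(2) unfolding face_section(3) [OF f, symmetric] by (rule imageE)
  then have qx: "q = \<theta> x" using face_section(5) [OF f] by simp
  obtain e' where e': "e' \<in> cells1 D" "side_of e' = ?A" "\<And>q. q \<in> ?A \<Longrightarrow> face_section f q = edge_section e' q"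
    using face_side [OF f A] by (elim bexE conjE) (metis (no_types))
  have "x = edge_section e' (\<theta> x)" using q(1) e'(3) [OF th(1)] unfolding qx by simp
  moreover have "edge_section e' (\<theta> x) \<in> edge_section e' ` side_of e'" using th(1) e'(2) by simp
  ultimately have "x \<in> e' ` {0<..<1}" unfolding edge_section(2) [OF e'(1)] by simp
  then have "e' ` {0<..<1} \<inter> e ` {0<..<1} \<noteq> {}" using x(1) by (metis IntI empty_iff)
  then have "e' = e" by (rule edge_eq [OF e'(1) e])
  then show ?thesis using e'(3) f by (simp add: faces_at_def)
qed

lemma faces_at_closure:
  assumes "e \<in> cells1 D" "f \<in> faces_at e" "x \<in> e ` {0<..<1}"
  shows "x \<in> closure (f ` ball 0 1)" "f \<in> cells2 D" "x = face_section f (\<theta> x)"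
proof -
  have th: "\<theta> x \<in> side_of e" "x = edge_section e (\<theta> x)" using theta_edge [OF assms(1,3)] by auto
  show f: "f \<in> cells2 D" using assms(2) by (simp add: faces_at_def)
  show eq: "x = face_section f (\<theta> x)" using th assms(2) by (simp add: faces_at_def)
  have "side_of e \<subseteq> closure I" using side [OF side_of(1) [OF assms(1)]] by simp
  then have "\<theta> x \<in> closure I" using th(1) by (rule subsetD)
  then have "face_section f (\<theta> x) \<in> face_section f ` closure I" by (rule imageI)
  then show "x \<in> closure (f ` ball 0 1)" unfolding face_section(3) [OF f] using eq by simp
qed

text \<open>The remaining closed cells and all vertices form a closed set \<open>Z\<close>, being
  finitely many, and \<open>x\<close> is not in it; what is left of the interior of \<open>T\<close>
  is the required neighbourhood.\<close>

lemma local_structure: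
  assumes e: "e \<in> cells1 D" and x: "x \<in> e ` {0<..<1}" "x \<in> interior T"
  obtains W where "open W" "x \<in> W" "W \<subseteq> e ` {0<..<1} \<union> (\<Union>f\<in>faces_at e. f ` ball 0 1)"
proof -
  define Z where "Z = cells0 D \<union> (\<Union>e'\<in>cells1 D - {e}. e' ` {0..1}) \<union> (\<Union>f\<in>cells2 D - faces_at e. closure (f ` ball 0 1))"
  have "closed Z"
    unfolding Z_def
  proof (rule closed_Un [OF closed_Un])
    show "closed (cells0 D)" using fin(1) by (rule finite_imp_closed)
    show "closed (\<Union>e'\<in>cells1 D - {e}. e' ` {0..1})"
      using fin(2) edge_map(1)
      by (intro closed_UN ballI compact_imp_closed compact_continuous_image finite_Diff compact_Icc) blast+
    show "closed (\<Union>f\<in>cells2 D - faces_at e. closure (f ` ball 0 1))"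
      using fin(3) by (intro closed_UN ballI finite_Diff closed_closure)
  qed
  moreover have "x \<notin> Z"
  proof
    assume "x \<in> Z"
    have nv: "x \<notin> cells0 D"
      using theta_edge [OF e x(1)] vertex [of x] side [OF side_of(1) [OF e]] by blast
    with \<open>x \<in> Z\<close> consider e' where "e' \<in> cells1 D" "e' \<noteq> e" "x \<in> e' ` {0..1}"
      | f where "f \<in> cells2 D" "f \<notin> faces_at e" "x \<in> closure (f ` ball 0 1)"
      unfolding Z_def by blast
    then show False
    proof cases
      case 1
      then obtain t where t: "t \<in> {0..1}" "x = e' t" by blast
      have "t \<noteq> 0" "t \<noteq> 1" using nv t(2) edge_map(3,4) [OF 1(1)] by auto
      then have "x \<in> e' ` {0<..<1}" using t by auto
      then show False using edge_eq [OF 1(1) e] 1(2) x(1) by blast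
    next
      case 2
      then show False using faces_at_if_closure [OF e _ x(1)] by blast
    qed
  qed
  moreover have "interior T - Z \<subseteq> e ` {0<..<1} \<union> (\<Union>f\<in>faces_at e. f ` ball 0 1)"
  proof
    fix y assume y: "y \<in> interior T - Z"
    then have "y \<in> T" using interior_subset by blast
    moreover have "y \<notin> cells0 D" using y by (simp add: Z_def)
    moreover have "y \<notin> e' ` {0<..<1}" if "e' \<in> cells1 D" "e' \<noteq> e" for e'
    proof -
      have "e' ` {0<..<1} \<subseteq> e' ` {0..1}" by (intro image_mono) auto
      then show ?thesis using y that unfolding Z_def by blast
    qed
    moreover have "y \<notin> f ` ball 0 1" if "f \<in> cells2 D" "f \<notin> faces_at e" for f
      using y that closure_subset [of "f ` ball 0 1"] unfolding Z_def by blast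
    ultimately show "y \<in> e ` {0<..<1} \<union> (\<Union>f\<in>faces_at e. f ` ball 0 1)"
      using cell_cases [of y] by blast
  qed
  ultimately show thesis
    using that [of "interior T - Z"] x(2) by (simp add: open_Diff)
qed

lemma edge_face_disjoint:
  assumes "e \<in> cells1 D" "f \<in> cells2 D"
  shows "e ` {0<..<1} \<inter> f ` ball 0 1 = {}"
proof -
  have "side_of e \<inter> I = {}" using side [OF side_of(1) [OF assms(1)]] by simp
  then have "x \<notin> f ` ball 0 1" if "x \<in> e ` {0<..<1}" for x
    using theta_edge [OF assms(1) that] theta_face [OF assms(2), of x] by (metis IntI empty_iff)
  then show ?thesis by (metis Int_emptyI)
qed

lemma inj_on_theta_face:
  assumes "f \<in> cells2 D"
  shows "inj_on \<theta> (closure (f ` ball 0 1))"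
proof (rule inj_onI)
  fix x y assume xy: "x \<in> closure (f ` ball 0 1)" "y \<in> closure (f ` ball 0 1)" "\<theta> x = \<theta> y"
  obtain p where p: "p \<in> closure I" "x = face_section f p"
    using xy(1) unfolding face_section(3) [OF assms, symmetric] by (rule imageE)
  obtain q where q: "q \<in> closure I" "y = face_section f q"
    using xy(2) unfolding face_section(3) [OF assms, symmetric] by (rule imageE)
  show "x = y" using xy(3) face_section(5) [OF assms p(1)] face_section(5) [OF assms q(1)] p(2) q(2) by simp
qed

text \<open>With at most one face along \<open>e\<close>, the map \<open>\<theta>\<close> would be
  injective near \<open>x\<close>. By invariance of domain \<open>\<theta> x\<close> would then be
  an interior point of the closed polygon, but it lies on a side.\<close>

lemma not_one_face:
  assumes e: "e \<in> cells1 D" and x: "x \<in> e ` {0<..<1}" "x \<in> interior T"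
  shows "\<not> faces_at e \<subseteq> {f}"
proof
  assume sub: "faces_at e \<subseteq> {f}"
  obtain W where W: "open W" "x \<in> W" "W \<subseteq> e ` {0<..<1} \<union> (\<Union>f\<in>faces_at e. f ` ball 0 1)"
    by (rule local_structure [OF e x])
  have inj: "inj_on \<theta> W"
  proof (cases "f \<in> faces_at e")
    case True
    have "W \<subseteq> closure (f ` ball 0 1)"
    proof (rule order_trans [OF W(3)], rule Un_least [OF subsetI UN_least])
      show "y \<in> closure (f ` ball 0 1)" if "y \<in> e ` {0<..<1}" for y
        using faces_at_closure(1) [OF e True that] .
      show "f' ` ball 0 1 \<subseteq> closure (f ` ball 0 1)" if "f' \<in> faces_at e" for f'
      proof -
        have "f' = f" using sub that by (metis singletonD subsetD)
        then show ?thesis using closure_subset by simp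
      qed
    qed
    moreover have "f \<in> cells2 D" using True by (simp add: faces_at_def)
    ultimately show ?thesis using inj_on_theta_face inj_on_subset by blast
  next
    case False
    then have "faces_at e = {}" using sub by (metis subset_singletonD singletonI)
    then have W': "W \<subseteq> e ` {0<..<1}" using W(3) by simp
    show ?thesis
    proof (rule inj_onI)
      fix x y assume "x \<in> W" "y \<in> W" "\<theta> x = \<theta> y"
      then show "x = y"
        using theta_edge [OF e subsetD [OF W', of x]] theta_edge [OF e subsetD [OF W', of y]] by simp
    qed
  qed
  have WT: "W \<subseteq> T"
  proof (rule order_trans [OF W(3)], rule Un_least [OF _ UN_least])
    show "e ` {0<..<1} \<subseteq> T" by (rule open_cell_subset [OF open_cells_in(2) [OF e]])
    show "f ` ball 0 1 \<subseteq> T" if "f \<in> faces_at e" for f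
      using that open_cell_subset [OF open_cells_in(3) [of f]] by (simp add: faces_at_def)
  qed
  have "open (\<theta> ` W)"
    by (rule invariance_of_domain_gen [OF W(1) continuous_on_subset [OF cont WT] inj]) simp
  moreover have "\<theta> ` W \<subseteq> closure I"
  proof
    fix q assume "q \<in> \<theta> ` W"
    then obtain y where y: "q = \<theta> y" "y \<in> W" by (rule imageE)
    from subsetD [OF W(3) y(2)] show "q \<in> closure I"
    proof (elim UnE UN_E)
      assume "y \<in> e ` {0<..<1}"
      from theta_edge [OF e this] have "q \<in> side_of e" using y(1) by simp
      then show ?thesis using side [OF side_of(1) [OF e]] by (metis subsetD)
    next
      fix f assume "f \<in> faces_at e" "y \<in> f ` ball 0 1"
      then have "\<theta> y \<in> I" using theta_face [of f y] by (simp add: faces_at_def)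
      then show ?thesis using closure_subset y(1) by (metis subsetD)
    qed
  qed
  ultimately have "\<theta> ` W \<subseteq> interior (closure I)" by (intro interior_maximal)
  then have "\<theta> x \<in> I" using W(2) I by (simp add: convex_interior_closure interior_open image_subset_iff)
  moreover have "\<theta> x \<in> side_of e" using theta_edge [OF e x(1)] by simp
  ultimately show False using side [OF side_of(1) [OF e]] by (metis IntI empty_iff)
qed

text \<open>Two faces, glued along \<open>e\<close> by means of the reflection, already fill a
  neighbourhood of a point of the edge by invariance of domain. A third face would accumulate at
  this point without entering the neighbourhood.\<close>

lemma not_three_faces:
  assumes e: "e \<in> cells1 D" and f: "f1 \<in> faces_at e" "f2 \<in> faces_at e" "f3 \<in> faces_at e"
    and ne: "f1 \<noteq> f2" "f1 \<noteq> f3" "f2 \<noteq> f3"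
  shows False
proof -
  let ?A = "side_of e"
  note A = side_of(1) [OF e]
  note A' = side [OF A]
  have c: "f1 \<in> cells2 D" "f2 \<in> cells2 D" "f3 \<in> cells2 D" using f by (auto simp: faces_at_def)
  obtain q where q: "q \<in> ?A" using A' by (metis ex_in_conv)
  obtain r where R: "continuous_on UNIV r \<and> inj r \<and> (\<forall>q\<in>?A. r q = q) \<and>
      (\<forall>q\<in>I. r q \<notin> closure I) \<and> (\<forall>q. q \<in> closure I \<longrightarrow> r q \<in> closure I \<longrightarrow> r q = q) \<and>
      (\<forall>y\<in>?A. \<exists>B. open B \<and> y \<in> B \<and> B \<subseteq> I \<union> ?A \<union> r -` I)"
    using reflection [OF A] by (rule exE)
  then have r: "continuous_on UNIV r" "inj r" "\<And>q. q \<in> ?A \<Longrightarrow> r q = q"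
    "\<And>q. q \<in> I \<Longrightarrow> r q \<notin> closure I" "\<And>q. q \<in> closure I \<Longrightarrow> r q \<in> closure I \<Longrightarrow> r q = q"
    and RB: "\<forall>y\<in>?A. \<exists>B. open B \<and> y \<in> B \<and> B \<subseteq> I \<union> ?A \<union> r -` I"
  proof -
    show "continuous_on UNIV r" using R by (rule conjunct1)
    show "inj r" using R by (elim conjE)
    show "r q = q" if "q \<in> ?A" for q using R that by (elim conjE) (rule bspec)
    show "r q \<notin> closure I" if "q \<in> I" for q
    proof -
      have "\<forall>q\<in>I. r q \<notin> closure I" using R by (elim conjE)
      then show ?thesis using that by (rule bspec)
    qed
    show "r q = q" if "q \<in> closure I" "r q \<in> closure I" for q
    proof -
      have "\<forall>q. q \<in> closure I \<longrightarrow> r q \<in> closure I \<longrightarrow> r q = q" using R by (elim conjE)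
      then have "q \<in> closure I \<longrightarrow> r q \<in> closure I \<longrightarrow> r q = q" by (rule spec)
      then show ?thesis using that by (rule mp [OF mp])
    qed
    show "\<forall>y\<in>?A. \<exists>B. open B \<and> y \<in> B \<and> B \<subseteq> I \<union> ?A \<union> r -` I" using R by (elim conjE)
  qed
  obtain B where B: "open B" "q \<in> B" "B \<subseteq> I \<union> ?A \<union> r -` I"
    using bspec [OF RB q] by (elim exE conjE)
  \<comment> \<open>\<open>f1\<close> on the polygon and \<open>f2\<close> on its mirror image; they
    match on the side, where both follow \<open>e\<close>.\<close>
  define \<tau> where "\<tau> y = (if y \<in> closure I then face_section f1 y else face_section f2 (r y))" for y
  have Isub: "I \<subseteq> closure I" by (rule closure_subset)
  have fixI: "y \<in> ?A" if "y \<in> B" "y \<in> closure I" "r y \<in> closure I" for y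
  proof -
    have ry: "r y = y" by (rule r(5) [OF that(2,3)])
    then have "y \<notin> I" using r(4) [of y] that(2) by metis
    moreover have "y \<in> I \<union> ?A \<union> r -` I" by (rule subsetD [OF B(3) that(1)])
    ultimately show ?thesis using ry by simp
  qed
  have agree: "face_section f1 y = edge_section e y" "face_section f2 y = edge_section e y" if "y \<in> ?A" for y
    using f that by (auto simp: faces_at_def)
  have "continuous_on ((B \<inter> closure I) \<union> (B \<inter> r -` closure I)) \<tau>"
    unfolding \<tau>_def
  proof (rule continuous_on_cases_local)
    have cl: "closedin (top_of_set (B \<inter> closure I \<union> B \<inter> r -` closure I)) (B \<inter> S)"
      if "closed S" "S = closure I \<or> S = r -` closure I" for S
    proof -
      have "B \<inter> S = (B \<inter> closure I \<union> B \<inter> r -` closure I) \<inter> S" using that(2) by blast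
      then show ?thesis using that(1) by (metis closedin_closed_Int)
    qed
    show "closedin (top_of_set (B \<inter> closure I \<union> B \<inter> r -` closure I)) (B \<inter> closure I)"
      by (rule cl) simp_all
    show "closedin (top_of_set (B \<inter> closure I \<union> B \<inter> r -` closure I)) (B \<inter> r -` closure I)"
      by (rule cl) (simp_all add: closed_vimage r(1))
    show "continuous_on (B \<inter> closure I) (face_section f1)"
      by (rule continuous_on_subset [OF face_section(1) [OF c(1)]]) simp
    show "continuous_on (B \<inter> r -` closure I) (\<lambda>y. face_section f2 (r y))"
      by (rule continuous_on_compose2 [OF face_section(1) [OF c(2)]])
        (auto intro: continuous_on_subset [OF r(1)])
    fix y assume "y \<in> B \<inter> closure I \<and> y \<notin> closure I \<or> y \<in> B \<inter> r -` closure I \<and> y \<in> closure I"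
    then have "y \<in> ?A" using fixI by blast
    then show "face_section f1 y = face_section f2 (r y)" using agree r(3) by simp
  qed
  moreover have "?A \<subseteq> closure I" using A' by simp
  then have "I \<union> ?A \<union> r -` I \<subseteq> closure I \<union> r -` closure I" using Isub by blast
  then have "B \<subseteq> closure I \<union> r -` closure I" using B(3) by (rule order_trans [rotated])
  then have Bsub: "B \<subseteq> (B \<inter> closure I) \<union> (B \<inter> r -` closure I)" by blast
  ultimately have cont: "continuous_on B \<tau>" by (rule continuous_on_subset)
  have cases: "(y \<in> I \<and> \<tau> y = face_section f1 y \<and> \<tau> y \<in> f1 ` ball 0 1) \<or>
      (y \<in> ?A \<and> \<tau> y = edge_section e y \<and> \<tau> y \<in> e ` {0<..<1}) \<or>
      (r y \<in> I \<and> \<tau> y = face_section f2 (r y) \<and> \<tau> y \<in> f2 ` ball 0 1)" if yB: "y \<in> B" for y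
  proof -
    have "y \<in> I \<or> y \<in> ?A \<or> r y \<in> I" using subsetD [OF B(3) yB] by simp
    then consider "y \<in> I" | "y \<in> ?A" | "r y \<in> I" by (elim disjE)
    then show ?thesis
    proof cases
      case 1
      then have "\<tau> y = face_section f1 y" using Isub by (auto simp: \<tau>_def)
      then show ?thesis using 1 face_section(2) [OF c(1)] by blast
    next
      case 2
      then have "\<tau> y = edge_section e y" using A' agree by (auto simp: \<tau>_def)
      then show ?thesis using 2 edge_section(2) [OF e] by blast
    next
      case 3
      have "y \<notin> closure I"
      proof
        assume y: "y \<in> closure I"
        have ry: "r y \<in> closure I" by (rule subsetD [OF Isub 3])
        then have "r y = y" by (rule r(5) [OF y])
        then have "y \<in> I" using 3 by simp
        then show False using r(4) ry by metis
      qed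
      then have "\<tau> y = face_section f2 (r y)" by (simp add: \<tau>_def)
      moreover have "face_section f2 (r y) \<in> f2 ` ball 0 1"
        unfolding face_section(2) [OF c(2), symmetric] using 3 by (rule imageI)
      ultimately show ?thesis using 3 by simp
    qed
  qed
  have dis: "f1 ` ball 0 1 \<inter> f2 ` ball 0 1 = {}" "f1 ` ball 0 1 \<inter> f3 ` ball 0 1 = {}"
    "f2 ` ball 0 1 \<inter> f3 ` ball 0 1 = {}"
    using face_eq [OF c(1,2)] face_eq [OF c(1,3)] face_eq [OF c(2,3)] ne by metis+
  note dise = edge_face_disjoint [OF e c(1)] edge_face_disjoint [OF e c(2)] edge_face_disjoint [OF e c(3)]
  have th1: "\<theta> (face_section f1 y) = y" "\<theta> (face_section f2 y) = y" if "y \<in> I" for y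
    using face_section(5) [OF c(1) subsetD [OF Isub that]] face_section(5) [OF c(2) subsetD [OF Isub that]] by simp_all
  have thA: "\<theta> (edge_section e y) = y" if "y \<in> ?A" for y
    by (rule edge_section(5) [OF e subsetD [OF closure_subset that]])
  \<comment> \<open>\<open>\<tau> y\<close> determines which of \<open>y\<close> and
    \<open>r y\<close> is equal to \<open>\<theta> (\<tau> y)\<close>, and \<open>r\<close> is
    injective; so \<open>\<tau>\<close> is injective.\<close>
  have key: "(\<tau> y \<in> f2 ` ball 0 1 \<and> \<theta> (\<tau> y) = r y) \<or> (\<tau> y \<notin> f2 ` ball 0 1 \<and> \<theta> (\<tau> y) = y)"
    if "y \<in> B" for y
    using cases [OF that]
  proof (elim disjE conjE)
    assume *: "y \<in> I" "\<tau> y = face_section f1 y" "\<tau> y \<in> f1 ` ball 0 1"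
    have "\<tau> y \<notin> f2 ` ball 0 1" using *(3) dis(1) by (metis IntI empty_iff)
    then show ?thesis using th1(1) [OF *(1)] *(2) by simp
  next
    assume *: "y \<in> ?A" "\<tau> y = edge_section e y" "\<tau> y \<in> e ` {0<..<1}"
    have "\<tau> y \<notin> f2 ` ball 0 1" using *(3) dise(2) by (metis IntI empty_iff)
    then show ?thesis using thA [OF *(1)] *(2) by simp
  next
    assume *: "r y \<in> I" "\<tau> y = face_section f2 (r y)" "\<tau> y \<in> f2 ` ball 0 1"
    then show ?thesis using th1(2) [OF *(1)] by simp
  qed
  have inj: "inj_on \<tau> B"
  proof (rule inj_onI)
    fix y z assume yz: "y \<in> B" "z \<in> B" "\<tau> y = \<tau> z"
    then have "r y = r z \<or> y = z" using key [OF yz(1)] key [OF yz(2)] by metis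
    then show "y = z" using injD [OF r(2)] by metis
  qed
  have "open (\<tau> ` B)"
    by (rule invariance_of_domain_gen [OF B(1) cont inj]) simp
  moreover have "q \<in> closure I" using A' q by (metis subsetD)
  then have "\<tau> q = edge_section e q" using agree(1) [OF q] by (simp add: \<tau>_def)
  moreover have "edge_section e q \<in> e ` {0<..<1}"
    unfolding edge_section(2) [OF e, symmetric] using q by (rule imageI)
  ultimately have "\<tau> q \<in> e ` {0<..<1}" by simp
  then have "\<tau> q \<in> closure (f3 ` ball 0 1)" by (rule faces_at_closure(1) [OF e f(3)])
  then have "\<tau> ` B \<inter> closure (f3 ` ball 0 1) \<noteq> {}" using B(2) by (metis IntI empty_iff imageI)
  then have "\<tau> ` B \<inter> f3 ` ball 0 1 \<noteq> {}"
    using open_Int_closure_eq_empty [OF \<open>open (\<tau> ` B)\<close>] by metis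
  then obtain x where x: "x \<in> \<tau> ` B" "x \<in> f3 ` ball 0 1" by (metis IntE ex_in_conv)
  obtain y where y: "x = \<tau> y" "y \<in> B" using x(1) by (rule imageE)
  have "x \<notin> f1 ` ball 0 1" "x \<notin> f2 ` ball 0 1" "x \<notin> e ` {0<..<1}"
    using x(2) dis(2,3) dise(3) by (metis IntI empty_iff)+
  then show False using cases [OF y(2)] y(1) by simp
qed

text \<open>The counts of faces apply at points of the open edge in the interior of
  \<open>T\<close>. Such points exist close to \<open>v\<close>, because the section of
  \<open>e\<close> is continuous up to its end over \<open>\<theta> v\<close>.\<close>

lemma card_faces_at:
  assumes e: "e \<in> cells1 D" and v: "v \<in> {e 0, e 1}" "v \<in> interior T"
  shows "card (faces_at e) = 2"
proof -
  let ?A = "side_of e"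
  have v': "\<theta> v \<in> closure ?A" "edge_section e (\<theta> v) = v" using edge_endpoints(2) [OF e, of v] v(1) by auto
  have "openin (top_of_set (closure ?A)) (closure ?A \<inter> edge_section e -` interior T)"
    by (rule continuous_openin_preimage_gen [OF edge_section(1) [OF e] open_interior])
  then obtain U where U: "open U" "closure ?A \<inter> edge_section e -` interior T = closure ?A \<inter> U"
    by (auto simp: openin_open)
  have "\<theta> v \<in> U" using U(2) v v' by auto
  then have "U \<inter> ?A \<noteq> {}" using v'(1) U(1) open_Int_closure_eq_empty by blast
  then obtain q where q: "q \<in> U" "q \<in> ?A" by blast
  let ?x = "edge_section e q"
  have x: "?x \<in> e ` {0<..<1}" "?x \<in> interior T"
    using q U(2) closure_subset [of ?A] edge_section(2) [OF e] by blast+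
  have fin': "finite (faces_at e)" using fin(3) by (simp add: faces_at_def)
  obtain f1 where f1: "f1 \<in> faces_at e" using not_one_face [OF e x] by blast
  obtain f2 where f2: "f2 \<in> faces_at e" "f2 \<noteq> f1" using not_one_face [OF e x, of f1] by blast
  have "faces_at e = {f1, f2}"
    using f1 f2 not_three_faces [OF e f1 f2(1)] by blast
  then show ?thesis using f2(2) by simp
qed

section \<open>Counting corners at an interior vertex\<close>

text \<open>Double counting: a face with a corner at \<open>v\<close> follows exactly one edge over
  \<open>A\<close>, and this edge ends at \<open>v\<close>; conversely each such edge lies on two
  faces.\<close>

lemma card_corners:
  assumes v: "v \<in> cells0 D" "v \<in> interior T" and A: "A \<in> HS \<union> NS" "\<theta> v \<in> closure A"
  shows "card {f \<in> cells2 D. face_section f (\<theta> v) = v} = 2 * card {e \<in> cells1 D. v \<in> {e 0, e 1} \<and> side_of e = A}"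
proof -
  define N where "N = {e \<in> cells1 D. v \<in> {e 0, e 1} \<and> side_of e = A}"
  have "{f \<in> cells2 D. face_section f (\<theta> v) = v} = (\<Union>e\<in>N. faces_at e)"
  proof -
    \<comment> \<open>Agreement of the two sections along the open side passes to its end by
      continuity.\<close>
    have eqw: "face_section f (\<theta> v) = edge_section e (\<theta> v)"
      if "f \<in> cells2 D" "e \<in> cells1 D" "side_of e = A" "\<And>q. q \<in> A \<Longrightarrow> face_section f q = edge_section e q" for e f
    proof -
      have "closure A \<subseteq> closure I" using side [OF A(1)] closure_minimal by blast
      then have c: "continuous_on (closure A) (\<lambda>q. face_section f q - edge_section e q)"
        using continuous_on_subset [OF face_section(1) [OF that(1)]] edge_section(1) [OF that(2)] that(3)
        by (intro continuous_on_diff) simp_all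
      have "face_section f (\<theta> v) - edge_section e (\<theta> v) = 0"
        by (rule continuous_constant_on_closure [OF c _ A(2)]) (simp add: that(4))
      then show ?thesis by simp
    qed
    show ?thesis
    proof (intro equalityI subsetI)
      fix f assume "f \<in> {f \<in> cells2 D. face_section f (\<theta> v) = v}"
      then have f: "f \<in> cells2 D" "face_section f (\<theta> v) = v" by auto
      obtain e where e: "e \<in> cells1 D" "side_of e = A" "\<And>q. q \<in> A \<Longrightarrow> face_section f q = edge_section e q"
        using face_side [OF f(1) A(1)] by blast
      then have "edge_section e (\<theta> v) = v" using eqw [OF f(1)] f(2) by simp
      then have "v \<in> {e 0, e 1}" using edge_endpoints(2) [OF e(1)] v(1) A(2) e(2) by blast
      then have "e \<in> N" using e by (simp add: N_def)
      moreover have "f \<in> faces_at e" using e f by (simp add: faces_at_def)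
      ultimately show "f \<in> (\<Union>e\<in>N. faces_at e)" by blast
    next
      fix f assume "f \<in> (\<Union>e\<in>N. faces_at e)"
      then obtain e where "e \<in> N" and f: "f \<in> faces_at e" by blast
      then have e: "e \<in> cells1 D" "v \<in> {e 0, e 1}" "side_of e = A" by (simp_all add: N_def)
      have f': "f \<in> cells2 D" "\<And>q. q \<in> A \<Longrightarrow> face_section f q = edge_section e q"
        using f e(3) by (simp_all add: faces_at_def)
      have "edge_section e (\<theta> v) = v" using edge_endpoints(2) [OF e(1)] e(2) by blast
      then show "f \<in> {f \<in> cells2 D. face_section f (\<theta> v) = v}"
        using eqw [OF f'(1) e(1,3) f'(2)] f'(1) by simp
    qed
  qed
  moreover have "card (\<Union>e\<in>N. faces_at e) = (\<Sum>e\<in>N. card (faces_at e))"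
  proof (rule card_UN_disjoint)
    show "finite N" using fin(2) by (simp add: N_def)
    show "\<forall>e\<in>N. finite (faces_at e)" using fin(3) by (simp add: faces_at_def)
    \<comment> \<open>A face follows only one edge over \<open>A\<close>, so no corner is counted
      twice.\<close>
    show "\<forall>e\<in>N. \<forall>e'\<in>N. e \<noteq> e' \<longrightarrow> faces_at e \<inter> faces_at e' = {}"
    proof (intro ballI impI, rule ccontr)
      fix e e' assume N: "e \<in> N" "e' \<in> N" and ne: "e \<noteq> e'" and "faces_at e \<inter> faces_at e' \<noteq> {}"
      then obtain f where f: "f \<in> faces_at e" "f \<in> faces_at e'" by blast
      have e: "e \<in> cells1 D" "e' \<in> cells1 D" "side_of e = A" "side_of e' = A" using N by (auto simp: N_def)
      obtain q where q: "q \<in> A" using side [OF A(1)] by blast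
      then have "edge_section e q = edge_section e' q" using f e(3,4) by (simp add: faces_at_def)
      moreover have "edge_section e q \<in> e ` {0<..<1}" "edge_section e' q \<in> e' ` {0<..<1}"
        using edge_section(2) [OF e(1)] edge_section(2) [OF e(2)] e(3,4) q by blast+
      ultimately show False using edge_eq [OF e(1,2)] ne by auto
    qed
  qed
  moreover have "(\<Sum>e\<in>N. card (faces_at e)) = (\<Sum>e\<in>N. 2)"
    using card_faces_at v(2) by (intro sum.cong) (auto simp: N_def)
  ultimately show ?thesis by (simp add: N_def)
qed

text \<open>Each corner of a face at \<open>v\<close> lies between an edge over \<open>HS\<close> and an edge over \<open>NS\<close>, while each edge
  at \<open>v\<close> lies in exactly two corners.\<close>

lemma even_valence:
  assumes v: "v \<in> cells0 D" "v \<in> interior T"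
  shows "\<exists>n. valence D v = enat (2 * n)"
proof -
  define E where "E = {(e, t). e \<in> cells1 D \<and> t \<in> {0, 1} \<and> e t = v}"
  define N where "N = {e \<in> cells1 D. v \<in> {e 0, e 1}}"
  have "finite (cells1 D \<times> {0, 1 :: real})" using fin(2) by simp
  then have finE: "finite E" by (rule rev_finite_subset) (auto simp: E_def)
  have "inj_on fst E"
  proof (rule inj_onI)
    fix a b assume ab: "a \<in> E" "b \<in> E" "fst a = fst b"
    obtain e t where a: "a = (e, t)" "e \<in> cells1 D" "t = 0 \<or> t = 1" "e t = v" using ab(1) by (auto simp: E_def)
    obtain u where b: "b = (e, u)" "u = 0 \<or> u = 1" "e u = v" using ab(2,3) a(1) by (cases b) (auto simp: E_def)
    have "t = u" using a(3,4) b(2,3) edge_endpoints(1) [OF a(2)] by (elim disjE) simp_all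
    then show "a = b" using a(1) b(1) by simp
  qed
  moreover have "fst ` E = N"
  proof
    show "fst ` E \<subseteq> N"
    proof (rule image_subsetI)
      fix a assume "a \<in> E"
      then obtain e t where "a = (e, t)" "e \<in> cells1 D" "t = 0 \<or> t = 1" "e t = v" by (auto simp: E_def)
      then show "fst a \<in> N" by (elim disjE) (simp_all add: N_def)
    qed
    show "N \<subseteq> fst ` E"
    proof
      fix e assume "e \<in> N"
      then have e: "e \<in> cells1 D" "v = e 0 \<or> v = e 1" by (simp_all add: N_def)
      then have "(e, 0) \<in> E \<or> (e, 1) \<in> E" unfolding E_def by (elim disjE) simp_all
      then show "e \<in> fst ` E" by (metis fst_conv imageI)
    qed
  qed
  ultimately have card_E: "card E = card N" by (metis card_image)
  obtain A where A0: "A \<in> HS \<and> \<theta> v \<in> closure A" and A1: "\<forall>A'. A' \<in> HS \<and> \<theta> v \<in> closure A' \<longrightarrow> A' = A"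
    using corner(1) [OF vertex [OF v(1)]] by (rule ex1E)
  have A: "A \<in> HS" "\<theta> v \<in> closure A" "A' \<in> HS \<Longrightarrow> \<theta> v \<in> closure A' \<Longrightarrow> A' = A" for A'
    by (rule conjunct1 [OF A0], rule conjunct2 [OF A0], rule mp [OF spec [OF A1]], rule conjI)
  obtain B where B0: "B \<in> NS \<and> \<theta> v \<in> closure B" and B1: "\<forall>A'. A' \<in> NS \<and> \<theta> v \<in> closure A' \<longrightarrow> A' = B"
    using corner(2) [OF vertex [OF v(1)]] by (rule ex1E)
  have B: "B \<in> NS" "\<theta> v \<in> closure B" "A' \<in> NS \<Longrightarrow> \<theta> v \<in> closure A' \<Longrightarrow> A' = B" for A'
    by (rule conjunct1 [OF B0], rule conjunct2 [OF B0], rule mp [OF spec [OF B1]], rule conjI)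
  define NA where "NA C = {e \<in> cells1 D. v \<in> {e 0, e 1} \<and> side_of e = C}" for C
  \<comment> \<open>Both numbers count the corners at \<open>v\<close>, once through sides in
    \<open>HS\<close> and once through sides in \<open>NS\<close>.\<close>
  have "2 * card (NA A) = 2 * card (NA B)"
    unfolding NA_def
    by (rule trans [OF card_corners [OF v UnI1 [OF A(1)] A(2), symmetric] card_corners [OF v UnI2 [OF B(1)] B(2)]])
  moreover have "N = NA A \<union> NA B"
  proof
    show "N \<subseteq> NA A \<union> NA B"
    proof
      fix e assume "e \<in> N"
      then have e: "e \<in> cells1 D" "v \<in> {e 0, e 1}" by (simp_all add: N_def)
      then have "\<theta> v \<in> closure (side_of e)" using edge_endpoints(2) [OF e(1)] by simp
      then have "side_of e = A \<or> side_of e = B" using side_of(1) [OF e(1)] A(3) B(3) by (metis UnE)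
      then show "e \<in> NA A \<union> NA B" using e by (simp add: NA_def)
    qed
    show "NA A \<union> NA B \<subseteq> N" unfolding N_def NA_def by blast
  qed
  moreover have "A \<noteq> B" using A(1) B(1) HS_NS by (metis IntI empty_iff)
  then have "NA A \<inter> NA B = {}" unfolding NA_def by blast
  moreover have "finite (NA C)" for C using fin(2) by (simp add: NA_def)
  ultimately have "card N = 2 * card (NA A)" by (simp add: card_Un_disjoint)
  then show ?thesis
    unfolding valence_def Let_def E_def [symmetric] using finE card_E by (intro exI [of _ "card (NA A)"]) simp
qed

end

section \<open>Folding onto an octagon and the condition T(4)\<close>

text \<open>The quotient map of the plane by the group generated by the reflections in the sides of
  a tile: \<open>arccos (cos (pi * t)) / pi\<close> is the zigzag of period 2 that equals
  \<open>t\<close> on [0, 1]. The inverse branches on the single tiles are the maps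
  \<open>unfold_plane i j\<close>, which reverse a coordinate when its index is odd.\<close>

definition fold_plane :: "real \<times> real \<Rightarrow> real \<times> real" where
  "fold_plane = (\<lambda>(x, y). (4 / pi * arccos (cos (pi * (x / 4))), 1 / pi * arccos (cos (pi * y))))"

definition unfold_plane :: "int \<Rightarrow> int \<Rightarrow> real \<times> real \<Rightarrow> real \<times> real" where
  "unfold_plane i j = (\<lambda>(s, t). (4 * of_int i + (if even i then s else 4 - s),
     of_int j + (if even j then t else 1 - t)))"

lemma arccos_cos_pi_int:
  assumes "0 \<le> w" "w \<le> 1"
  shows "arccos (cos (pi * (of_int i + w))) = pi * (if even i then w else 1 - w)"
proof (cases "even i")
  case True
  then obtain k where "i = 2 * k" by (elim evenE)
  then have "pi * (of_int i + w) = pi * w + of_int k * (2 * pi)" by (simp add: algebra_simps)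
  then have "cos (pi * (of_int i + w)) = cos (pi * w)" using cos.plus_of_int [of "pi * w" k] by simp
  moreover have "arccos (cos (pi * w)) = pi * w"
    using assms by (intro arccos_cos) (simp_all add: mult_le_cancel_left1)
  ultimately show ?thesis using True by simp
next
  case False
  then obtain k where "i = 2 * k + 1" by (elim oddE)
  then have "pi * (of_int i + w) = (pi * w + pi) + of_int k * (2 * pi)" by (simp add: algebra_simps)
  then have "cos (pi * (of_int i + w)) = cos (pi * w + pi)"
    using cos.plus_of_int [of "pi * w + pi" k] by simp
  also have "\<dots> = cos (pi - pi * w)" by simp
  also have "\<dots> = cos (pi * (1 - w))" by (simp add: right_diff_distrib)
  finally have "cos (pi * (of_int i + w)) = cos (pi * (1 - w))" .
  moreover have "arccos (cos (pi * (1 - w))) = pi * (1 - w)"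
    using assms by (intro arccos_cos) (simp_all add: mult_le_cancel_left1)
  ultimately show ?thesis using False by simp
qed

lemma fold_plane_eq:
  assumes "0 \<le> u" "u \<le> 4" "0 \<le> v" "v \<le> 1"
  shows "fold_plane (4 * of_int i + u, of_int j + v) =
    (if even i then u else 4 - u, if even j then v else 1 - v)"
proof -
  have "pi * ((4 * of_int i + u) / 4) = pi * (of_int i + u / 4)" by simp
  then have "arccos (cos (pi * ((4 * of_int i + u) / 4))) = pi * (if even i then u / 4 else 1 - u / 4)"
    using arccos_cos_pi_int [of "u / 4" i] assms by (simp only:)
  then show ?thesis
    using arccos_cos_pi_int [of v j] assms by (simp add: fold_plane_def field_simps)
qed

abbreviation octagon :: "(real \<times> real) set" where
  "octagon \<equiv> {0..4} \<times> {0..1}"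

lemma fold_unfold: "q \<in> octagon \<Longrightarrow> fold_plane (unfold_plane i j q) = q"
  by (cases q) (simp add: unfold_plane_def fold_plane_eq)

lemma unfold_fold:
  assumes "p \<in> rect i j"
  shows "unfold_plane i j (fold_plane p) = p" "fold_plane p \<in> octagon"
proof -
  obtain u v where p: "p = (4 * of_int i + u, of_int j + v)" and uv: "0 \<le> u" "u \<le> 4" "0 \<le> v" "v \<le> 1"
    using assms that [of "fst p - 4 * of_int i" "snd p - of_int j"]
    by (cases p) (simp add: rect_def)
  show "unfold_plane i j (fold_plane p) = p" "fold_plane p \<in> octagon"
    using uv unfolding p fold_plane_eq [OF uv] by (simp_all add: unfold_plane_def)
qed

lemma fold_plane_image:
  assumes "B \<subseteq> rect i j"
  shows "fold_plane ` B = {q \<in> octagon. unfold_plane i j q \<in> B}"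
proof (intro equalityI subsetI)
  fix q assume "q \<in> fold_plane ` B"
  then obtain p where p: "p \<in> B" "q = fold_plane p" by (rule imageE)
  then have "p \<in> rect i j" using assms by (rule_tac subsetD)
  then show "q \<in> {q \<in> octagon. unfold_plane i j q \<in> B}" using p unfold_fold [of p i j] by simp
next
  fix q assume "q \<in> {q \<in> octagon. unfold_plane i j q \<in> B}"
  then have "q \<in> octagon" "unfold_plane i j q \<in> B" by simp_all
  then show "q \<in> fold_plane ` B" using fold_unfold [of q i j] by (metis imageI)
qed

lemma continuous_on_unfold: "continuous_on A (unfold_plane i j)"
  unfolding unfold_plane_def case_prod_unfold by (cases "even i"; cases "even j") (simp_all, (intro continuous_intros)+)

lemma continuous_on_fold_plane: "continuous_on A fold_plane"
  unfolding fold_plane_def case_prod_unfold by (intro continuous_intros) simp_all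

text \<open>\<open>pinch\<close> identifies only mirror images about abscissae
  \<open>4 * of_int i\<close>, and the fold is even about each of them. Hence it descends to the
  complex.\<close>

lemma fold_plane_cong:
  assumes "pinch p = pinch q"
  shows "fold_plane p = fold_plane q"
proof -
  have "cos (pi * ((4 * of_int i + u) / 4)) = cos (pi * ((4 * of_int i - u) / 4))" for i u
  proof -
    have "pi * ((4 * of_int i + u) / 4) = pi * of_int i + pi * (u / 4)"
      "pi * ((4 * of_int i - u) / 4) = pi * of_int i - pi * (u / 4)"
      by (simp_all add: field_simps)
    then show ?thesis by (simp only: cos_add cos_diff sin_pi_int)
  qed
  then have "fold_plane (4 * of_int i + u, of_int j) = fold_plane (4 * of_int i - u, of_int j)" for i j u
    by (simp add: fold_plane_def)
  then show ?thesis using pinch_eq_imp [OF assms] by metis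
qed

definition octagon_fold :: "real \<times> real \<times> real \<Rightarrow> real \<times> real" where
  "octagon_fold x = fold_plane (SOME p. pinch p = x)"

lemma fold_pinch: "octagon_fold (pinch p) = fold_plane p"
  unfolding octagon_fold_def by (rule fold_plane_cong) (rule someI [of "\<lambda>q. pinch q = pinch p" p], rule refl)

lemma continuous_on_fold: "continuous_on (range pinch) octagon_fold"
proof -
  have "octagon_fold \<circ> pinch = fold_plane" by (simp add: fun_eq_iff fold_pinch)
  then have "continuous_map euclidean euclidean (octagon_fold \<circ> pinch)"
    using continuous_on_fold_plane [of UNIV] by simp
  then have "continuous_map (top_of_set (range pinch)) euclidean octagon_fold"
    by (simp only: continuous_compose_quotient_map_eq [OF quotient_map_pinch])
  then show ?thesis by simp
qed

section \<open>Sides of the octagon and images of cells\<close>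

definition hair_sides :: "(real \<times> real) set set" where
  "hair_sides = {{0<..<1} \<times> {0}, {0<..<1} \<times> {1}, {3<..<4} \<times> {0}, {3<..<4} \<times> {1}}"

definition long_sides :: "(real \<times> real) set set" where
  "long_sides = {{1<..<3} \<times> {0}, {1<..<3} \<times> {1}, {0} \<times> {0<..<1}, {4} \<times> {0<..<1}}"

definition octagon_vertices :: "(real \<times> real) set" where
  "octagon_vertices = {0, 1, 3, 4} \<times> {0, 1}"

abbreviation open_octagon :: "(real \<times> real) set" where
  "open_octagon \<equiv> {0<..<4} \<times> {0<..<1}"

lemma fold_region_cases:
  "fold_plane ` region k = open_octagon \<or> fold_plane ` region k \<in> hair_sides \<union> long_sides \<or>
   (\<exists>w\<in>octagon_vertices. fold_plane ` region k = {w})"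
proof (cases k)
  case (Tip i j)
  have "fold_plane (4 * of_int i + 0, of_int j + 0) \<in> octagon_vertices"
    unfolding fold_plane_eq [OF order_refl zero_le_numeral order_refl zero_le_one] by (simp add: octagon_vertices_def)
  then show ?thesis using Tip by simp
next
  case (Root i j)
  have "fold_plane (4 * of_int i + 1, of_int j + 0) \<in> octagon_vertices"
    by (subst fold_plane_eq) (simp_all add: octagon_vertices_def)
  then show ?thesis using Root by simp
next
  case (Hair i j)
  have "fold_plane ` region k = (if even i then {0<..<1} else {3<..<4}) \<times> (if even j then {0} else {1})"
    unfolding Hair fold_plane_image [OF region_subset_rect(3)]
    by (cases "even i"; cases "even j") (auto simp: unfold_plane_def)
  then show ?thesis by (cases "even i"; cases "even j") (simp_all add: hair_sides_def)
next
  case (Mid i j)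
  have "fold_plane ` region k = {1<..<3} \<times> (if even j then {0} else {1})"
    unfolding Mid fold_plane_image [OF region_subset_rect(4)]
    by (cases "even i"; cases "even j") (auto simp: unfold_plane_def)
  then show ?thesis by (cases "even j") (simp_all add: long_sides_def)
next
  case (Vert i j)
  have "fold_plane ` region k = (if even i then {0} else {4}) \<times> {0<..<1}"
    unfolding Vert fold_plane_image [OF region_subset_rect(5)]
    by (cases "even i"; cases "even j") (auto simp: unfold_plane_def)
  then show ?thesis by (cases "even i") (simp_all add: long_sides_def)
next
  case (Face i j)
  have "fold_plane ` region k = open_octagon"
    unfolding Face fold_plane_image [OF region_subset_rect(6)]
    by (cases "even i"; cases "even j") (auto simp: unfold_plane_def)
  then show ?thesis by simp
qed

lemma region_in_rect: "\<exists>i j. region k \<subseteq> rect i j"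
  by (cases k) (metis region_subset_rect)+

text \<open>Together with \<open>sides_not_open\<close> this helps to recover the dimension of a
  cell from its image in the octagon.\<close>

lemma sides_not_singleton:
  assumes "J = open_octagon \<or> J \<in> hair_sides \<union> long_sides"
  shows "J \<noteq> {w}"
proof -
  have "\<exists>a b. a \<in> J \<and> b \<in> J \<and> a \<noteq> b"
  proof -
    have *: "\<exists>a b. a \<in> {x<..<x'} \<times> C \<and> b \<in> {x<..<x'} \<times> C \<and> a \<noteq> b" if "x < x'" "c \<in> C"
      for x x' c :: real and C
      using that by (intro exI [of _ "((x + x') / 2, c)"] exI [of _ "((3 * x + x') / 4, c)"]) simp
    have **: "\<exists>a b. a \<in> {c} \<times> {x<..<x'} \<and> b \<in> {c} \<times> {x<..<x'} \<and> a \<noteq> b" if "x < x'"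
      for x x' c :: real
      using that by (intro exI [of _ "(c, (x + x') / 2)"] exI [of _ "(c, (3 * x + x') / 4)"]) simp
    show ?thesis
      using assms unfolding hair_sides_def long_sides_def Un_iff insert_iff empty_iff
      by (elim disjE FalseE) (hypsubst, (rule * [where c = "1 / 2"] * [where c = 0] * [where c = 1] **; simp))+
  qed
  then show ?thesis by (metis singletonD)
qed

lemma octagon_closure: "closure open_octagon = octagon" "interior octagon = open_octagon"
  by (simp_all add: closure_Times interior_Times)

lemma sides_not_open:
  assumes "J \<in> hair_sides \<union> long_sides"
  shows "\<not> open J"
proof
  assume "open J"
  have "J \<subseteq> octagon \<and> J \<inter> open_octagon = {}"
    using assms unfolding hair_sides_def long_sides_def Un_iff insert_iff empty_iff
    by (elim disjE FalseE) (hypsubst, auto)+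
  moreover from this \<open>open J\<close> have "J \<subseteq> open_octagon" using interior_maximal [of J octagon] unfolding octagon_closure by simp
  ultimately have "J = {}" by blast
  moreover have "J \<noteq> {}"
    using assms unfolding hair_sides_def long_sides_def Un_iff insert_iff empty_iff
    by (elim disjE FalseE) simp_all
  ultimately show False by simp
qed

text \<open>The inverse branch goes from the octagon to a tile by \<open>unfold_plane\<close>, into
  the complex by \<open>pinch\<close> and back into the cell by the inverse of \<open>h\<close>. The
  dimension of \<open>J\<close> is not yet compared with that of the cell.\<close>

lemma section_of_cell:
  fixes D :: "complex cell_complex"
  assumes h: "combinatorial_map D pinched_plane h" and top: "cw_space D = top_of_set T"
    and c: "c \<in> open_cells D" "c \<subseteq> T"
  shows "\<exists>J \<sigma>. (J = open_octagon \<or> J \<in> hair_sides \<union> long_sides \<or> (\<exists>w\<in>octagon_vertices. J = {w})) \<and>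
    continuous_on J \<sigma> \<and> \<sigma> ` J = c \<and> (\<forall>q\<in>J. octagon_fold (h (\<sigma> q)) = q)"
proof -
  have "\<exists>d\<in>open_cells pinched_plane. homeomorphic_map (subtopology (cw_space D) c) (subtopology (cw_space pinched_plane) d) h"
    using h c(1) unfolding combinatorial_map_def by simp
  then obtain k where k: "homeomorphic_map (subtopology (cw_space D) c)
      (subtopology (cw_space pinched_plane) (pinch ` region k)) h"
    unfolding open_cells_pinched_plane by blast
  let ?d = "pinch ` region k"
  have tops: "subtopology (cw_space D) c = top_of_set c" "subtopology (cw_space pinched_plane) ?d = top_of_set ?d"
    using c(2) subtopology_pinched_plane [of ?d] by (simp_all add: top subtopology_subtopology Int_absorb1 image_mono)
  obtain g where "homeomorphic_maps (top_of_set c) (top_of_set ?d) h g"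
    using k unfolding tops homeomorphic_map_maps by blast
  then have g: "continuous_on ?d g" "g ` ?d \<subseteq> c" "\<And>x. x \<in> c \<Longrightarrow> g (h x) = x" "\<And>y. y \<in> ?d \<Longrightarrow> h (g y) = y"
    and hc: "h ` c \<subseteq> ?d"
    unfolding homeomorphic_maps_def by (auto simp: image_subset_iff_funcset)
  have gd: "g ` ?d = c"
  proof
    show "c \<subseteq> g ` ?d"
    proof
      fix x assume x: "x \<in> c"
      then have "h x \<in> ?d" using hc by (rule_tac subsetD [OF hc imageI])
      then have "g (h x) \<in> g ` ?d" by (rule imageI)
      then show "x \<in> g ` ?d" by (simp only: g(3) [OF x])
    qed
  qed (rule g(2))
  obtain i j where ij: "region k \<subseteq> rect i j" using region_in_rect by blast
  define J where "J = fold_plane ` region k"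
  define \<sigma> where "\<sigma> = (\<lambda>q. g (pinch (unfold_plane i j q)))"
  have un: "unfold_plane i j ` J = region k"
  proof -
    have "unfold_plane i j ` J = (\<lambda>p. p) ` region k"
      unfolding J_def image_image by (rule image_cong [OF refl]) (use ij unfold_fold(1) in blast)
    then show ?thesis by simp
  qed
  have pu: "(\<lambda>q. pinch (unfold_plane i j q)) ` J = ?d"
    using un by (simp only: image_image [symmetric])
  have "continuous_on J (\<lambda>q. pinch (unfold_plane i j q))"
    by (intro continuous_intros continuous_on_unfold)
  then have "continuous_on J \<sigma>"
    unfolding \<sigma>_def by (rule continuous_on_compose2 [OF g(1)]) (simp only: pu order_refl)
  moreover have "\<sigma> ` J = c"
    using gd unfolding \<sigma>_def pu [symmetric] image_image .
  moreover have "octagon_fold (h (\<sigma> q)) = q" if q: "q \<in> J" for q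
  proof -
    obtain p where p: "p \<in> region k" "q = fold_plane p" using q unfolding J_def by (rule imageE)
    then have "unfold_plane i j q = p" using unfold_fold(1) [of p i j] ij by (metis subsetD)
    then have "h (\<sigma> q) = pinch p" using g(4) [of "pinch p"] p(1) by (simp add: \<sigma>_def)
    then show ?thesis using p(2) by (simp add: fold_pinch)
  qed
  ultimately show ?thesis using fold_region_cases [of k] unfolding J_def [symmetric] by metis
qed

lemma open_subset_Reals_empty:
  fixes U :: "complex set"
  assumes "open U" "U \<subseteq> \<real>"
  shows "U = {}"
proof (rule ccontr)
  assume "U \<noteq> {}"
  then obtain x where x: "x \<in> U" by blast
  then obtain e where e: "0 < e" "ball x e \<subseteq> U" using assms(1) open_contains_ball by metis
  define y where "y = x + of_real (e / 2) * \<i>"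
  have "dist x y = e / 2" using e(1) by (simp add: y_def dist_norm norm_mult)
  then have "y \<in> U" using e by (metis half_gt_zero_iff less_add_same_cancel1 mem_ball field_sum_of_halves subsetD)
  then have "Im y = 0" "Im x = 0" using assms(2) x complex_is_Real_iff by blast+
  then show False using e(1) by (simp add: y_def)
qed

text \<open>Horizontal sides are described uniformly by their end abscissae, so that later arguments
  distinguish two cases instead of eight.\<close>

lemma sides_cases:
  assumes "A \<in> hair_sides \<union> long_sides"
  obtains a b t where "A = {a<..<b} \<times> {t}" "0 \<le> a" "a < b" "b \<le> 4" "t \<in> {0, 1 :: real}" "{a, b} \<subseteq> {0, 1, 3, 4 :: real}"
      "A \<in> hair_sides \<longleftrightarrow> (a, b) \<in> {(0, 1), (3, 4)}" "(a, b) \<in> {(0, 1), (1, 3), (3, 4)}"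
    | s where "A = {s} \<times> {0<..<1}" "s \<in> {0, 4 :: real}"
proof -
  have ne: "{a<..<b} \<times> {t} \<noteq> {s} \<times> {0<..<1 :: real}" if "a < b" for a b s t :: real
  proof
    assume "{a<..<b} \<times> {t} = {s} \<times> {0<..<1 :: real}"
    then have "(s, 1 / 3) \<in> {a<..<b} \<times> {t}" "(s, 1 / 2) \<in> {a<..<b} \<times> {t}" by simp_all
    then show False by simp
  qed
  have inj: "{a<..<b} \<times> {t} = {a'<..<b'} \<times> {t'} \<longleftrightarrow> a = a' \<and> b = b' \<and> t = t'"
    if "a < b" "a' < b'" for a b a' b' t t' :: real
    using that by (auto simp: times_eq_iff greaterThanLessThan_eq_iff)
  show thesis
    using assms unfolding Un_iff
  proof
    assume "A \<in> hair_sides"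
    then have "\<exists>a b t. A = {a<..<b} \<times> {t} \<and> (a, b) \<in> {(0, 1), (3, 4)} \<and> t \<in> {0, 1 :: real}"
      unfolding hair_sides_def by blast
    then obtain a b t where A: "A = {a<..<b} \<times> {t}" "(a, b) \<in> {(0, 1), (3, 4)}" "t \<in> {0, 1 :: real}" by blast
    show thesis
      by (rule that(1) [OF A(1)]) (use A \<open>A \<in> hair_sides\<close> in auto)
  next
    assume l: "A \<in> long_sides"
    then have "(\<exists>t. A = {1<..<3} \<times> {t} \<and> t \<in> {0, 1 :: real}) \<or> (\<exists>s. A = {s} \<times> {0<..<1} \<and> s \<in> {0, 4})"
      unfolding long_sides_def by blast
    then show thesis
    proof (elim disjE exE conjE)
      fix t assume A: "A = {1<..<3} \<times> {t}" "t \<in> {0, 1 :: real}"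
      have "A \<notin> hair_sides" unfolding A hair_sides_def by (simp add: inj)
      then show thesis by (intro that(1) [OF A(1)]) (use A(2) in auto)
    next
      fix s assume "A = {s} \<times> {0<..<1}" "s \<in> {0, 4 :: real}"
      then show thesis by (rule that(2))
    qed
  qed
qed

text \<open>\<open>r\<close> is the Euclidean reflection in the line of the side. \<open>B\<close>
  extends from the side in both directions by the height 1 or the width 4 of the octagon, and is
  covered by the octagon, its mirror image and the side between them.\<close>

lemma side_reflection:
  assumes "A \<in> hair_sides \<union> long_sides"
  shows "\<exists>r. continuous_on UNIV r \<and> inj r \<and> (\<forall>q\<in>A. r q = q) \<and>
      (\<forall>q\<in>open_octagon. r q \<notin> closure open_octagon) \<and> (\<forall>q. q \<in> closure open_octagon \<longrightarrow> r q \<in> closure open_octagon \<longrightarrow> r q = q) \<and>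
      (\<forall>y\<in>A. \<exists>B. open B \<and> y \<in> B \<and> B \<subseteq> open_octagon \<union> A \<union> r -` open_octagon)"
  using assms
proof (cases rule: sides_cases)
  case (1 a b t)
  define r where "r = (\<lambda>(x :: real, y). (x, 2 * t - y))"
  define B where "B = {a<..<b} \<times> {t - 1<..<t + 1}"
  have "continuous_on UNIV r"
    unfolding r_def case_prod_unfold by (intro continuous_intros)
  moreover have "inj r" by (auto simp: inj_def r_def)
  moreover have "\<forall>q\<in>A. r q = q" by (auto simp: r_def 1(1))
  moreover have "\<forall>q\<in>open_octagon. r q \<notin> closure open_octagon"
    using 1(5) unfolding octagon_closure by (auto simp: r_def)
  moreover have "\<forall>q. q \<in> closure open_octagon \<longrightarrow> r q \<in> closure open_octagon \<longrightarrow> r q = q"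
    using 1(5) unfolding octagon_closure by (auto simp: r_def)
  moreover have "open B" unfolding B_def by (intro open_Times open_greaterThanLessThan)
  moreover have "A \<subseteq> B" unfolding B_def 1(1) by auto
  moreover have "B \<subseteq> open_octagon \<union> A \<union> r -` open_octagon"
  proof
    fix p assume "p \<in> B"
    then obtain x y where p: "p = (x, y)" "a < x" "x < b" "t - 1 < y" "y < t + 1" unfolding B_def by auto
    then have x: "0 < x" "x < 4" using 1 by auto
    consider "0 < y" "y < 1" | "y = t" | "0 < 2 * t - y" "2 * t - y < 1" using p(4,5) 1(5) by fastforce
    then show "p \<in> open_octagon \<union> A \<union> r -` open_octagon"
      using p x 1(1) by cases (simp_all add: r_def)
  qed
  ultimately show ?thesis by (intro exI [of _ r]) blast
next
  case (2 s)
  define r where "r = (\<lambda>(x, y :: real). (2 * s - x, y))"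
  define B where "B = {s - 4<..<s + 4} \<times> {0<..<1 :: real}"
  have "continuous_on UNIV r"
    unfolding r_def case_prod_unfold by (intro continuous_intros)
  moreover have "inj r" by (auto simp: inj_def r_def)
  moreover have "\<forall>q\<in>A. r q = q" by (auto simp: r_def 2(1))
  moreover have "\<forall>q\<in>open_octagon. r q \<notin> closure open_octagon"
    using 2(2) unfolding octagon_closure by (auto simp: r_def)
  moreover have "\<forall>q. q \<in> closure open_octagon \<longrightarrow> r q \<in> closure open_octagon \<longrightarrow> r q = q"
    using 2(2) unfolding octagon_closure by (auto simp: r_def)
  moreover have "open B" unfolding B_def by (intro open_Times open_greaterThanLessThan)
  moreover have "A \<subseteq> B" unfolding B_def 2(1) by auto
  moreover have "B \<subseteq> open_octagon \<union> A \<union> r -` open_octagon"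
  proof
    fix p assume "p \<in> B"
    then obtain x y where p: "p = (x, y)" "s - 4 < x" "x < s + 4" "0 < y" "y < 1" unfolding B_def by auto
    consider "0 < x" "x < 4" | "x = s" | "0 < 2 * s - x" "2 * s - x < 4" using p(2,3) 2(2) by fastforce
    then show "p \<in> open_octagon \<union> A \<union> r -` open_octagon"
      using p 2(1) by cases (simp_all add: r_def)
  qed
  ultimately show ?thesis by (intro exI [of _ r]) blast
qed

lemma closure_side:
  "a < b \<Longrightarrow> closure ({a<..<b} \<times> {t :: real}) = {a..b :: real} \<times> {t}"
  "closure ({s :: real} \<times> {0<..<1 :: real}) = {s} \<times> {0..1}"
  by (simp_all add: closure_Times)

lemma side_closure_ends:
  assumes "A \<in> hair_sides \<union> long_sides"
  shows "\<exists>a b. a \<noteq> b \<and> closure A = A \<union> {a, b} \<and> a \<notin> A \<and> b \<notin> A"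
  using assms
proof (cases rule: sides_cases)
  case (1 a b t)
  have "closure A = A \<union> {(a, t), (b, t)}" unfolding 1(1) closure_side(1) [OF 1(3)] using 1(3) by auto
  then show ?thesis using 1(1,3) by (intro exI [of _ "(a, t)"] exI [of _ "(b, t)"]) simp
next
  case (2 s)
  have "closure A = A \<union> {(s, 0), (s, 1)}" unfolding 2(1) closure_side by auto
  then show ?thesis using 2(1) by (intro exI [of _ "(s, 0)"] exI [of _ "(s, 1)"]) simp
qed

text \<open>The alternation of hairs and long sides around the octagon, on which the evenness of
  valences rests.\<close>

lemma octagon_corner:
  assumes "w \<in> octagon_vertices"
  shows "\<exists>!A. A \<in> hair_sides \<and> w \<in> closure A" "\<exists>!A. A \<in> long_sides \<and> w \<in> closure A"
proof -
  obtain x t where w: "w = (x, t)" "x \<in> {0, 1, 3, 4}" "t \<in> {0, 1}"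
    using assms unfolding octagon_vertices_def by blast
  have cl: "closure ({0<..<1} \<times> {u}) = {0..1 :: real} \<times> {u :: real}" "closure ({1<..<3} \<times> {u}) = {1..3 :: real} \<times> {u}"
    "closure ({3<..<4} \<times> {u}) = {3..4 :: real} \<times> {u}" for u
    by (simp_all add: closure_Times)
  have H: "A \<in> hair_sides \<and> w \<in> closure A \<longleftrightarrow> A = (if x \<le> 1 then {0<..<1} else {3<..<4}) \<times> {t}" for A
  proof
    assume "A \<in> hair_sides \<and> w \<in> closure A"
    then show "A = (if x \<le> 1 then {0<..<1} else {3<..<4}) \<times> {t}"
      unfolding hair_sides_def insert_iff empty_iff w(1)
      by (elim conjE disjE FalseE) (hypsubst_thin, simp add: cl)+
  next
    assume "A = (if x \<le> 1 then {0<..<1} else {3<..<4}) \<times> {t}"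
    then show "A \<in> hair_sides \<and> w \<in> closure A"
      using w by (cases "x \<le> 1") (auto simp: cl hair_sides_def)
  qed
  show "\<exists>!A. A \<in> hair_sides \<and> w \<in> closure A" unfolding H by simp
  have N: "A \<in> long_sides \<and> w \<in> closure A \<longleftrightarrow>
      A = (if x = 1 \<or> x = 3 then {1<..<3} \<times> {t} else {x} \<times> {0<..<1})" for A
  proof
    assume "A \<in> long_sides \<and> w \<in> closure A"
    then show "A = (if x = 1 \<or> x = 3 then {1<..<3} \<times> {t} else {x} \<times> {0<..<1})"
      using w(2) unfolding long_sides_def insert_iff empty_iff w(1)
      by (elim conjE disjE FalseE) (simp_all add: cl closure_side)
  next
    assume "A = (if x = 1 \<or> x = 3 then {1<..<3} \<times> {t} else {x} \<times> {0<..<1})"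
    then show "A \<in> long_sides \<and> w \<in> closure A"
      using w by (auto simp: cl closure_side long_sides_def)
  qed
  show "\<exists>!A. A \<in> long_sides \<and> w \<in> closure A" unfolding N by simp
qed

lemma bounded_Ioo: "bounded {a<..<b :: real}"
  by (rule bounded_subset [OF compact_imp_bounded [OF compact_Icc [of a b]]]) auto

section \<open>Diagrams over the complex and the condition T(4)\<close>

text \<open>The main point is that a combinatorial map preserves dimension, since its definition
  speaks only of homeomorphisms between open cells. A 0-cell has a one-point image; the image of a
  2-cell in the octagon is open by invariance of domain, so it is neither a side nor a point; the
  image of a 1-cell is not a point by injectivity and not the open octagon by the argument
  below.\<close>

lemma folded_diagram_pinched_plane:
  fixes D :: "complex cell_complex"
  assumes D: "cw_complex D" "cw_space D = top_of_set T" "finite (cells0 D)" "finite (cells1 D)" "finite (cells2 D)"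
    and h: "combinatorial_map D pinched_plane h"
  shows "folded_diagram D T (octagon_fold \<circ> h) open_octagon hair_sides long_sides octagon_vertices"
proof
  have cover: "\<Union> (open_cells D) = T"
    using D(1) unfolding cw_complex_def D(2) by simp
  have sub: "c \<subseteq> T" if "c \<in> open_cells D" for c using that cover by blast
  note sec = section_of_cell [OF h D(2) _ sub]
  have inO: "v \<in> cells0 D \<Longrightarrow> {v} \<in> open_cells D" "e \<in> cells1 D \<Longrightarrow> e ` {0<..<1} \<in> open_cells D"
    "f \<in> cells2 D \<Longrightarrow> f ` ball 0 1 \<in> open_cells D" for v e f
    unfolding open_cells_def by (simp_all add: image_iff) blast+
  have hT: "continuous_on T h" "h ` T \<subseteq> range pinch"
    using h unfolding combinatorial_map_def D(2) pinched_plane_simps(1)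
    by (simp_all add: image_subset_iff_funcset)
  show cont: "continuous_on T (octagon_fold \<circ> h)"
    using hT(1) continuous_on_subset [OF continuous_on_fold hT(2)] by (rule continuous_on_compose)
  show "(octagon_fold \<circ> h) v \<in> octagon_vertices" if v: "v \<in> cells0 D" for v
  proof -
    obtain J \<sigma> where Js: "(J = open_octagon \<or> J \<in> hair_sides \<union> long_sides \<or> (\<exists>w\<in>octagon_vertices. J = {w})) \<and>
        continuous_on J \<sigma> \<and> \<sigma> ` J = {v} \<and> (\<forall>q\<in>J. octagon_fold (h (\<sigma> q)) = q)"
      using sec [OF inO(1) [OF v] inO(1) [OF v]] by (elim exE)
    have J: "J = open_octagon \<or> J \<in> hair_sides \<union> long_sides \<or> (\<exists>w\<in>octagon_vertices. J = {w})" using Js by (rule conjunct1)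
    have s: "\<sigma> ` J = {v}" "q \<in> J \<Longrightarrow> octagon_fold (h (\<sigma> q)) = q" for q
      using Js by simp_all
    have "J = (\<lambda>q. octagon_fold (h (\<sigma> q))) ` J" using s(2) by simp
    also have "\<dots> = (\<lambda>x. octagon_fold (h x)) ` (\<sigma> ` J)" by (simp only: image_image)
    finally have "J = {octagon_fold (h v)}" unfolding s(1) by simp
    then show ?thesis using J sides_not_singleton [of J "octagon_fold (h v)"] by auto
  qed
  show "\<exists>\<sigma>. continuous_on open_octagon \<sigma> \<and> \<sigma> ` open_octagon = f ` ball 0 1 \<and> (\<forall>q\<in>open_octagon. (octagon_fold \<circ> h) (\<sigma> q) = q)"
    if f: "f \<in> cells2 D" for f
  proof -
    obtain J \<sigma> where Js: "(J = open_octagon \<or> J \<in> hair_sides \<union> long_sides \<or> (\<exists>w\<in>octagon_vertices. J = {w})) \<and>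
        continuous_on J \<sigma> \<and> \<sigma> ` J = f ` ball 0 1 \<and> (\<forall>q\<in>J. octagon_fold (h (\<sigma> q)) = q)"
      using sec [OF inO(3) [OF f] inO(3) [OF f]] by (elim exE)
    have J: "J = open_octagon \<or> J \<in> hair_sides \<union> long_sides \<or> (\<exists>w\<in>octagon_vertices. J = {w})" using Js by (rule conjunct1)
    have s: "continuous_on J \<sigma>" "\<sigma> ` J = f ` ball 0 1" "q \<in> J \<Longrightarrow> octagon_fold (h (\<sigma> q)) = q" for q
      using Js by simp_all
    have hom: "homeomorphic_map (top_of_set (ball 0 1)) (subtopology (cw_space D) (f ` ball 0 1)) f"
      using D(1) f unfolding cw_complex_def by blast
    then have inj: "inj_on f (ball 0 1)" unfolding homeomorphic_eq_everything_map by simp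
    have cf: "continuous_on (ball 0 1) f"
      using homeomorphic_imp_continuous_map [OF hom] unfolding D(2) by (simp add: continuous_map_in_subtopology)
    have "f ` ball 0 1 \<subseteq> T" using sub inO(3) [OF f] by blast
    have "continuous_on (ball 0 1) (\<lambda>z. (octagon_fold \<circ> h) (f z))"
      by (rule continuous_on_compose2 [OF cont cf \<open>f ` ball 0 1 \<subseteq> T\<close>])
    moreover have "inj_on (\<lambda>z. (octagon_fold \<circ> h) (f z)) (ball 0 1)"
    proof (rule inj_onI)
      fix y z assume yz: "y \<in> ball 0 1" "z \<in> ball 0 1" "(octagon_fold \<circ> h) (f y) = (octagon_fold \<circ> h) (f z)"
      have "f y \<in> \<sigma> ` J" "f z \<in> \<sigma> ` J" unfolding s(2) by (rule imageI [OF yz(1)], rule imageI [OF yz(2)])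
      moreover obtain p where "f y = \<sigma> p" "p \<in> J" using \<open>f y \<in> \<sigma> ` J\<close> by (rule imageE)
      moreover obtain q where "f z = \<sigma> q" "q \<in> J" using \<open>f z \<in> \<sigma> ` J\<close> by (rule imageE)
      ultimately have "f y = f z" using yz(3) s(3) [of p] s(3) [of q] by simp
      then show "y = z" using inj_onD [OF inj _ yz(1,2)] by simp
    qed
    ultimately have "open ((\<lambda>z. (octagon_fold \<circ> h) (f z)) ` ball 0 1)"
      by (rule invariance_of_domain_gen [OF open_ball]) simp
    moreover have "(\<lambda>z. (octagon_fold \<circ> h) (f z)) ` ball 0 1 = J"
    proof -
      have "(\<lambda>z. (octagon_fold \<circ> h) (f z)) ` ball 0 1 = (\<lambda>x. octagon_fold (h x)) ` (\<sigma> ` J)" unfolding s(2) by (simp add: image_image)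
      also have "\<dots> = J" unfolding image_image using s(3) by simp
      finally show ?thesis .
    qed
    ultimately have "open J" by simp
    have "J = open_octagon"
    proof (rule ccontr)
      assume "J \<noteq> open_octagon"
      then obtain w where "J = {w}" using J sides_not_open \<open>open J\<close> by blast
      then show False using \<open>open J\<close> not_open_singleton by blast
    qed
    then show ?thesis using s by (intro exI [of _ \<sigma>]) simp
  qed
  show "\<exists>A\<in>hair_sides \<union> long_sides. \<exists>\<sigma>. continuous_on A \<sigma> \<and> \<sigma> ` A = e ` {0<..<1} \<and> (\<forall>q\<in>A. (octagon_fold \<circ> h) (\<sigma> q) = q)"
    if e: "e \<in> cells1 D" for e
  proof -
    obtain J \<sigma> where Js: "(J = open_octagon \<or> J \<in> hair_sides \<union> long_sides \<or> (\<exists>w\<in>octagon_vertices. J = {w})) \<and>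
        continuous_on J \<sigma> \<and> \<sigma> ` J = e ` {0<..<1} \<and> (\<forall>q\<in>J. octagon_fold (h (\<sigma> q)) = q)"
      using sec [OF inO(2) [OF e] inO(2) [OF e]] by (elim exE)
    have J: "J = open_octagon \<or> J \<in> hair_sides \<union> long_sides \<or> (\<exists>w\<in>octagon_vertices. J = {w})" using Js by (rule conjunct1)
    have s: "continuous_on J \<sigma>" "\<sigma> ` J = e ` {0<..<1}" "q \<in> J \<Longrightarrow> octagon_fold (h (\<sigma> q)) = q" for q
      using Js by simp_all
    have hom: "homeomorphic_map (top_of_set {0<..<1}) (subtopology (cw_space D) (e ` {0<..<1})) e"
      using D(1) e unfolding cw_complex_def by blast
    then have inj: "inj_on e {0<..<1}" unfolding homeomorphic_eq_everything_map by simp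
    have "e ` {0<..<1} \<subseteq> T" using sub inO(2) [OF e] by blast
    then have "subtopology (cw_space D) (e ` {0<..<1}) = top_of_set (e ` {0<..<1})"
      by (simp add: D(2) subtopology_subtopology Int_absorb1)
    then obtain g where "homeomorphic_maps (top_of_set {0<..<1}) (top_of_set (e ` {0<..<1})) e g"
      using hom unfolding homeomorphic_map_maps by metis
    then have g: "continuous_on (e ` {0<..<1}) g" "\<And>t. t \<in> {0<..<1} \<Longrightarrow> g (e t) = t"
      unfolding homeomorphic_maps_def by simp_all
    \<comment> \<open>Otherwise the open edge, parametrised by the open octagon, would be open in
      the plane. Embedded into the real axis by \<open>g\<close>, it would yield a non-empty open
      subset of the plane inside that axis.\<close>
    have "J \<noteq> open_octagon"
    proof
      assume JI: "J = open_octagon"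
      have "inj_on \<sigma> open_octagon" using s(3) unfolding JI by (intro inj_on_inverseI [of _ "\<lambda>x. octagon_fold (h x)"])
      moreover have "continuous_on open_octagon \<sigma>" using s(1) unfolding JI .
      moreover have "open open_octagon" by (intro open_Times open_greaterThanLessThan)
      ultimately have "open (\<sigma> ` open_octagon)"
        by (intro invariance_of_domain_gen [where S = open_octagon and f = \<sigma>]) simp_all
      then have op: "open (e ` {0<..<1})" using s(2) unfolding JI by simp
      have "continuous_on (e ` {0<..<1}) (\<lambda>x. complex_of_real (g x))"
        using g(1) by (rule continuous_on_of_real)
      moreover have "inj_on (\<lambda>x. complex_of_real (g x)) (e ` {0<..<1})"
      proof (rule inj_onI)
        fix x y assume xy: "x \<in> e ` {0<..<1}" "y \<in> e ` {0<..<1}" "complex_of_real (g x) = complex_of_real (g y)"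
        obtain t where t: "x = e t" "t \<in> {0<..<1}" using xy(1) by (rule imageE)
        obtain u where u: "y = e u" "u \<in> {0<..<1}" using xy(2) by (rule imageE)
        show "x = y" using xy(3) g(2) [OF t(2)] g(2) [OF u(2)] unfolding t(1) u(1) by simp
      qed
      ultimately have "open ((\<lambda>x. complex_of_real (g x)) ` (e ` {0<..<1}))"
        using op invariance_of_domain [of "e ` {0<..<1}" "\<lambda>x. complex_of_real (g x)"] by simp
      moreover have "(\<lambda>x. complex_of_real (g x)) ` (e ` {0<..<1}) \<subseteq> \<real>" by (rule image_subsetI) simp
      ultimately have "(\<lambda>x. complex_of_real (g x)) ` (e ` {0<..<1}) = {}" by (rule open_subset_Reals_empty)
      then show False by simp
    qed
    moreover have "J \<noteq> {w}" for w
    proof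
      assume "J = {w}"
      then have "e ` {0<..<1} = {\<sigma> w}" using s(2) by simp
      moreover have "(1 / 2 :: real) \<in> {0<..<1}" "(1 / 3 :: real) \<in> {0<..<1}" by simp_all
      ultimately have "e (1 / 2) = e (1 / 3)" by (metis imageI singletonD)
      then show False using inj_onD [OF inj, of "1 / 2" "1 / 3"] by simp
    qed
    ultimately have "J \<in> hair_sides \<union> long_sides" using J by blast
    then show ?thesis using s by (intro bexI [of _ J] exI [of _ \<sigma>]) simp_all
  qed
  show "open open_octagon" by (intro open_Times open_greaterThanLessThan)
  show "convex open_octagon" by (intro convex_Times convex_real_interval)
  show "bounded open_octagon" by (intro bounded_Times bounded_Ioo)
  show "hair_sides \<inter> long_sides = {}"
  proof -
    have False if "A \<in> hair_sides" "A \<in> long_sides" for A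
    proof -
      have "A \<in> hair_sides \<union> long_sides" using that(1) by simp
      then show False
      proof (cases rule: sides_cases)
        case (1 a b t)
        then have ab: "(a, b) \<in> {(0, 1), (3, 4)}" using that(1) by simp
        have "((a + b) / 2, t) \<in> A" using 1(1,3) by simp
        then have "((a + b) / 2, t) \<in> {1<..<3} \<times> {0} \<or> ((a + b) / 2, t) \<in> {1<..<3} \<times> {1} \<or>
          ((a + b) / 2, t) \<in> {0} \<times> {0<..<1} \<or> ((a + b) / 2, t) \<in> {4} \<times> {0<..<1}"
          using that(2) unfolding long_sides_def by blast
        then show False using ab by auto
      next
        case (2 s)
        have "(s, 1 / 2) \<in> A" using 2(1) by simp
        then show False using that(1) unfolding hair_sides_def by auto
      qed
    qed
    then show ?thesis by blast
  qed
  show "convex A \<and> A \<noteq> {} \<and> bounded A \<and> A \<subseteq> closure open_octagon \<and> A \<inter> open_octagon = {} \<and> A \<inter> octagon_vertices = {}"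
    if "A \<in> hair_sides \<union> long_sides" for A
    using that
  proof (cases rule: sides_cases)
    case (1 a b t)
    have "convex A" unfolding 1(1) by (intro convex_Times convex_real_interval convex_singleton)
    moreover have "bounded A" unfolding 1(1) by (intro bounded_Times bounded_Ioo bounded_insert [THEN iffD2] bounded_empty)
    moreover have "A \<noteq> {}" using 1(1,3) by simp
    moreover have "A \<subseteq> octagon" unfolding 1(1) using 1(2,4,5) by auto
    then have "A \<subseteq> closure open_octagon" by (simp only: octagon_closure(1))
    moreover have "A \<inter> open_octagon = {}" unfolding 1(1) using 1(5) by auto
    moreover have "A \<inter> octagon_vertices = {}" unfolding 1(1) octagon_vertices_def using 1(8) by auto
    ultimately show ?thesis by blast
  next
    case (2 s)
    have "convex A" unfolding 2(1) by (intro convex_Times convex_real_interval convex_singleton)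
    moreover have "bounded A" unfolding 2(1) by (intro bounded_Times bounded_Ioo bounded_insert [THEN iffD2] bounded_empty)
    moreover have "A \<noteq> {}" using 2(1) by simp
    moreover have "A \<subseteq> octagon" unfolding 2(1) using 2(2) by auto
    then have "A \<subseteq> closure open_octagon" by (simp only: octagon_closure(1))
    moreover have "A \<inter> open_octagon = {}" unfolding 2(1) using 2(2) by auto
    moreover have "A \<inter> octagon_vertices = {}" unfolding 2(1) octagon_vertices_def by auto
    ultimately show ?thesis by blast
  qed
  show "A = B" if AB: "A \<in> hair_sides \<union> long_sides" "B \<in> hair_sides \<union> long_sides" "A \<inter> B \<noteq> {}" for A B
    using AB(1)
  proof (cases rule: sides_cases)
    case (1 a b t)
    note A = 1
    show ?thesis using AB(2)
    proof (cases rule: sides_cases)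
      case (1 a' b' t')
      obtain x where "a < x" "x < b" "a' < x" "x < b'" "t = t'" using AB(3) A(1) 1(1) by auto
      then have "a = a'" "b = b'" using A(8) 1(8) by auto
      then show ?thesis using A(1) 1(1) \<open>t = t'\<close> by simp
    next
      case (2 s)
      show ?thesis using AB(3) A(1,5) 2(1) by auto
    qed
  next
    case (2 s)
    note A = 2
    show ?thesis using AB(2)
    proof (cases rule: sides_cases)
      case (1 a' b' t')
      show ?thesis using AB(3) 1(1,5) A(1) by auto
    next
      case (2 s')
      show ?thesis using AB(3) 2(1) A(1) by auto
    qed
  qed
  show "open_octagon \<inter> octagon_vertices = {}" by (auto simp: octagon_vertices_def)
qed (rule D | erule side_closure_ends | erule side_reflection | erule octagon_corner)+

lemma T_condition_pinched_plane: "T_condition 4 pinched_plane"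
  unfolding T_condition_def
proof (rule notI, elim exE conjE bexE)
  fix D :: "complex cell_complex" and h v
  assume D: "disc_diagram D" and h: "reduced_map D pinched_plane h"
    and v: "v \<in> cells0 D" "v \<in> interior (topspace (cw_space D))" "2 < valence D v" "valence D v < enat 4"
  interpret folded_diagram D "topspace (cw_space D)" "octagon_fold \<circ> h" open_octagon hair_sides long_sides octagon_vertices
  proof (rule folded_diagram_pinched_plane)
    show "cw_complex D" "cw_space D = top_of_set (topspace (cw_space D))"
      "finite (cells0 D)" "finite (cells1 D)" "finite (cells2 D)"
      using D unfolding disc_diagram_def two_complex_def by blast+
    show "combinatorial_map D pinched_plane h" using h unfolding reduced_map_def by blast
  qed
  obtain n where n: "valence D v = enat (2 * n)" using even_valence [OF v(1,2)] by blast
  have "2 * n < 4" "2 < 2 * n" using v(3,4) unfolding n by (simp_all add: numeral_eq_enat)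
  then show False by simp
qed

section \<open>Contractibility, the action, and the absence of flat planes\<close>

text \<open>The homotopy slides \<open>x\<close> to \<open>x - tri_wave x\<close>, shrinking every
  folded interval to its centre. Its final map factors through the plane by way of \<open>b\<close>,
  and the plane is contractible.\<close>

lemma contractible_space_pinched_plane: "contractible_space (cw_space pinched_plane)"
proof -
  define F :: "real \<times> real \<times> real \<Rightarrow> real \<times> real \<times> real \<times> real" where "F = (\<lambda>(t, p). (t, pinch p))"
  define K where "K = (\<lambda>(t, p :: real \<times> real). pinch (fst p - t * tri_wave (fst p), snd p))"
  define inv_pinch where "inv_pinch x = (SOME p. pinch p = x)" for x
  define H where "H = (\<lambda>(t, x). K (t, inv_pinch x))"
  define a where "a = (\<lambda>p. (fst p - tri_wave (fst p), snd p :: real))"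
  have inv: "pinch (inv_pinch (pinch p)) = pinch p" for p
    unfolding inv_pinch_def by (rule someI) (rule refl)
  have wave: "tri_wave (4 * of_int i - u) = - u" "tri_wave (4 * of_int i + u) = u" if "\<bar>u\<bar> \<le> 1" for i u
    using tri_wave_hair [of "- u" i] tri_wave_hair [of u i] that by simp_all
  have K_cong: "K (t, p) = K (t, q)" if pq: "pinch p = pinch q" and t: "t \<in> {0..1}" for t p q
    using pinch_eq_imp [OF pq]
  proof (elim disjE exE conjE)
    fix i j u assume u: "0 < \<bar>u\<bar>" "\<bar>u\<bar> \<le> 1" "p = (4 * of_int i + u, of_int j)" "q = (4 * of_int i - u, of_int j)"
    \<comment> \<open>Sliding moves the mirror images \<open>4 * of_int i + u\<close> and
      \<open>4 * of_int i - u\<close> to those with \<open>(1 - t) * u\<close> in place of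
      \<open>u\<close>; they remain within reach of the fold and so stay identified.\<close>
    have "\<bar>(1 - t) * u\<bar> \<le> 1 * 1"
      unfolding abs_mult using t u(2) by (intro mult_mono) simp_all
    then have "\<bar>(1 - t) * u\<bar> \<le> 1" by simp
    from pinch_fold [OF this, of i j] show ?thesis
      using wave [OF u(2)] unfolding K_def u(3,4) by (simp add: algebra_simps)
  qed simp
  have HF: "H (F (t, p)) = K (t, p)" if "t \<in> {0..1}" for t p
    using K_cong [OF inv that] by (simp add: H_def F_def)
  have FU: "F ` ({0..1} \<times> UNIV) = {0..1} \<times> range pinch"
  proof (intro equalityI subsetI)
    fix y :: "real \<times> real \<times> real \<times> real" assume "y \<in> F ` ({0..1} \<times> UNIV)"
    then obtain x where "y = F x" "x \<in> {0..1} \<times> UNIV" by (rule imageE)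
    then show "y \<in> {0..1} \<times> range pinch" by (cases x) (simp add: F_def)
  next
    fix y :: "real \<times> real \<times> real \<times> real" assume "y \<in> {0..1} \<times> range pinch"
    then obtain t x where y: "y = (t, x)" "t \<in> {0..1}" "x \<in> range pinch" by (rule SigmaE)
    obtain p where "x = pinch p" using y(3) by (rule imageE)
    then have "y = F (t, p)" using y(1) by (simp add: F_def)
    then show "y \<in> F ` ({0..1} \<times> UNIV)" using y(2) by (intro image_eqI [where x = "(t, p)"]) simp_all
  qed
  have cF: "continuous_on ({0..1} \<times> UNIV) F"
    unfolding F_def case_prod_unfold by (intro continuous_intros)
  \<comment> \<open>Reduces continuity of \<open>H\<close> to that of \<open>K\<close>. The bound 2
    consists of 1 for the parameter and 1 from \<open>norm_diff_pinch\<close>.\<close>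
  have "quotient_map (top_of_set ({0..1} \<times> UNIV)) (top_of_set (F ` ({0..1} \<times> UNIV))) F"
  proof (rule quotient_map_if_norm_le [OF cF, of 2])
    fix x :: "real \<times> real \<times> real" assume "x \<in> {0..1} \<times> UNIV"
    then obtain t p where x: "x = (t, p)" "0 \<le> t" "t \<le> 1" by auto
    have "norm x \<le> norm t + norm p" unfolding x(1) by (rule norm_Pair_le)
    also have "\<dots> \<le> 1 + (norm (pinch p) + 1)" using x(2,3) norm_diff_pinch [of p] by simp
    also have "norm (pinch p) \<le> norm (F x)" unfolding x(1) F_def by (simp add: norm_snd_le)
    finally show "norm x \<le> norm (F x) + 2" by simp
  qed (intro closed_Times closed_atLeastAtMost closed_UNIV)
  then have qF: "quotient_map (top_of_set ({0..1} \<times> UNIV)) (top_of_set ({0..1} \<times> range pinch)) F"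
    unfolding FU .
  have "continuous_on ({0..1} \<times> UNIV) K"
    unfolding K_def case_prod_unfold by (intro continuous_intros)
  then have "continuous_on ({0..1} \<times> UNIV) (H \<circ> F)"
    by (rule continuous_on_eq) (auto simp: HF)
  then have "continuous_map (top_of_set ({0..1} \<times> UNIV)) euclidean (H \<circ> F)" by simp
  then have cH: "continuous_map (top_of_set ({0..1} \<times> range pinch)) euclidean H"
    by (simp only: continuous_compose_quotient_map_eq [OF qF])
  have H_img: "H x \<in> range pinch" for x
    unfolding H_def K_def by (simp add: case_prod_unfold)
  have ca: "continuous_map euclidean euclidean a"
    unfolding a_def by (simp, intro continuous_intros)
  define b where "b = a \<circ> inv_pinch"
  have a_cong: "a p = a q" if pq: "pinch p = pinch q" for p q
    using pinch_eq_imp [OF pq]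
  proof (elim disjE exE conjE)
    fix i j u assume u: "0 < \<bar>u\<bar>" "\<bar>u\<bar> \<le> 1" "p = (4 * of_int i + u, of_int j)" "q = (4 * of_int i - u, of_int j)"
    then show ?thesis using wave [OF u(2)] by (simp add: a_def)
  qed simp
  have "b \<circ> pinch = a"
    using a_cong [OF inv] by (simp add: b_def fun_eq_iff)
  then have cb: "continuous_map (top_of_set (range pinch)) euclidean b"
    using ca by (simp only: continuous_compose_quotient_map_eq [OF quotient_map_pinch, symmetric])
  have H0: "H (0, x) = x" if x: "x \<in> range pinch" for x
  proof -
    obtain p where "x = pinch p" using x by (rule imageE)
    then show ?thesis using inv by (simp add: H_def K_def)
  qed
  have H1: "H (1, x) = (pinch \<circ> b) x" for x
    by (simp add: H_def K_def b_def a_def)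
  have "homotopic_with (\<lambda>x. True) (top_of_set (range pinch)) (top_of_set (range pinch)) id (pinch \<circ> b)"
  proof (subst homotopic_with, rule refl, intro exI [of _ H] conjI ballI TrueI)
    show "continuous_map (prod_topology (top_of_set {0..1}) (top_of_set (range pinch))) (top_of_set (range pinch)) H"
      unfolding prod_topology_subtopology_eu continuous_map_in_subtopology
      using cH H_img by (intro conjI image_subsetI) simp_all
    show "H (0, x) = id x" if "x \<in> topspace (top_of_set (range pinch))" for x
      using H0 [of x] that by simp
    show "H (1, x) = (pinch \<circ> b) x" for x by (rule H1)
  qed
  moreover have "\<exists>c. homotopic_with (\<lambda>x. True) (top_of_set (range pinch)) (top_of_set (range pinch)) (pinch \<circ> b) (\<lambda>x. c)"
  proof -
    have "contractible_space (top_of_set (UNIV :: (real \<times> real) set))"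
      by (simp only: contractible_space_top_of_set contractible_UNIV)
    then have ce: "contractible_space (euclidean :: (real \<times> real) topology)"
      by (simp only: subtopology_UNIV)
    have cp: "continuous_map euclidean (top_of_set (range pinch)) pinch"
      using quotient_map_pinch by (rule quotient_imp_continuous_map)
    obtain c where "homotopic_with (\<lambda>x. True) (top_of_set (range pinch)) (top_of_set (range pinch)) (pinch \<circ> b) (\<lambda>x. c)"
      by (rule nullhomotopic_through_contractible_space [OF cb cp ce])
    then show ?thesis by (rule exI)
  qed
  then obtain c where "homotopic_with (\<lambda>x. True) (top_of_set (range pinch)) (top_of_set (range pinch)) (pinch \<circ> b) (\<lambda>x. c)"
    by (rule exE)
  ultimately have "homotopic_with (\<lambda>x. True) (top_of_set (range pinch)) (top_of_set (range pinch)) id (\<lambda>x. c)"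
    by (rule homotopic_with_trans)
  then show ?thesis
    unfolding contractible_space_def pinched_plane_simps(1) by (rule exI)
qed

lemma simply_connected_if_contractible:
  assumes "contractible_space X" "topspace X \<noteq> {}"
  shows "simply_connected_space X"
  unfolding simply_connected_space_def
proof (intro conjI allI impI)
  show "path_connected_space X" using assms(1) by (rule contractible_imp_path_connected_space)
  fix p assume p: "pathin X p \<and> p 0 = p 1"
  obtain c where c: "homotopic_with (\<lambda>x. True) X X id (\<lambda>x. c)"
    using assms(1) unfolding contractible_space_def by (rule exE)
  \<comment> \<open>Each stage of the contraction is applied to \<open>p\<close>; since
    \<open>p 0 = p 1\<close>, every intermediate path is again a loop.\<close>
  have "homotopic_with (\<lambda>q. q 0 = q (1 :: real)) (top_of_set {0..1}) X (id \<circ> p) ((\<lambda>x. c) \<circ> p)"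
    by (rule homotopic_with_compose_continuous_map_right [OF c]) (use p in \<open>simp_all add: pathin_def\<close>)
  then have "homotopic_with (\<lambda>q. q 0 = q (1 :: real)) (top_of_set {0..1}) X p (\<lambda>_. c)"
    by (simp add: o_def)
  moreover have "c \<in> topspace X"
    using homotopic_with_imp_continuous_maps [OF c] assms(2) by (auto simp: continuous_map_def)
  ultimately show "\<exists>c\<in>topspace X. homotopic_with (\<lambda>q. q 0 = q 1) (top_of_set {0..1}) X p (\<lambda>_. c)" by blast
qed

section \<open>The translation action of the free abelian group of rank two\<close>

abbreviation Z2 :: "(nat \<Rightarrow>\<^sub>0 int) monoid" where
  "Z2 \<equiv> free_Abelian_group {0, 1}"

definition translation :: "(nat \<Rightarrow>\<^sub>0 int) \<Rightarrow> real \<times> real \<times> real" where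
  "translation g = (4 * of_int (Poly_Mapping.lookup g 0), of_int (Poly_Mapping.lookup g 1), 0)"

text \<open>The restriction makes the translations extensional functions, as the elements of
  \<open>BijGroup\<close> are.\<close>

definition translate :: "(nat \<Rightarrow>\<^sub>0 int) \<Rightarrow> real \<times> real \<times> real \<Rightarrow> real \<times> real \<times> real" where
  "translate g = restrict (\<lambda>x. x + translation g) (range pinch)"

lemma translation_add: "translation (g + g') = translation g + translation g'"
  by (simp add: translation_def lookup_add)

lemma pinch_add_translation:
  "pinch p + translation g =
    pinch (p + (4 * of_int (Poly_Mapping.lookup g 0), of_int (Poly_Mapping.lookup g 1)))"
  using pinch_translate [of "fst p" "Poly_Mapping.lookup g 0" "snd p" "Poly_Mapping.lookup g 1"]
  by (cases p) (simp add: translation_def)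

lemma add_translation_range: "x \<in> range pinch \<Longrightarrow> x + translation g \<in> range pinch"
  using pinch_add_translation by (metis imageE rangeI)

lemma translate_pinch:
  "translate g (pinch p) = pinch (p + (4 * of_int (Poly_Mapping.lookup g 0), of_int (Poly_Mapping.lookup g 1)))"
  by (simp add: translate_def pinch_add_translation)

lemma translate_region:
  "translate g ` (pinch ` region k) =
    pinch ` region (translate_cell (Poly_Mapping.lookup g 0) (Poly_Mapping.lookup g 1) k)"
proof -
  define m n where "m = Poly_Mapping.lookup g 0" and "n = Poly_Mapping.lookup g 1"
  have *: "region (translate_cell m n k) = (\<lambda>p. p + (4 * of_int m, of_int n)) ` region k"
  proof (intro equalityI subsetI)
    fix p assume "p \<in> region (translate_cell m n k)"
    then have "p - (4 * of_int m, of_int n) \<in> region k"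
      by (cases k; cases p) (simp_all add: algebra_simps)
    then show "p \<in> (\<lambda>p. p + (4 * of_int m, of_int n)) ` region k"
      by (rule rev_image_eqI) simp
  next
    fix p assume "p \<in> (\<lambda>p. p + (4 * of_int m, of_int n)) ` region k"
    then obtain q where "p = q + (4 * of_int m, of_int n)" "q \<in> region k" by (rule imageE)
    then show "p \<in> region (translate_cell m n k)"
      by (cases k; cases q) (simp_all add: algebra_simps)
  qed
  show ?thesis unfolding m_def [symmetric] n_def [symmetric] * image_image translate_pinch by simp
qed

lemma homeomorphic_map_translate:
  "homeomorphic_map (top_of_set (range pinch)) (top_of_set (range pinch)) (translate g)"
proof -
  have c: "continuous_on (range pinch) (translate g)" for g
    unfolding translate_def by (rule continuous_on_eq [of _ "\<lambda>x. x + translation g"]) (auto intro!: continuous_intros)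
  have t: "translate g x \<in> range pinch" "translate (- g) (translate g x) = x" if "x \<in> range pinch" for x g
  proof -
    have 0: "translation g + translation (- g) = 0" using translation_add [of g "- g"] by (simp add: translation_def zero_prod_def)
    show "translate g x \<in> range pinch" using add_translation_range [OF that] that by (simp add: translate_def)
    show "translate (- g) (translate g x) = x"
      using add_translation_range [OF that] that 0 by (simp add: translate_def add.assoc)
  qed
  have "homeomorphic_maps (top_of_set (range pinch)) (top_of_set (range pinch)) (translate g) (translate (- g))"
    unfolding homeomorphic_maps_def
    using c t t [of _ "- g"] by (simp add: image_subset_iff_funcset [symmetric] image_subset_iff)
  then show ?thesis using homeomorphic_map_maps by metis
qed

lemma combinatorial_automorphism_translate: "combinatorial_automorphism pinched_plane (translate g)"
  unfolding combinatorial_automorphism_def combinatorial_map_def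
proof (intro conjI ballI)
  have hom: "homeomorphic_map (cw_space pinched_plane) (cw_space pinched_plane) (translate g)"
    unfolding pinched_plane_simps by (rule homeomorphic_map_translate)
  then show "homeomorphic_map (cw_space pinched_plane) (cw_space pinched_plane) (translate g)" .
  show "continuous_map (cw_space pinched_plane) (cw_space pinched_plane) (translate g)"
    using hom by (rule homeomorphic_imp_continuous_map)
  fix c assume "c \<in> open_cells pinched_plane"
  then obtain k where c: "c = pinch ` region k" unfolding open_cells_pinched_plane by (rule imageE)
  let ?d = "pinch ` region (translate_cell (Poly_Mapping.lookup g 0) (Poly_Mapping.lookup g 1) k)"
  have "translate g ` (topspace (cw_space pinched_plane) \<inter> c) = topspace (cw_space pinched_plane) \<inter> ?d"
  proof -
    have "topspace (cw_space pinched_plane) \<inter> pinch ` R = pinch ` R" for R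
      by (simp add: pinched_plane_simps Int_absorb1 image_mono)
    then show ?thesis unfolding c by (simp only: translate_region)
  qed
  with hom have "homeomorphic_map (subtopology (cw_space pinched_plane) c) (subtopology (cw_space pinched_plane) ?d) (translate g)"
    by (rule homeomorphic_map_subtopologies)
  moreover have "?d \<in> open_cells pinched_plane" unfolding open_cells_pinched_plane by (rule rangeI)
  ultimately show "\<exists>d\<in>open_cells pinched_plane.
      homeomorphic_map (subtopology (cw_space pinched_plane) c) (subtopology (cw_space pinched_plane) d) (translate g)"
    by (rule rev_bexI [rotated])
qed

lemma group_action_translate: "group_action Z2 (range pinch) translate"
  unfolding group_action_def group_hom_def group_hom_axioms_def
proof (intro conjI group_free_Abelian_group group_BijGroup homI)
  have bij: "translate g \<in> Bij (range pinch)" for g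
  proof -
    have "bij_betw (translate g) (range pinch) (range pinch)"
      using homeomorphic_map_translate [of g] unfolding homeomorphic_eq_everything_map bij_betw_def by simp
    then show ?thesis by (simp add: Bij_def translate_def)
  qed
  show "translate g \<in> carrier (BijGroup (range pinch))" for g
    by (simp add: BijGroup_def bij)
  show "translate (g \<otimes>\<^bsub>Z2\<^esub> g') = translate g \<otimes>\<^bsub>BijGroup (range pinch)\<^esub> translate g'" for g g'
  proof -
    have "translate (g + g') = compose (range pinch) (translate g) (translate g')"
    proof
      fix x
      show "translate (g + g') x = compose (range pinch) (translate g) (translate g') x"
      proof (cases "x \<in> range pinch")
        case True
        then show ?thesis
          using add_translation_range [OF True, of g']
          by (simp add: compose_def translate_def translation_add add_ac)
      next
        case False
        then show ?thesis by (simp add: compose_def translate_def)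
      qed
    qed
    then show ?thesis by (simp add: BijGroup_def bij)
  qed
qed

lemma combinatorial_action_translate: "combinatorial_action Z2 pinched_plane translate"
  unfolding combinatorial_action_def pinched_plane_simps topspace_euclidean_subtopology
  using group_action_translate combinatorial_automorphism_translate by simp

lemma poly_mapping_01_eqI:
  assumes "Poly_Mapping.keys g \<subseteq> {0, 1 :: nat}" "Poly_Mapping.keys g' \<subseteq> {0, 1}"
    "Poly_Mapping.lookup g 0 = Poly_Mapping.lookup g' 0" "Poly_Mapping.lookup g 1 = Poly_Mapping.lookup g' 1"
  shows "g = g'"
proof (rule poly_mapping_eqI)
  fix k
  show "Poly_Mapping.lookup g k = Poly_Mapping.lookup g' k"
  proof (cases "k \<in> {0, 1}")
    case True then show ?thesis using assms(3,4) by (elim insertE) simp_all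
  next
    case False
    then have "k \<notin> Poly_Mapping.keys g" "k \<notin> Poly_Mapping.keys g'" using assms(1,2) by blast+
    then show ?thesis by (simp add: in_keys_iff)
  qed
qed

lemma proper_action_translate: "proper_action Z2 pinched_plane translate"
  unfolding proper_action_def
proof (intro allI impI)
  fix K assume K: "compactin (cw_space pinched_plane) K"
  then have "compact K" "K \<subseteq> range pinch" by (simp_all add: pinched_plane_simps compactin_subtopology)
  then obtain b where b: "\<And>x. x \<in> K \<Longrightarrow> norm x \<le> b" using compact_imp_bounded bounded_iff by metis
  define N where "N = \<lceil>2 * b\<rceil>"
  define M where "M = (\<lambda>g :: nat \<Rightarrow>\<^sub>0 int. (Poly_Mapping.lookup g 0, Poly_Mapping.lookup g 1))"
  let ?G = "{g \<in> carrier Z2. translate g ` K \<inter> K \<noteq> {}}"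
  have "M ` ?G \<subseteq> {-N..N} \<times> {-N..N}"
  proof (rule image_subsetI)
    fix g assume "g \<in> ?G"
    then have "\<exists>x\<in>K. translate g x \<in> K" by blast
    then obtain x where x: "x \<in> K" "translate g x \<in> K" by (rule bexE)
    then have "x + translation g \<in> K" using \<open>K \<subseteq> range pinch\<close> by (auto simp: translate_def)
    \<comment> \<open>The translation is the difference of two points of \<open>K\<close>, each of
      norm at most \<open>b\<close>.\<close>
    then have "norm (translation g) \<le> 2 * b"
      using norm_triangle_ineq4 [of "x + translation g" x] b [of x] b [of "x + translation g"] x(1) by simp
    then have 1: "\<bar>4 * real_of_int (Poly_Mapping.lookup g 0)\<bar> \<le> 2 * b" "norm (snd (translation g)) \<le> 2 * b"
      using norm_fst_le [of "fst (translation g)" "snd (translation g)"] norm_snd_le [of "snd (translation g)" "fst (translation g)"]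
      by (simp_all add: translation_def)
    then have 2: "\<bar>real_of_int (Poly_Mapping.lookup g 1)\<bar> \<le> 2 * b"
      by (simp add: translation_def norm_Pair)
    have "\<bar>real_of_int (Poly_Mapping.lookup g 0)\<bar> \<le> of_int N" "\<bar>real_of_int (Poly_Mapping.lookup g 1)\<bar> \<le> of_int N"
      using 1(1) 2 le_of_int_ceiling [of "2 * b"] unfolding N_def by linarith+
    then have "\<bar>Poly_Mapping.lookup g 0\<bar> \<le> N" "\<bar>Poly_Mapping.lookup g 1\<bar> \<le> N"
      by (metis of_int_abs of_int_le_iff)+
    then show "M g \<in> {-N..N} \<times> {-N..N}" by (simp add: M_def abs_le_iff)
  qed
  then have "finite (M ` ?G)" by (rule finite_subset) simp
  moreover have "inj_on M ?G"
  proof (rule inj_onI)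
    fix g g' assume "g \<in> ?G" "g' \<in> ?G" "M g = M g'"
    then show "g = g'" by (intro poly_mapping_01_eqI) (simp_all add: M_def)
  qed
  ultimately show "finite ?G" by (rule finite_imageD)
qed

lemma cocompact_action_translate: "cocompact_action Z2 pinched_plane translate"
  unfolding cocompact_action_def
proof (intro exI [of _ "pinch ` rect 0 0"] conjI equalityI subsetI)
  have "compact (pinch ` rect 0 0)"
    by (intro compact_continuous_image continuous_on_pinch continuous_on_id compact_rect)
  then show "compactin (cw_space pinched_plane) (pinch ` rect 0 0)"
    by (simp add: pinched_plane_simps compactin_subtopology image_mono)
next
  fix y assume "y \<in> (\<Union>g\<in>carrier Z2. translate g ` pinch ` rect 0 0)"
  then obtain g p where "y = translate g (pinch p)" by blast
  then show "y \<in> topspace (cw_space pinched_plane)" by (simp add: pinched_plane_simps translate_pinch)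
next
  fix y assume "y \<in> topspace (cw_space pinched_plane)"
  then obtain p where y: "y = pinch p" by (auto simp: pinched_plane_simps)
  define i j where "i = \<lfloor>fst p / 4\<rfloor>" and "j = \<lfloor>snd p\<rfloor>"
  define g where "g = Poly_Mapping.single (0 :: nat) i + Poly_Mapping.single 1 j"
  have g01: "Poly_Mapping.lookup g 0 = i" "Poly_Mapping.lookup g 1 = j"
    by (simp_all add: g_def lookup_add lookup_single)
  have "Poly_Mapping.keys g \<subseteq> {0, 1}"
    unfolding g_def by (rule order_trans [OF keys_add]) auto
  then have gG: "g \<in> carrier Z2" by simp
  define q where "q = p - (4 * of_int i, of_int j)"
  have "of_int i \<le> fst p / 4" "fst p / 4 < of_int i + 1" "of_int j \<le> snd p" "snd p < of_int j + 1"
    unfolding i_def j_def by linarith+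
  then have "q \<in> rect 0 0" unfolding q_def rect_def by (cases p) simp
  moreover have "y = translate g (pinch q)" unfolding translate_pinch g01 y q_def by simp
  ultimately show "y \<in> (\<Union>g\<in>carrier Z2. translate g ` pinch ` rect 0 0)" using gG by blast
qed

text \<open>\<open>free_abelian\<close> asks for a basis in the type of the group elements, so the
  index set of two numbers is exchanged for an equipotent set of two group elements.\<close>

lemma free_abelian_Z2: "free_abelian Z2"
proof -
  have "{0, 1 :: nat} \<approx> {0, frag_of (0 :: nat)}"
    by (intro eqpoll_iff_card [THEN iffD2]) (simp_all add: frag_of_nonzero [symmetric] eq_commute)
  then have "Z2 \<cong> free_Abelian_group {0, frag_of (0 :: nat)}"
    by (simp only: isomorphic_free_Abelian_groups)
  then show ?thesis
    unfolding free_abelian_def by (intro conjI group_free_Abelian_group exI)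
qed

lemma lookup_pow_Z2: "g \<in> carrier Z2 \<Longrightarrow> Poly_Mapping.lookup (g [^]\<^bsub>Z2\<^esub> (n :: int)) k = n * Poly_Mapping.lookup g k"
  by (simp add: lookup_frag_cmul)

lemma not_cyclic_Z2: "\<not> cyclic_group Z2"
proof
  assume "cyclic_group Z2"
  then obtain a where a: "a \<in> carrier Z2" "carrier Z2 = range (\<lambda>n :: int. a [^]\<^bsub>Z2\<^esub> n)"
    unfolding group.cyclic_group [OF group_free_Abelian_group] by (rule bexE)
  have "Poly_Mapping.single 0 1 \<in> carrier Z2" "Poly_Mapping.single 1 1 \<in> carrier Z2" by simp_all
  then obtain m n :: int where "Poly_Mapping.single 0 1 = a [^]\<^bsub>Z2\<^esub> m" "Poly_Mapping.single 1 1 = a [^]\<^bsub>Z2\<^esub> n"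
    unfolding a(2) by (metis imageE)
  then have mn: "Poly_Mapping.lookup (Poly_Mapping.single (0 :: nat) 1) k = m * Poly_Mapping.lookup a k"
    "Poly_Mapping.lookup (Poly_Mapping.single (1 :: nat) 1) k = n * Poly_Mapping.lookup a k" for k
    by (simp_all only: lookup_pow_Z2 [OF a(1)])
  \<comment> \<open>By the first equation \<open>m\<close> is not zero, so the second makes the
    coordinate of \<open>a\<close> at 1 vanish, against the third.\<close>
  have "m * Poly_Mapping.lookup a 0 = 1" "m * Poly_Mapping.lookup a 1 = 0" "n * Poly_Mapping.lookup a 1 = 1"
    using mn(1) [of 0] mn(1) [of 1] mn(2) [of 1] unfolding lookup_single when_def by simp_all
  then show False by auto
qed

text \<open>Faces that meet have a corner of the lattice in common, hence the whole hair ending there.\<close>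

lemma faces_meet_in_hair:
  assumes "pinch ` rect i j \<inter> pinch ` rect i' j' \<noteq> {}"
  shows "pinch ` rect i j \<inter> pinch ` rect i' j' \<noteq> {w}"
proof -
  have hair: "pinch ` ({4 * of_int a..4 * of_int a + 1} \<times> {of_int b}) \<subseteq> pinch ` rect k l"
    if ab: "(4 * of_int a, of_int b) \<in> rect k l" for a b k l
  proof -
    have r: "real_of_int k \<le> of_int a" "real_of_int a \<le> of_int k + 1" "real_of_int l \<le> of_int b" "real_of_int b \<le> of_int l + 1"
      using ab by (simp_all add: rect_def)
    then have "a = k \<or> a = k + 1" by linarith
    then show ?thesis
    proof
      assume "a = k"
      then show ?thesis using r by (intro image_mono) (auto simp: rect_def)
    next
      \<comment> \<open>At a right corner the tile contains the left half of the folded segment,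
        which has the same image as the right half.\<close>
      assume "a = k + 1"
      then show ?thesis using r unfolding pinch_fold_image [symmetric] by (intro image_mono) (auto simp: rect_def)
    qed
  qed
  have "\<exists>a b. (4 * of_int a, of_int b) \<in> rect i j \<and> (4 * of_int a, of_int b) \<in> rect i' j'"
  proof -
    obtain x where x: "x \<in> pinch ` rect i j" "x \<in> pinch ` rect i' j'" using assms by blast
    obtain p where p: "x = pinch p" "p \<in> rect i j" using x(1) by (rule imageE)
    obtain q where q: "x = pinch q" "q \<in> rect i' j'" using x(2) by (rule imageE)
    have "pinch p = pinch q" using p q by simp
    from pinch_eq_imp [OF this] show ?thesis
    proof (elim disjE exE conjE)
      assume "p = q"
      then have r: "4 * real_of_int i \<le> fst p" "fst p \<le> 4 * of_int i + 4" "of_int j \<le> snd p" "snd p \<le> of_int j + 1"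
        "4 * real_of_int i' \<le> fst p" "fst p \<le> 4 * of_int i' + 4" "of_int j' \<le> snd p" "snd p \<le> of_int j' + 1"
        using p(2) q(2) by (simp_all add: rect_def mem_Times_iff)
      have "real_of_int i < of_int i' + 2" "real_of_int i' < of_int i + 2"
        "real_of_int j < of_int j' + 2" "real_of_int j' < of_int j + 2" using r by linarith+
      then have i: "i \<le> i' + 1" "i' \<le> i + 1" "j \<le> j' + 1" "j' \<le> j + 1" by linarith+
      \<comment> \<open>The lower left corner of the intersection of the two rectangles.\<close>
      have "(4 * of_int (max i i'), of_int (max j j')) \<in> rect i j" "(4 * of_int (max i i'), of_int (max j j')) \<in> rect i' j'"
        using i by (auto simp: rect_def max_def)
      then show ?thesis by blast
    next
      fix a b u assume u: "0 < \<bar>u\<bar>" "\<bar>u\<bar> \<le> 1" "p = (4 * of_int a + u, of_int b)" "q = (4 * of_int a - u, of_int b)"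
      \<comment> \<open>Tiles begin and end at multiples of 4, so a tile that reaches within
        distance 1 of the fold along the line contains its centre.\<close>
      have "(4 * of_int a, of_int b) \<in> rect k l" if r: "(4 * of_int a + v, of_int b) \<in> rect k l" "\<bar>v\<bar> \<le> 1" for v :: real and k l
      proof -
        have "real_of_int k < of_int a + 1" "real_of_int a < of_int k + 2" using r by (auto simp: rect_def abs_le_iff)
        then have "k \<le> a" "a \<le> k + 1" by linarith+
        then show ?thesis using r(1) by (simp add: rect_def)
      qed
      then have "(4 * of_int a, of_int b) \<in> rect i j" "(4 * of_int a, of_int b) \<in> rect i' j'"
        using p(2) q(2) u(2) unfolding u(3,4) by (metis, metis abs_minus_cancel add_uminus_conv_diff)
      then show ?thesis by blast
    qed
  qed
  then obtain a b where ab: "(4 * of_int a, of_int b) \<in> rect i j" "(4 * of_int a, of_int b) \<in> rect i' j'" by (elim exE conjE)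
  have sub: "pinch ` ({4 * of_int a..4 * of_int a + 1} \<times> {of_int b}) \<subseteq> pinch ` rect i j \<inter> pinch ` rect i' j'"
    using hair [OF ab(1)] hair [OF ab(2)] by (rule Int_greatest)
  have in2: "pinch (4 * of_int a + t, of_int b) \<in> pinch ` rect i j \<inter> pinch ` rect i' j'" if "t \<in> {0..1}" for t
    using that by (intro subsetD [OF sub] imageI) simp
  \<comment> \<open>The two ends of the hair, a tip and a root, are different cells; hence the
    intersection has more than one point.\<close>
  have ne: "pinch (4 * of_int a + 0, of_int b) \<noteq> pinch (4 * of_int a + 1, of_int b)"
    using region_unique [of "(4 * of_int a + 0, of_int b)" "Tip a b" "(4 * of_int a + 1, of_int b)" "Root a b"] by auto
  show ?thesis
  proof
    assume "pinch ` rect i j \<inter> pinch ` rect i' j' = {w}"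
    then show False using in2 [of 0] in2 [of 1] ne by simp
  qed
qed

section \<open>Absence of flat planes and the final assembly\<close>

lemma no_flat_plane: "\<not> flat_plane (restrict_complex pinched_plane S)"
proof
  let ?E = "restrict_complex pinched_plane S"
  assume E: "flat_plane ?E"
  have sub: "cells2 ?E \<subseteq> cells2 pinched_plane" by (auto simp: restrict_complex_def)
  obtain f where f: "f \<in> cells2 ?E"
    using E unfolding flat_plane_def C4_T4_complex_def two_complex_def by (metis ex_in_conv)
  have "f \<in> cells2 pinched_plane" using sub f by (rule subsetD)
  then obtain i j where fij: "f = face i j" by (auto simp: pinched_plane_simps)
  have "\<not> (\<exists>v\<in>cells0 ?E. f ` cball 0 1 \<inter> g ` cball 0 1 = {v})" if g: "g \<in> neighbours ?E f" for g
  proof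
    assume "\<exists>v\<in>cells0 ?E. f ` cball 0 1 \<inter> g ` cball 0 1 = {v}"
    then obtain v where v: "f ` cball 0 1 \<inter> g ` cball 0 1 = {v}" by (rule bexE)
    have "g \<in> cells2 pinched_plane" using g subsetD [OF sub] by (simp add: neighbours_def)
    then obtain k l where gkl: "g = face k l" by (auto simp: pinched_plane_simps)
    show False using v faces_meet_in_hair [of i j k l v] unfolding fij gkl face_cball by simp
  qed
  then have e: "{g \<in> neighbours ?E f. \<exists>v\<in>cells0 ?E. f ` cball 0 1 \<inter> g ` cball 0 1 = {v}} = {}" by blast
  have c: "card {g \<in> neighbours ?E f. \<exists>v\<in>cells0 ?E. f ` cball 0 1 \<inter> g ` cball 0 1 = {v}} = 4"
    using E f unfolding flat_plane_def by (elim conjE) (drule bspec, assumption, elim conjE)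
  from c [unfolded e] show False by simp
qed

theorem proposition7p7:
  shows "\<exists>(X :: (real \<times> real \<times> real) cell_complex) (G :: (nat \<Rightarrow>\<^sub>0 int) monoid) \<phi>.
    C4_T4_complex X \<and> simply_connected_space (cw_space X) \<and>
    free_abelian G \<and> \<not> cyclic_group G \<and>
    combinatorial_action G X \<phi> \<and> proper_action G X \<phi> \<and> cocompact_action G X \<phi> \<and>
    \<not> (\<exists>S. is_subcomplex S X \<and> (\<forall>g\<in>carrier G. \<phi> g ` S = S) \<and>
          flat_plane (restrict_complex X S))"
proof (intro exI conjI)
  show "C4_T4_complex pinched_plane"
    unfolding C4_T4_complex_def
    by (intro conjI two_complex_pinched_plane C_condition_pinched_plane T_condition_pinched_plane)
  have "topspace (cw_space pinched_plane) \<noteq> {}" by (simp add: pinched_plane_simps)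
  then show "simply_connected_space (cw_space pinched_plane)"
    by (rule simply_connected_if_contractible [OF contractible_space_pinched_plane])
  show "\<not> (\<exists>S. is_subcomplex S pinched_plane \<and> (\<forall>g\<in>carrier Z2. translate g ` S = S) \<and>
          flat_plane (restrict_complex pinched_plane S))"
    using no_flat_plane by (metis (no_types, lifting))
qed (rule free_abelian_Z2 not_cyclic_Z2 combinatorial_action_translate proper_action_translate
    cocompact_action_translate)+

end
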